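(* Let $m,n,a,b,c\in\mathbb Z_{\ge0}$ with $m\ge c$, $n-b+c\ge0$, and put $\alpha:=m-n+b-2c+\varsigma_2$. Assume $\alpha>0$, $\alpha$ is even, and $b>a+c$. Then in $L(m,n)$ $$B^{(a)}_{1}B^{(b)}_{2}B^{(c)}_{1}\eta=[\alpha]\sum_{\substack{0\le k\le c\\ k\ \mathrm{even}}}\frac{[\alpha-k+2][\alpha-k+4]\cdots[\alpha+k-2]}{[k]!}\mathfrak{B}^{(a,b-k,c-k)}_{2}+\sum_{\substack{0\le k\le c\\ k\ \mathrm{odd}}}\frac{[\alpha-k+1][\alpha-k+3]\cdots[\alpha+k-1]}{[k]!}\mathfrak{B}^{(a,b-k,c-k)}_{2}$$ and $$\mathfrak{B}_{2}^{(a,b,c)}=\sum_{k=0}^{c}(-1)^{k}\frac{[\alpha][\alpha+2]\cdots[\alpha+2k-2]}{[k]!}B_{1}^{(a)}B^{(b-k)}_{2}B^{(c-k)}_{1}\eta.$$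
   Context: Conventions: products written with dots run in steps of $2$ ($[\alpha-k+2]\cdots[\alpha+k-2]$ has $k-1$ factors), and the full coefficient of each $k=0$ term (including the prefactor $[\alpha]$) is $1$. For $r\in\mathbb Z$: $[r]=\frac{q^r-q^{-r}}{q-q^{-1}}$; $[r]!=[1]\cdots[r]$, $[0]!=1$; $X^{(r)}=X^r/[r]!$ for $r\ge0$ and $X^{(r)}=0$ for $r<0$. $\mathbf U=U_q(\mathfrak{sl}_3)$ is the $\mathbb Q(q)$-algebra generated by $E_i,F_i,K_i^{\pm1}$, $i\in\{1,2\}$, with $K_1K_2=K_2K_1$, $K_iE_jK_i^{-1}=q^{a_{ij}}E_j$, $K_iF_jK_i^{-1}=q^{-a_{ij}}F_j$ ($a_{ii}=2$, $a_{12}=a_{21}=-1$), $E_iF_j-F_jE_i=\delta_{ij}\frac{K_i-K_i^{-1}}{q-q^{-1}}$, and for $i\ne j$ the Serre relations $E_jE_i^{(2)}-E_iE_jE_i+E_i^{(2)}E_j=0$, $F_jF_i^{(2)}-F_iF_jF_i+F_i^{(2)}F_j=0$. $\tau$ swaps $1$ and $2$. The parameter is $\varsigma=(\varsigma_1,\varsigma_2)\in\{(1,0),(0,1)\}$. $\mathbf U^\imath$ is the subalgebra of $\mathbf U$ generated by $B_i=F_i+q^{\varsigma_i}E_{\tau i}K_i^{-1}$, $k_i=K_iK_{\tau i}^{-1}$. $\psi^\imath$ is the $\mathbb Q$-algebra automorphism of $\mathbf U^\imath$ with $q\mapsto q^{-1}$, $B_i\mapsto B_i$, $k_i\mapsto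 k_i^{-1}$. $L(m,n)$ is the simple $\mathbf U$-module of highest weight $m\omega_1+n\omega_2$ with highest weight vector $\eta$; $\psi^\imath$ also denotes the anti-linear involution of $L(m,n)=\mathbf U^\imath\eta$ with $\psi^\imath(u\eta)=\psi^\imath(u)\eta$. iCanonical basis: for $a,b,c\ge0$, $b\ge a+c$ with $F_1^{(a)}F_2^{(b)}F_1^{(c)}\eta\neq0$ (equivalently $c\le m$, $b-c\le n$), $\mathfrak B_2^{(a,b,c)}\in L(m,n)$ is the unique $\psi^\imath$-invariant element of $F_1^{(a)}F_2^{(b)}F_1^{(c)}\eta+\sum_{x,y\ge0,(x,y)\ne(0,0)}q^{-1}\mathbb Z[q^{-1}]F_1^{(a-x)}F_2^{(b-x-y)}F_1^{(c-y)}\eta$. *)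

theory Defs
  imports
    "HOL-Library.Poly_Mapping"
    "HOL-Computational_Algebra.Polynomial"
    "HOL-Computational_Algebra.Fraction_Field"
begin

type_synonym qfield = "rat poly fract"

definition qq :: qfield where
  "qq = Fract [:0, 1:] 1"

definition qint :: "int \<Rightarrow> qfield" where
  "qint r = (qq powi r - qq powi (- r)) / (qq - qq powi (- 1))"

definition qfact :: "nat \<Rightarrow> qfield" where
  "qfact r = (\<Prod>i = 1..r. qint (int i))"

definition qstep :: "int \<Rightarrow> nat \<Rightarrow> qfield" where
  "qstep s l = (\<Prod>j<l. qint (s + 2 * int j))"

definition qinv_Z_qinv :: "qfield set" where
  "qinv_Z_qinv = range (\<lambda>p :: int poly. inverse qq * poly (map_poly of_int p) (inverse qq))"

datatype idx = I1 | I2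

fun tau :: "idx \<Rightarrow> idx" where
  "tau I1 = I2"
| "tau I2 = I1"

definition cartan :: "idx \<Rightarrow> idx \<Rightarrow> int" where
  "cartan i j = (if i = j then 2 else - 1)"

text \<open>The free associative algebra on the letters below is the monoid algebra of the free monoid
  of words; words are wrapped in a type of their own so that concatenation can be the \<open>monoid_add\<close>
  structure used by the convolution product of \<^theory>\<open>HOL-Library.Poly_Mapping\<close>.\<close>

datatype letter = LE idx | LF idx | LK idx | LKinv idx

datatype word = Word (letters: "letter list")

instantiation word :: monoid_add
begin

definition zero_word :: word where
  "0 = Word []"

definition plus_word :: "word \<Rightarrow> word \<Rightarrow> word" where
  "u + v = Word (letters u @ letters v)"

instance
  by standard (auto simp: zero_word_def plus_word_def)

end

type_synonym free_alg = "word \<Rightarrow>\<^sub>0 qfield"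

definition fgen :: "letter \<Rightarrow> free_alg" where
  "fgen x = Poly_Mapping.single (Word [x]) 1"

definition fscal :: "qfield \<Rightarrow> free_alg" where
  "fscal c = Poly_Mapping.single 0 c"

abbreviation "fE i \<equiv> fgen (LE i)"
abbreviation "fF i \<equiv> fgen (LF i)"
abbreviation "fK i \<equiv> fgen (LK i)"
abbreviation "fKinv i \<equiv> fgen (LKinv i)"

text \<open>The two-sided ideal generated by the defining relations (left hand side minus right hand
  side).\<close>

inductive_set uq_ideal :: "free_alg set" where
  K_Kinv: "fK i * fKinv i - 1 \<in> uq_ideal"
| Kinv_K: "fKinv i * fK i - 1 \<in> uq_ideal"
| K_K: "fK I1 * fK I2 - fK I2 * fK I1 \<in> uq_ideal"
| K_E: "fK i * fE j * fKinv i - fscal (qq powi cartan i j) * fE j \<in> uq_ideal"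
| K_F: "fK i * fF j * fKinv i - fscal (qq powi (- cartan i j)) * fF j \<in> uq_ideal"
| E_F: "fE i * fF j - fF j * fE i
    - (if i = j then fscal (1 / (qq - qq powi (- 1))) * (fK i - fKinv i) else 0) \<in> uq_ideal"
| Serre_E: "i \<noteq> j \<Longrightarrow>
    fE j * (fscal (1 / qfact 2) * fE i ^ 2) - fE i * fE j * fE i
    + (fscal (1 / qfact 2) * fE i ^ 2) * fE j \<in> uq_ideal"
| Serre_F: "i \<noteq> j \<Longrightarrow>
    fF j * (fscal (1 / qfact 2) * fF i ^ 2) - fF i * fF j * fF i
    + (fscal (1 / qfact 2) * fF i ^ 2) * fF j \<in> uq_ideal"
| zero: "0 \<in> uq_ideal"
| add: "x \<in> uq_ideal \<Longrightarrow> y \<in> uq_ideal \<Longrightarrow> x + y \<in> uq_ideal"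
| mult_left: "x \<in> uq_ideal \<Longrightarrow> u * x \<in> uq_ideal"
| mult_right: "x \<in> uq_ideal \<Longrightarrow> x * u \<in> uq_ideal"

lemma uq_ideal_uminus: "x \<in> uq_ideal \<Longrightarrow> - x \<in> uq_ideal"
  using uq_ideal.mult_left[of x "- 1"] by simp

lemma uq_ideal_diff: "x \<in> uq_ideal \<Longrightarrow> y \<in> uq_ideal \<Longrightarrow> x - y \<in> uq_ideal"
  using uq_ideal.add[of x "- y"] uq_ideal_uminus by simp

quotient_type uq = free_alg / "\<lambda>x y. x - y \<in> uq_ideal"
proof (rule equivpI)
  show "reflp (\<lambda>x y. x - y \<in> uq_ideal)"
    by (rule reflpI) (simp add: uq_ideal.zero)
  show "symp (\<lambda>x y. x - y \<in> uq_ideal)"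
    by (rule sympI) (metis minus_diff_eq uq_ideal_uminus)
  show "transp (\<lambda>x y. x - y \<in> uq_ideal)"
  proof (rule transpI)
    fix x y z assume "x - y \<in> uq_ideal" "y - z \<in> uq_ideal"
    from uq_ideal.add[OF this] show "x - z \<in> uq_ideal" by simp
  qed
qed

instantiation uq :: ring
begin

lift_definition zero_uq :: uq is 0 .

lift_definition plus_uq :: "uq \<Rightarrow> uq \<Rightarrow> uq" is "(+)"
  by (simp only: add_diff_add uq_ideal.add)

lift_definition uminus_uq :: "uq \<Rightarrow> uq" is uminus
  by (simp only: minus_diff_minus uq_ideal_uminus)

lift_definition minus_uq :: "uq \<Rightarrow> uq \<Rightarrow> uq" is "(-)"
proof -
  fix x x' y y' :: free_alg
  assume "x - x' \<in> uq_ideal" "y - y' \<in> uq_ideal"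
  then have "(x - x') - (y - y') \<in> uq_ideal"
    by (rule uq_ideal_diff)
  then show "x - y - (x' - y') \<in> uq_ideal"
    by (simp add: algebra_simps)
qed

lift_definition times_uq :: "uq \<Rightarrow> uq \<Rightarrow> uq" is "(*)"
proof -
  fix x x' y y' :: free_alg
  assume "x - x' \<in> uq_ideal" "y - y' \<in> uq_ideal"
  then have "(x - x') * y + x' * (y - y') \<in> uq_ideal"
    by (intro uq_ideal.intros)
  then show "x * y - x' * y' \<in> uq_ideal"
    by (simp add: algebra_simps)
qed

instance
  by standard (transfer; simp add: algebra_simps uq_ideal.zero)+

end

instantiation uq :: monoid_mult
begin

lift_definition one_uq :: uq is 1 .

instance
  by standard (transfer; simp add: uq_ideal.zero)+

end

lift_definition scal :: "qfield \<Rightarrow> uq" is fscal .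
lift_definition uE :: "idx \<Rightarrow> uq" is "\<lambda>i. fE i" .
lift_definition uF :: "idx \<Rightarrow> uq" is "\<lambda>i. fF i" .
lift_definition uK :: "idx \<Rightarrow> uq" is "\<lambda>i. fK i" .
lift_definition uKinv :: "idx \<Rightarrow> uq" is "\<lambda>i. fKinv i" .

definition divpow :: "uq \<Rightarrow> int \<Rightarrow> uq" where
  "divpow X r = (if r < 0 then 0 else scal (1 / qfact (nat r)) * X ^ nat r)"

fun par :: "int \<times> int \<Rightarrow> idx \<Rightarrow> int" where
  "par \<sigma> I1 = fst \<sigma>"
| "par \<sigma> I2 = snd \<sigma>"

definition iB :: "int \<times> int \<Rightarrow> idx \<Rightarrow> uq" where
  "iB \<sigma> i = uF i + scal (qq powi par \<sigma> i) * uE (tau i) * uKinv i"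

definition ik :: "idx \<Rightarrow> uq" where
  "ik i = uK i * uKinv (tau i)"

definition ikinv :: "idx \<Rightarrow> uq" where
  "ikinv i = uK (tau i) * uKinv i"

text \<open>No separate generator is needed for \<open>k\<^sub>i\<^sup>-\<^sup>1\<close>, which equals \<open>k\<close> at the other index.\<close>

inductive_set Ui :: "int \<times> int \<Rightarrow> uq set" for \<sigma> where
  scal: "scal c \<in> Ui \<sigma>"
| iB: "iB \<sigma> i \<in> Ui \<sigma>"
| ik: "ik i \<in> Ui \<sigma>"
| add: "x \<in> Ui \<sigma> \<Longrightarrow> y \<in> Ui \<sigma> \<Longrightarrow> x + y \<in> Ui \<sigma>"
| mult: "x \<in> Ui \<sigma> \<Longrightarrow> y \<in> Ui \<sigma> \<Longrightarrow> x * y \<in> Ui \<sigma>"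

text \<open>These conditions determine \<open>\<psi>\<close> on \<open>U\<^sup>\<imath>\<close>; nothing is required of its values elsewhere.\<close>

definition is_psi_i :: "int \<times> int \<Rightarrow> (uq \<Rightarrow> uq) \<Rightarrow> bool" where
  "is_psi_i \<sigma> \<psi> \<longleftrightarrow>
     bij_betw \<psi> (Ui \<sigma>) (Ui \<sigma>) \<and>
     (\<forall>x\<in>Ui \<sigma>. \<forall>y\<in>Ui \<sigma>. \<psi> (x + y) = \<psi> x + \<psi> y) \<and>
     (\<forall>x\<in>Ui \<sigma>. \<forall>y\<in>Ui \<sigma>. \<psi> (x * y) = \<psi> x * \<psi> y) \<and>
     (\<forall>r :: rat. \<psi> (scal (Fract [:r:] 1)) = scal (Fract [:r:] 1)) \<and>
     \<psi> (scal qq) = scal (inverse qq) \<and>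
     (\<forall>i. \<psi> (iB \<sigma> i) = iB \<sigma> i) \<and>
     (\<forall>i. \<psi> (ik i) = ikinv i)"

definition uq_module :: "(uq \<Rightarrow> 'v::ab_group_add \<Rightarrow> 'v) \<Rightarrow> bool" where
  "uq_module act \<longleftrightarrow>
     (\<forall>u v w. act u (v + w) = act u v + act u w) \<and>
     (\<forall>x y v. act (x + y) v = act x v + act y v) \<and>
     (\<forall>x y v. act (x * y) v = act x (act y v)) \<and>
     (\<forall>v. act 1 v = v)"

definition uq_submodule :: "(uq \<Rightarrow> 'v::ab_group_add \<Rightarrow> 'v) \<Rightarrow> 'v set \<Rightarrow> bool" where
  "uq_submodule act W \<longleftrightarrow>
     0 \<in> W \<and> (\<forall>v\<in>W. \<forall>w\<in>W. v + w \<in> W) \<and> (\<forall>u. \<forall>v\<in>W. act u v \<in> W)"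

definition simple_uq_module :: "(uq \<Rightarrow> 'v::ab_group_add \<Rightarrow> 'v) \<Rightarrow> bool" where
  "simple_uq_module act \<longleftrightarrow>
     uq_module act \<and> (\<exists>v :: 'v. v \<noteq> 0) \<and>
     (\<forall>W. uq_submodule act W \<longrightarrow> W = {0} \<or> W = UNIV)"

text \<open>The type \<open>'v\<close> with the action \<open>act\<close> is the simple module \<open>L(m,n)\<close>, and \<open>\<eta>\<close> is a highest
  weight vector of it.\<close>

definition is_L :: "(uq \<Rightarrow> 'v::ab_group_add \<Rightarrow> 'v) \<Rightarrow> 'v \<Rightarrow> nat \<Rightarrow> nat \<Rightarrow> bool" where
  "is_L act \<eta> m n \<longleftrightarrow>
     simple_uq_module act \<and> \<eta> \<noteq> 0 \<and>
     (\<forall>i. act (uE i) \<eta> = 0) \<and>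
     act (uK I1) \<eta> = act (scal (qq powi int m)) \<eta> \<and>
     act (uK I2) \<eta> = act (scal (qq powi int n)) \<eta>"

text \<open>The anti-linear involution of \<open>L(m,n)\<close> induced by \<open>\<psi>\<close>. An additive map is linear over the
  rationals, so the second condition gives \<open>f(q)v \<mapsto> f(q\<^sup>-\<^sup>1)\<Psi>(v)\<close> for all rational functions.\<close>

definition is_psi_L ::
  "int \<times> int \<Rightarrow> (uq \<Rightarrow> uq) \<Rightarrow> (uq \<Rightarrow> 'v::ab_group_add \<Rightarrow> 'v) \<Rightarrow> 'v \<Rightarrow> ('v \<Rightarrow> 'v) \<Rightarrow> bool" where
  "is_psi_L \<sigma> \<psi> act \<eta> \<Psi> \<longleftrightarrow>
     (\<forall>v w. \<Psi> (v + w) = \<Psi> v + \<Psi> w) \<and>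
     (\<forall>v. \<Psi> (act (scal qq) v) = act (scal (inverse qq)) (\<Psi> v)) \<and>
     (\<forall>v. \<Psi> (\<Psi> v) = v) \<and>
     (\<forall>u\<in>Ui \<sigma>. \<Psi> (act u \<eta>) = act (\<psi> u) \<eta>)"

definition Fmon :: "(uq \<Rightarrow> 'v::ab_group_add \<Rightarrow> 'v) \<Rightarrow> 'v \<Rightarrow> int \<Rightarrow> int \<Rightarrow> int \<Rightarrow> 'v" where
  "Fmon act \<eta> a b c = act (divpow (uF I1) a * divpow (uF I2) b * divpow (uF I1) c) \<eta>"

definition Bmon ::
  "int \<times> int \<Rightarrow> (uq \<Rightarrow> 'v::ab_group_add \<Rightarrow> 'v) \<Rightarrow> 'v \<Rightarrow> int \<Rightarrow> int \<Rightarrow> int \<Rightarrow> 'v" where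
  "Bmon \<sigma> act \<eta> a b c =
     act (divpow (iB \<sigma> I1) a * divpow (iB \<sigma> I2) b * divpow (iB \<sigma> I1) c) \<eta>"

text \<open>The set \<open>F\<^sub>1\<^sup>(\<^sup>a\<^sup>)F\<^sub>2\<^sup>(\<^sup>b\<^sup>)F\<^sub>1\<^sup>(\<^sup>c\<^sup>)\<eta> + \<Sum> q\<^sup>-\<^sup>1\<int>[q\<^sup>-\<^sup>1] F\<^sub>1\<^sup>(\<^sup>a\<^sup>-\<^sup>x\<^sup>)F\<^sub>2\<^sup>(\<^sup>b\<^sup>-\<^sup>x\<^sup>-\<^sup>y\<^sup>)F\<^sub>1\<^sup>(\<^sup>c\<^sup>-\<^sup>y\<^sup>)\<eta>\<close>, the sum being
  over all \<open>(x,y) \<noteq> (0,0)\<close> and its elements having finitely many summands.\<close>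

definition icb_coset :: "(uq \<Rightarrow> 'v::ab_group_add \<Rightarrow> 'v) \<Rightarrow> 'v \<Rightarrow> int \<Rightarrow> int \<Rightarrow> int \<Rightarrow> 'v set" where
  "icb_coset act \<eta> a b c =
     {Fmon act \<eta> a b c +
        (\<Sum>(x, y)\<in>S. act (scal (g x y)) (Fmon act \<eta> (a - int x) (b - int x - int y) (c - int y))) |
        (S :: (nat \<times> nat) set) g.
        finite S \<and> (0, 0) \<notin> S \<and> (\<forall>x y. g x y \<in> qinv_Z_qinv)}"

text \<open>Meaningful for \<open>a, b, c \<ge> 0\<close>, \<open>b \<ge> a + c\<close>, \<open>c \<le> m\<close> and \<open>b - c \<le> n\<close>, where the described element
  exists and is unique.\<close>

definition icb ::
  "(uq \<Rightarrow> 'v::ab_group_add \<Rightarrow> 'v) \<Rightarrow> 'v \<Rightarrow> ('v \<Rightarrow> 'v) \<Rightarrow> int \<Rightarrow> int \<Rightarrow> int \<Rightarrow> 'v" where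
  "icb act \<eta> \<Psi> a b c = (THE v. v \<in> icb_coset act \<eta> a b c \<and> \<Psi> v = v)"

end

theory Submission
  imports Defs
begin

text \<open>Since \<open>E\<^bsub>\<tau>i\<^esub>\<close> commutes with \<open>F\<^sub>i\<close>, the two summands of \<open>B\<^sub>i\<close> \<open>q\<close>-commute, and expanding powers of
  \<open>B\<^sub>1\<close> and \<open>B\<^sub>2\<close> by the \<open>q\<close>-binomial theorem writes \<open>B\<^sub>1\<^sup>(\<^sup>a\<^sup>)B\<^sub>2\<^sup>(\<^sup>b\<^sup>)B\<^sub>1\<^sup>(\<^sup>c\<^sup>)\<eta>\<close> in the monomials
  \<open>F\<^sub>1\<^sup>(\<^sup>a\<^sup>-\<^sup>x\<^sup>)F\<^sub>2\<^sup>(\<^sup>b\<^sup>-\<^sup>x\<^sup>-\<^sup>y\<^sup>)F\<^sub>1\<^sup>(\<^sup>c\<^sup>-\<^sup>y\<^sup>)\<eta>\<close>, the coefficients being products of a factor in \<open>y\<close> and a factor in \<open>x\<close>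
  that lies in \<open>q\<^sup>-\<^sup>1\<int>[q\<^sup>-\<^sup>1]\<close> for \<open>x > 0\<close>. In the alternating sum of the second formula the factors in \<open>y\<close>
  combine into a terminating basic hypergeometric sum in \<open>u = q\<^sup>-\<^sup>2\<close>; at the smallest admissible value
  \<open>m - c = \<alpha> - 1\<close> it is a Gaussian binomial in \<open>u\<^sup>2\<close> up to a power of \<open>q\<close>, or zero, and a contiguity relation
  raises \<open>m - c\<close>. So the sum lies in \<open>q\<^sup>-\<^sup>1\<int>[q\<^sup>-\<^sup>1]\<close> for \<open>y > 0\<close>, and being invariant it is the iCanonical
  basis element. An analogous formula holds for odd \<open>\<alpha>\<close>; it is needed because passing from \<open>(b, c)\<close>
  to \<open>(b - k, c - k)\<close> replaces \<open>\<alpha>\<close> by \<open>\<alpha> + k\<close>. The first formula then is the inversion of a triangular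
  matrix, a telescoping identity. Uniqueness of the basis element rests on the linear independence of
  the nonzero monomials.\<close>

section \<open>Quantum integers\<close>

text \<open>The order on \<open>qfield\<close> makes a polynomial positive when its leading
  coefficient is, so \<open>qq\<close> exceeds every constant. Nonvanishing and size estimates for
  quantum integers come from this order.\<close>

lemma qq_gt_2: "qq > 2"
proof -
  have "(2::qfield) = Fract 2 1"
    by (metis Fract_of_nat_eq of_nat_numeral)
  also have "(2::rat poly) < [:0, 1:]"
    by (simp add: less_poly_def pos_poly_def numeral_poly)
  then have "Fract (2::rat poly) 1 < qq"
    unfolding qq_def by simp
  finally show ?thesis .
qed

lemma qq_nonzero [simp]: "qq \<noteq> 0"
  using qq_gt_2 by (metis not_numeral_less_zero)

lemma qq_powi_pos [simp]: "qq powi r > 0"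
  using qq_gt_2 by (intro zero_less_power_int) (meson less_trans zero_less_numeral)

lemma qdenom_ge_1: "qq - qq powi (- 1) \<ge> 1"
proof -
  have "inverse qq \<le> inverse 1"
    using qq_gt_2 by (intro le_imp_inverse_le) (auto intro: order.trans[of _ 2])
  then show ?thesis
    using qq_gt_2 by (simp add: power_int_minus)
qed

lemma qdenom_pos: "qq - qq powi (- 1) > 0"
  using qdenom_ge_1 by (meson less_le_trans zero_less_one)

lemma inverse_qq_less: "inverse qq < qq"
  using qdenom_pos by (simp add: power_int_minus)

lemma qdenom_nonzero [simp]: "qq - qq powi (- 1) \<noteq> 0" "qq - inverse qq \<noteq> 0"
  using qdenom_pos inverse_qq_less by auto

lemma qint_0 [simp]: "qint 0 = 0"
  by (simp add: qint_def)

lemma qint_1 [simp]: "qint 1 = 1"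
  using qdenom_nonzero(1) by (simp add: qint_def del: qdenom_nonzero)

lemma qint_minus: "qint (- r) = - qint r"
  by (simp add: qint_def minus_divide_left)

lemma qint_add: "qint (x + y) = qq powi y * qint x + qq powi (- x) * qint y"
  by (simp add: qint_def power_int_add power_int_minus power_int_diff divide_simps)
     (simp add: algebra_simps)

lemma qint_pos: "r > 0 \<Longrightarrow> qint r > 0"
proof -
  assume "r > 0"
  then have "qq powi (- r) < qq powi r"
    using qq_gt_2 by (intro power_int_strict_increasing) (auto intro: less_trans[of _ 2])
  then show ?thesis
    unfolding qint_def using qdenom_pos by simp
qed

lemma qint_nonneg: "r \<ge> 0 \<Longrightarrow> qint r \<ge> 0"
  using qint_pos[of r] by (cases "r = 0") auto

lemma qint_nonzero: "r \<noteq> 0 \<Longrightarrow> qint r \<noteq> 0"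
  using qint_pos[of r] qint_pos[of "- r"] by (cases "r > 0") (auto simp: qint_minus)

lemma qint_less: "x < y \<Longrightarrow> 0 \<le> x \<Longrightarrow> qint x < qint y"
proof -
  assume *: "x < y" "0 \<le> x"
  have "qint x \<le> qq powi (y - x) * qint x"
    using * qint_nonneg[of x] qq_gt_2
    by (intro mult_le_cancel_right1[THEN iffD2]) (auto simp: intro!: one_le_power_int less_imp_le intro: less_trans[of _ 2])
  also have "\<dots> < qq powi (y - x) * qint x + qq powi (- x) * qint (y - x)"
    using * qint_pos[of "y - x"] by simp
  also have "\<dots> = qint y"
    using qint_add[of x "y - x"] by simp
  finally show ?thesis .
qed

lemma qint_le: "x \<le> y \<Longrightarrow> 0 \<le> x \<Longrightarrow> qint x \<le> qint y"
  using qint_less[of x y] by (cases "x = y") auto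

text \<open>Dropping first the subtracted term of the numerator and then the denominator, which is
  at least 1, only increases the value.\<close>

lemma qint_le_power: "qint r \<le> qq powi r"
proof -
  have "qq powi r * 1 \<le> qq powi r * (qq - qq powi (- 1))"
    using qdenom_ge_1 by (intro mult_left_mono) (auto intro: less_imp_le)
  moreover have "qq powi r - qq powi (- r) \<le> qq powi r"
    by (simp add: less_imp_le)
  ultimately show ?thesis
    unfolding qint_def pos_divide_le_eq[OF qdenom_pos] by linarith
qed

text \<open>Bounding one factor by \<open>qint_le_power\<close> leaves a single summand of
  \<open>qint_add\<close>. The estimate is used in \<open>contraction_factor\<close>.\<close>

lemma qint_mult_le: "x \<ge> 0 \<Longrightarrow> y \<ge> 0 \<Longrightarrow> qint x * qint y \<le> qint (x + y)"
proof -
  assume *: "x \<ge> 0" "y \<ge> 0"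
  have "qint x * qint y \<le> qq powi y * qint x"
    using * qint_le_power[of y] qint_nonneg[of x] by (simp add: mult.commute mult_left_mono)
  also have "\<dots> \<le> qint (x + y)"
    unfolding qint_add using * qint_nonneg[of y] by (simp add: less_imp_le)
  finally show ?thesis .
qed

text \<open>Over a common denominator this compares Laurent monomials in \<open>qq\<close>. It
  drives both the telescoping in \<open>partial_sum_bcoef\<close> and the commutation of
  \<open>uE i\<close> with divided powers of \<open>uF i\<close>.\<close>

lemma qint_product_sum:
  "qint (r - k) * qint (x - k) + qint k * qint (x + r - k) = qint r * qint x"
  by (simp add: qint_def power_int_add power_int_minus power_int_diff divide_simps)
     (simp add: algebra_simps)

lemma qfact_0 [simp]: "qfact 0 = 1"
  by (simp add: qfact_def)

lemma qfact_Suc [simp]: "qfact (Suc k) = qint (int k + 1) * qfact k"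
  by (simp add: qfact_def prod.nat_ivl_Suc' add.commute)

lemma qfact_pos: "qfact k > 0"
  unfolding qfact_def by (intro prod_pos) (auto intro: qint_pos)

lemma qfact_nonzero [simp]: "qfact k \<noteq> 0"
  using qfact_pos[of k] by simp

lemma qstep_0 [simp]: "qstep s 0 = 1"
  by (simp add: qstep_def)

lemma qstep_add: "qstep s (k + l) = qstep s k * qstep (s + 2 * int k) l"
  by (induction l) (simp_all add: qstep_def algebra_simps)

lemma qstep_Suc: "qstep s (Suc l) = qstep s l * qint (s + 2 * int l)"
  by (simp add: qstep_def)

lemma qstep_Suc_left: "qstep s (Suc l) = qint s * qstep (s + 2) l"
  using qstep_add[of s 1 l] by (simp add: qstep_Suc)

section \<open>Inverting the expansion coefficients\<close>

text \<open>The odd branch is the analogue of the second formula for odd \<alpha>. Its value at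
  \<open>l = 0\<close> is set separately, because the truncated \<open>l - 1\<close> would leave a
  spurious factor \<open>qint (\<alpha> - 1)\<close>.\<close>

definition icoef :: "int \<Rightarrow> nat \<Rightarrow> qfield" where
  "icoef \<alpha> l = (- 1) ^ l / qfact l *
     (if even \<alpha> then qstep \<alpha> l
      else if l = 0 then 1 else qint (\<alpha> + int l - 1) * qstep (\<alpha> + 1) (l - 1))"

definition bcoef :: "int \<Rightarrow> nat \<Rightarrow> qfield" where
  "bcoef \<alpha> k =
     (if k = 0 then 1
      else if even k then qint \<alpha> * (qstep (\<alpha> - int k + 2) (k - 1) / qfact k)
      else qstep (\<alpha> - int k + 1) k / qfact k)"

lemma icoef_0 [simp]: "icoef \<alpha> 0 = 1"
  by (simp add: icoef_def)

text \<open>As \<alpha> is even, \<open>\<alpha> + int k\<close> has the parity of \<open>k\<close>,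
  which selects the branch of \<open>icoef\<close>. The step-two products of the two coefficients
  abut and merge into one of \<open>N - 1\<close> factors; for \<open>k = 0\<close> and for odd
  \<open>k = N\<close> the extra factor is split off as the first or last factor of a longer
  product.\<close>

lemma bcoef_icoef:
  assumes "even \<alpha>" and "k \<le> N" and "N > 0"
  shows "bcoef \<alpha> k * icoef (\<alpha> + int k) (N - k) = (- 1) ^ (N - k) / (qfact k * qfact (N - k)) *
    (if even k then qint \<alpha> * qstep (\<alpha> - int k + 2) (N - 1)
     else qint (\<alpha> + int N - 1) * qstep (\<alpha> - int k + 1) (N - 1))"
proof -
  consider "k = 0" | "k > 0" "even k" | "odd k" "k < N" | "odd k" "k = N"
    using assms by fastforce
  then show ?thesis
  proof cases
    case 1
    then show ?thesis
      using assms qstep_Suc_left[of \<alpha> "N - 1"] by (simp add: bcoef_def icoef_def)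
  next
    case 2
    then have eq: "qstep (\<alpha> - int k + 2) (N - 1) =
        qstep (\<alpha> - int k + 2) (k - 1) * qstep (\<alpha> + int k) (N - k)"
      using assms qstep_add[of "\<alpha> - int k + 2" "k - 1" "N - k"] by (simp add: add.commute[of "int k"])
    then show ?thesis
      unfolding eq using 2 assms by (simp add: bcoef_def icoef_def)
  next
    case 3
    then have "qstep (\<alpha> - int k + 1) (N - 1) =
        qstep (\<alpha> - int k + 1) k * qstep (\<alpha> + int k + 1) (N - k - 1)"
      using assms qstep_add[of "\<alpha> - int k + 1" k "N - k - 1"] by (simp add: algebra_simps)
    moreover have "\<alpha> + int k + int (N - k) = \<alpha> + int N"
      using assms by simp
    ultimately show ?thesis
      using 3 assms by (auto simp add: bcoef_def icoef_def)
  next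
    case 4
    then have "qstep (\<alpha> - int k + 1) k =
        qstep (\<alpha> - int k + 1) (N - 1) * qint (\<alpha> + int N - 1)"
      using assms qstep_Suc[of "\<alpha> - int k + 1" "N - 1"] by (simp add: of_nat_diff algebra_simps)
    then show ?thesis
      using 4 assms by (auto simp add: bcoef_def icoef_def)
  qed
qed

text \<open>Moving one factor between the two factorials puts the partial sum up to \<open>k\<close>
  over the denominator of the next term.\<close>

lemma qfact_ratio:
  "k < N \<Longrightarrow> qint (int N - int k) / (qint (int N) * (qfact k * qfact (N - k))) =
     qint (int (Suc k)) / (qint (int N) * (qfact (Suc k) * qfact (N - Suc k)))"
proof -
  assume "k < N"
  then obtain d where d: "N = Suc (k + d)"
    using less_imp_Suc_add by blast
  have "qint (int k + 1) \<noteq> 0" "qint (int d + 1) \<noteq> 0"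
    using qint_nonzero[of "int k + 1"] qint_nonzero[of "int d + 1"] by auto
  then show ?thesis
    by (simp add: d divide_simps) (simp add: algebra_simps)
qed

text \<open>The alternating sum telescopes: its partial sums are closed products.\<close>

lemma partial_sum_bcoef:
  assumes "even \<alpha>" and "N > 0" and "K \<le> N"
  shows "(\<Sum>k\<le>K. (- 1) ^ k / (qfact k * qfact (N - k)) *
      (if even k then qint \<alpha> * qstep (\<alpha> - int k + 2) (N - 1)
       else qint (\<alpha> + int N - 1) * qstep (\<alpha> - int k + 1) (N - 1)))
    = qint (int N - int K) / (qint (int N) * (qfact K * qfact (N - K))) *
      (if even K then qstep (\<alpha> - int K) N
       else - qint (\<alpha> + int N - 1 - int K) * qstep (\<alpha> - int K + 1) (N - 1))"
  using assms(3)
proof (induction K)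
  case 0
  have "qint (int N) \<noteq> 0"
    using assms by (intro qint_nonzero) auto
  then show ?case
    using assms qstep_Suc_left[of \<alpha> "N - 1"] by (simp add: algebra_simps)
next
  case (Suc K)
  define D where "D = qfact (Suc K) * qfact (N - Suc K)"
  define X where "X k = (if even k then qstep (\<alpha> - int k) N
       else - qint (\<alpha> + int N - 1 - int k) * qstep (\<alpha> - int k + 1) (N - 1))" for k
  define Y where "Y k = (if even k then qint \<alpha> * qstep (\<alpha> - int k + 2) (N - 1)
       else qint (\<alpha> + int N - 1) * qstep (\<alpha> - int k + 1) (N - 1))" for k
  have nz: "D \<noteq> 0" "qint (int N) \<noteq> 0"
    using assms qint_nonzero[of "int N"] qint_nonzero[of "int K + 1"] by (auto simp: D_def)
  have *: "n * (x * Q) = e * (f * Q) + g * (h * Q)" if "e * f + g * h = n * x"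
    for n x e f g h Q :: qfield
    using that by (metis distrib_right mult.assoc)
  \<comment> \<open>After clearing denominators, term \<open>Suc K\<close> is the difference of the
    closed forms at \<open>Suc K\<close> and \<open>K\<close>. With the shared product
    \<open>?Q\<close> taken out, each parity is an instance of
    \<open>qint_product_sum\<close>.\<close>
  have "(- 1) ^ Suc K * (qint (int N) * Y (Suc K)) =
      qint (int N - int (Suc K)) * X (Suc K) - qint (int (Suc K)) * X K"
  proof (cases "even K")
    case True
    let ?Q = "qstep (\<alpha> - int K) (N - 1)"
    have "X K = ?Q * qint (\<alpha> + int N - 1 + int N - int (Suc K))"
      using assms True qstep_Suc[of "\<alpha> - int K" "N - 1"] by (simp add: X_def algebra_simps)
    moreover have "X (Suc K) = - qint (\<alpha> + int N - 1 - int (Suc K)) * ?Q"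
      using True by (simp add: X_def)
    moreover have "Y (Suc K) = qint (\<alpha> + int N - 1) * ?Q"
      using True by (simp add: Y_def)
    moreover note *[OF qint_product_sum[of "int N" "int (Suc K)" "\<alpha> + int N - 1"], of ?Q]
    ultimately show ?thesis
      using True by (simp add: mult_ac del: of_nat_Suc)
  next
    case False
    let ?Q = "qstep (\<alpha> - int (Suc K) + 2) (N - 1)"
    have "X K = - qint (\<alpha> + int N - int (Suc K)) * ?Q"
      using False by (simp add: X_def algebra_simps)
    moreover have "X (Suc K) = qint (\<alpha> - int (Suc K)) * ?Q"
      using False assms qstep_Suc_left[of "\<alpha> - int (Suc K)" "N - 1"] by (simp add: X_def)
    moreover have "Y (Suc K) = qint \<alpha> * ?Q"
      using False by (simp add: Y_def)
    moreover note *[OF qint_product_sum[of "int N" "int (Suc K)" "\<alpha>"], of ?Q]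
    ultimately show ?thesis
      using False by (simp add: mult_ac del: of_nat_Suc)
  qed
  then have "(- 1) ^ Suc K / D * Y (Suc K) =
      qint (int N - int (Suc K)) / (qint (int N) * D) * X (Suc K) - qint (int (Suc K)) / (qint (int N) * D) * X K"
    using nz by (simp add: field_simps)
  moreover have "(\<Sum>k\<le>K. (- 1) ^ k / (qfact k * qfact (N - k)) * Y k) =
      qint (int (Suc K)) / (qint (int N) * D) * X K"
    using Suc.IH Suc.prems qfact_ratio[of K N] unfolding X_def Y_def D_def by simp
  ultimately show ?case
    unfolding X_def[symmetric] Y_def[symmetric] D_def[symmetric] sum.atMost_Suc by simp
qed

text \<open>At \<open>K = N\<close> the factor \<open>qint (int N - int K)\<close> of the closed
  partial sum vanishes. This is the off-diagonal part of the inversion of the triangular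
  matrix.\<close>

lemma sum_bcoef_icoef:
  assumes "even \<alpha>" and "N > 0"
  shows "(\<Sum>k\<le>N. bcoef \<alpha> k * icoef (\<alpha> + int k) (N - k)) = 0"
proof -
  have "(\<Sum>k\<le>N. bcoef \<alpha> k * icoef (\<alpha> + int k) (N - k)) =
      (\<Sum>k\<le>N. (- 1) ^ N * ((- 1) ^ k / (qfact k * qfact (N - k)) *
      (if even k then qint \<alpha> * qstep (\<alpha> - int k + 2) (N - 1)
       else qint (\<alpha> + int N - 1) * qstep (\<alpha> - int k + 1) (N - 1))))"
  proof (intro sum.cong refl)
    fix k assume "k \<in> {..N}"
    then have "k \<le> N" by simp
    moreover from this have "(- 1 :: qfield) ^ (N - k) = (- 1) ^ N * (- 1) ^ k"
      by (metis left_minus_one_mult_self le_add_diff_inverse mult.commute power_add)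
    ultimately show "bcoef \<alpha> k * icoef (\<alpha> + int k) (N - k) = (- 1) ^ N * ((- 1) ^ k / (qfact k * qfact (N - k)) *
      (if even k then qint \<alpha> * qstep (\<alpha> - int k + 2) (N - 1)
       else qint (\<alpha> + int N - 1) * qstep (\<alpha> - int k + 1) (N - 1)))"
      using bcoef_icoef[OF assms(1) _ assms(2), of k] by simp
  qed
  then show ?thesis
    unfolding sum_distrib_left[symmetric] using partial_sum_bcoef[OF assms, of N] by simp
qed

section \<open>A terminating basic hypergeometric sum\<close>

text \<open>The q-Pochhammer symbol (B; u)_n in base \<open>u\<close>.\<close>

definition upoch :: "'a::field \<Rightarrow> 'a \<Rightarrow> nat \<Rightarrow> 'a" where
  "upoch u B n = (\<Prod>j<n. 1 - B * u ^ j)"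

lemma upoch_0 [simp]: "upoch u B 0 = 1"
  by (simp add: upoch_def)

lemma upoch_Suc: "upoch u B (Suc n) = upoch u B n * (1 - B * u ^ n)"
  by (simp add: upoch_def)

lemma upoch_Suc_left: "upoch u B (Suc n) = (1 - B) * upoch u (B * u) n"
  unfolding upoch_def prod.lessThan_Suc_shift by (simp add: mult.assoc)

text \<open>The Gaussian binomial with upper entry \<open>r + h - 1\<close> and lower entry
  \<open>h\<close>. Indexing by \<open>r\<close> makes it a bare quotient of Pochhammer
  symbols.\<close>

definition gbin :: "'a::field \<Rightarrow> nat \<Rightarrow> nat \<Rightarrow> 'a" where
  "gbin u r h = upoch u (u ^ r) h / upoch u u h"

text \<open>The parameter \<open>v\<close> is the inverse of \<open>u\<close>, so negative powers of
  \<open>u\<close> can be written with natural exponents. The locale is interpreted in base q^-2 and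
  in its square.\<close>

locale not_root_of_unity =
  fixes u v :: "'a::field"
  assumes uv [simp]: "u * v = 1" and not_root: "\<And>k. k > 0 \<Longrightarrow> u ^ k \<noteq> 1"
begin

lemma vu [simp]: "v * u = 1"
  using uv by (simp add: mult.commute)

lemma upow_vpow [simp]: "u ^ k * v ^ k = 1" "v ^ k * u ^ k = 1"
  by (simp_all flip: power_mult_distrib)

lemma upow_vpow_left [simp]: "u ^ k * (v ^ k * x) = x" "v ^ k * (u ^ k * x) = x"
  by (simp_all flip: mult.assoc)

lemma one_minus_upow_nonzero [simp]: "1 - u ^ Suc n \<noteq> 0"
  using not_root[of "Suc n"] by (metis right_minus_eq zero_less_Suc)

lemma upoch_u_nonzero [simp]: "upoch u u n \<noteq> 0"
  using one_minus_upow_nonzero by (simp add: upoch_def del: one_minus_upow_nonzero)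

lemma divide_add_factor: "e \<noteq> 0 \<Longrightarrow> X = Y + Z * e \<Longrightarrow> X / (W * e) = Y / (W * e) + Z / W"
  for e X Y Z W :: "'b::field"
  by (simp add: add_divide_distrib)

lemma gbin_0 [simp]: "gbin u r 0 = 1"
  by (simp add: gbin_def)

lemma gbin_0_Suc [simp]: "gbin u 0 (Suc h) = 0"
  by (simp add: gbin_def upoch_Suc_left)

text \<open>A q-Pascal rule: the numerators share the product \<open>Q\<close>, and 1 - u^(r+h+1) =
  (1 - u^r) + u^r (1 - u^(h+1)).\<close>

lemma gbin_Suc_Suc: "gbin u (Suc r) (Suc h) = gbin u r (Suc h) + u ^ r * gbin u (Suc r) h"
proof -
  define Q where "Q = upoch u (u ^ Suc r) h"
  have "upoch u (u ^ Suc r) (Suc h) = Q * (1 - u ^ Suc r * u ^ h)"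
    by (simp add: Q_def upoch_Suc)
  moreover have "upoch u (u ^ r) (Suc h) = (1 - u ^ r) * Q"
    by (simp add: Q_def upoch_Suc_left mult.commute)
  moreover have "upoch u u (Suc h) = upoch u u h * (1 - u ^ Suc h)"
    by (simp add: upoch_Suc)
  moreover have "Q * (1 - u ^ Suc r * u ^ h) / (upoch u u h * (1 - u ^ Suc h)) =
      (1 - u ^ r) * Q / (upoch u u h * (1 - u ^ Suc h)) + (u ^ r * Q) / upoch u u h"
    by (rule divide_add_factor[OF one_minus_upow_nonzero]) (simp add: algebra_simps)
  ultimately show ?thesis
    by (simp only: gbin_def Q_def[symmetric] times_divide_eq_right)
qed

text \<open>The sequence \<open>c\<close> stays free because the parity of \<alpha> decides what is
  inserted; the relations below only move \<open>B\<close> and \<open>y\<close> and shift or rescale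
  \<open>c\<close>.\<close>

definition hsum :: "(nat \<Rightarrow> 'a) \<Rightarrow> nat \<Rightarrow> 'a \<Rightarrow> 'a" where
  "hsum c y B = (\<Sum>l\<le>y. (- 1) ^ l * v ^ (l * (y - l) + l * (l - 1) div 2) * c l *
     upoch u (B * u ^ l) (y - l) / (upoch u u l * upoch u u (y - l)))"

lemma hsum_0 [simp]: "hsum c 0 B = c 0"
  by (simp add: hsum_def)

lemma hsum_add: "hsum (\<lambda>l. c l + c' l) y B = hsum c y B + hsum c' y B"
  unfolding hsum_def sum.distrib[symmetric] by (intro sum.cong refl) (simp add: ring_distribs add_divide_distrib)

lemma hsum_cmult: "hsum (\<lambda>l. a * c l) y B = a * hsum c y B"
  by (simp add: hsum_def sum_distrib_left mult_ac)

text \<open>Termwise with \<open>y = l + k\<close>, 1 - B u^(l+k+1) = (1 - B u^l) + B u^l (1 -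
  u^(k+1)): the last factor cancels against \<open>upoch u u (Suc k)\<close> and u^l against v^l. At
  \<open>l = Suc y\<close> the Pochhammer factors in \<open>B\<close> are empty, so those terms
  agree.\<close>

lemma hsum_shift_argument: "hsum c (Suc y) (B * u) = hsum c (Suc y) B + B * hsum c y (B * u)"
proof -
  have "(- 1) ^ l * v ^ (l * (Suc y - l) + l * (l - 1) div 2) * c l *
          upoch u (B * u * u ^ l) (Suc y - l) / (upoch u u l * upoch u u (Suc y - l)) =
        (- 1) ^ l * v ^ (l * (Suc y - l) + l * (l - 1) div 2) * c l *
          upoch u (B * u ^ l) (Suc y - l) / (upoch u u l * upoch u u (Suc y - l)) +
        B * ((- 1) ^ l * v ^ (l * (y - l) + l * (l - 1) div 2) * c l *
          upoch u (B * u * u ^ l) (y - l) / (upoch u u l * upoch u u (y - l)))"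
    if "l \<le> y" for l
  proof -
    from that obtain k where k: "y = l + k"
      by (auto dest: le_Suc_ex)
    define Q where "Q = upoch u (B * u * u ^ l) k"
    define V where "V = v ^ (l * k + l * (l - 1) div 2)"
    have "upoch u (B * u * u ^ l) (Suc k) = Q * (1 - B * u * u ^ l * u ^ k)"
      by (simp add: Q_def upoch_Suc)
    moreover have "upoch u (B * u ^ l) (Suc k) = (1 - B * u ^ l) * Q"
      by (simp add: Q_def upoch_Suc_left mult_ac)
    moreover have "upoch u u (Suc k) = upoch u u k * (1 - u ^ Suc k)"
      by (simp add: upoch_Suc)
    moreover have "v ^ (l * Suc k + l * (l - 1) div 2) = v ^ l * V"
      by (simp add: V_def power_add)
    moreover have "v ^ l * V * (Q * (1 - B * u * u ^ l * u ^ k)) / (upoch u u k * (1 - u ^ Suc k)) =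
        v ^ l * V * ((1 - B * u ^ l) * Q) / (upoch u u k * (1 - u ^ Suc k)) + B * V * Q / upoch u u k"
      by (rule divide_add_factor[OF one_minus_upow_nonzero]) (simp add: algebra_simps)
    ultimately have "v ^ (l * Suc k + l * (l - 1) div 2) * upoch u (B * u * u ^ l) (Suc k) / upoch u u (Suc k)
       = v ^ (l * Suc k + l * (l - 1) div 2) * upoch u (B * u ^ l) (Suc k) / upoch u u (Suc k) +
         B * V * Q / upoch u u k"
      by (simp only:)
    then have "(- 1) ^ l * c l / upoch u u l *
        (v ^ (l * Suc k + l * (l - 1) div 2) * upoch u (B * u * u ^ l) (Suc k) / upoch u u (Suc k)) =
        (- 1) ^ l * c l / upoch u u l *
        (v ^ (l * Suc k + l * (l - 1) div 2) * upoch u (B * u ^ l) (Suc k) / upoch u u (Suc k)) +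
        (- 1) ^ l * c l / upoch u u l * (B * V * Q / upoch u u k)"
      by (simp only: distrib_left)
    then show ?thesis
      by (simp add: k Q_def V_def Suc_diff_le mult_ac)
  qed
  then show ?thesis
    unfolding hsum_def sum.atMost_Suc sum_distrib_left by (simp add: sum.distrib)
qed

text \<open>The factor \<open>1 - u ^ l\<close> kills the term \<open>l = 0\<close>, where
  \<open>l - 1\<close> is truncated, and otherwise cancels the last factor of
  \<open>upoch u u l\<close>; the index then shifts by one.\<close>

lemma hsum_shift_sequence:
  "hsum (\<lambda>l. (1 - u ^ l) * c (l - 1)) (Suc y) B = - (v ^ y) * hsum c y (B * u)"
proof -
  have "(- 1) ^ Suc l * v ^ (Suc l * (Suc y - Suc l) + Suc l * (Suc l - 1) div 2) * ((1 - u ^ Suc l) * c (Suc l - 1)) *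
          upoch u (B * u ^ Suc l) (Suc y - Suc l) / (upoch u u (Suc l) * upoch u u (Suc y - Suc l)) =
        - (v ^ y) * ((- 1) ^ l * v ^ (l * (y - l) + l * (l - 1) div 2) * c l *
          upoch u (B * u * u ^ l) (y - l) / (upoch u u l * upoch u u (y - l)))"
    if "l \<le> y" for l
  proof -
    have "Suc l * l div 2 = l + l * (l - 1) div 2"
    proof (cases l)
      case (Suc i)
      have "Suc (Suc i) * Suc i = 2 * Suc i + Suc i * i" by simp
      then show ?thesis using Suc by (metis div_mult_self4 mult.commute diff_Suc_1 zero_neq_numeral)
    qed simp
    then have "Suc l * (y - l) + Suc l * l div 2 = y + (l * (y - l) + l * (l - 1) div 2)"
      using that by simp
    then have "v ^ (Suc l * (y - l) + Suc l * l div 2) = v ^ y * v ^ (l * (y - l) + l * (l - 1) div 2)"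
      by (simp only: power_add)
    moreover have "(1 - u ^ Suc l) / upoch u u (Suc l) = 1 / upoch u u l"
      using one_minus_upow_nonzero[of l] by (simp add: upoch_Suc del: one_minus_upow_nonzero)
    ultimately have "v ^ (Suc l * (y - l) + Suc l * l div 2) * ((1 - u ^ Suc l) / upoch u u (Suc l)) *
        ((- 1) ^ l * c l * upoch u (B * u ^ Suc l) (y - l) / upoch u u (y - l)) =
        v ^ y * v ^ (l * (y - l) + l * (l - 1) div 2) * (1 / upoch u u l) *
        ((- 1) ^ l * c l * upoch u (B * u ^ Suc l) (y - l) / upoch u u (y - l))"
      by (simp only:)
    then show ?thesis
      by (simp add: mult_ac del: mult_Suc)
  qed
  then show ?thesis
    unfolding hsum_def sum.atMost_Suc_shift sum_distrib_left by simp
qed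

text \<open>In each term 1 - u^(y+1) = u^l (1 - u^(y+1-l)) + (1 - u^l). The first part lowers
  \<open>y\<close> at fixed \<open>B\<close>; the second is handled by
  \<open>hsum_shift_sequence\<close>.\<close>

lemma hsum_Suc:
  "(1 - u ^ Suc y) * hsum c (Suc y) B =
     (1 - B * u ^ y) * hsum c y B - v ^ y * hsum (\<lambda>l. c (Suc l)) y (B * u)"
proof -
  have *: "u ^ l * (1 - u ^ (Suc y - l)) * ((- 1) ^ l * v ^ (l * (Suc y - l) + l * (l - 1) div 2) * c l *
          upoch u (B * u ^ l) (Suc y - l) / (upoch u u l * upoch u u (Suc y - l))) =
       (1 - B * u ^ y) * ((- 1) ^ l * v ^ (l * (y - l) + l * (l - 1) div 2) * c l *
          upoch u (B * u ^ l) (y - l) / (upoch u u l * upoch u u (y - l)))" if "l \<le> y" for l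
  proof -
    from that obtain k where k: "y = l + k"
      by (auto dest: le_Suc_ex)
    have "(1 - u ^ Suc k) / upoch u u (Suc k) = 1 / upoch u u k"
      using one_minus_upow_nonzero[of k] by (simp add: upoch_Suc del: one_minus_upow_nonzero)
    moreover have "u ^ l * v ^ (l * Suc k + l * (l - 1) div 2) = v ^ (l * k + l * (l - 1) div 2)"
      by (simp add: power_add)
    moreover have "upoch u (B * u ^ l) (Suc k) = upoch u (B * u ^ l) k * (1 - B * u ^ y)"
      by (simp add: upoch_Suc k power_add mult_ac)
    ultimately have "(u ^ l * v ^ (l * Suc k + l * (l - 1) div 2)) * ((1 - u ^ Suc k) / upoch u u (Suc k)) *
         ((- 1) ^ l * c l * upoch u (B * u ^ l) (Suc k) / upoch u u l) =
         v ^ (l * k + l * (l - 1) div 2) * (1 / upoch u u k) *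
         ((- 1) ^ l * c l * (upoch u (B * u ^ l) k * (1 - B * u ^ y)) / upoch u u l)"
      by (simp only:)
    then show ?thesis
      by (simp add: k Suc_diff_le mult_ac)
  qed
  have "(1 - u ^ Suc y) * hsum c (Suc y) B =
      (\<Sum>l\<le>Suc y. u ^ l * (1 - u ^ (Suc y - l)) * ((- 1) ^ l * v ^ (l * (Suc y - l) + l * (l - 1) div 2) * c l *
          upoch u (B * u ^ l) (Suc y - l) / (upoch u u l * upoch u u (Suc y - l)))) +
      hsum (\<lambda>l. (1 - u ^ l) * c (Suc (l - 1))) (Suc y) B"
    unfolding hsum_def sum_distrib_left sum.distrib[symmetric]
  proof (intro sum.cong refl)
    fix l assume "l \<in> {..Suc y}"
    then have "u ^ l * u ^ (Suc y - l) = u ^ Suc y"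
      by (simp flip: power_add)
    then have "1 - u ^ Suc y = u ^ l * (1 - u ^ (Suc y - l)) + (1 - u ^ l)"
      by (simp add: algebra_simps)
    moreover have "(1 - u ^ l) * c (Suc (l - 1)) = (1 - u ^ l) * c l"
      by (cases l) auto
    ultimately show "(1 - u ^ Suc y) * ((- 1) ^ l * v ^ (l * (Suc y - l) + l * (l - 1) div 2) * c l *
          upoch u (B * u ^ l) (Suc y - l) / (upoch u u l * upoch u u (Suc y - l))) =
        u ^ l * (1 - u ^ (Suc y - l)) * ((- 1) ^ l * v ^ (l * (Suc y - l) + l * (l - 1) div 2) * c l *
          upoch u (B * u ^ l) (Suc y - l) / (upoch u u l * upoch u u (Suc y - l))) +
        (- 1) ^ l * v ^ (l * (Suc y - l) + l * (l - 1) div 2) * ((1 - u ^ l) * c (Suc (l - 1))) *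
          upoch u (B * u ^ l) (Suc y - l) / (upoch u u l * upoch u u (Suc y - l))"
      by (simp add: ring_distribs add_divide_distrib diff_divide_distrib mult_ac)
  qed
  also have "(\<Sum>l\<le>Suc y. u ^ l * (1 - u ^ (Suc y - l)) * ((- 1) ^ l * v ^ (l * (Suc y - l) + l * (l - 1) div 2) * c l *
          upoch u (B * u ^ l) (Suc y - l) / (upoch u u l * upoch u u (Suc y - l)))) =
      (1 - B * u ^ y) * hsum c y B"
    unfolding hsum_def sum_distrib_left using * by simp
  finally show ?thesis
    using hsum_shift_sequence[of "\<lambda>l. c (Suc l)" y B] by simp
qed

lemma upoch_u2_nonzero [simp]: "upoch (u\<^sup>2) (u\<^sup>2) n \<noteq> 0"
proof -
  have "u\<^sup>2 * (u\<^sup>2) ^ j \<noteq> 1" for j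
    using not_root[of "2 * Suc j"] by (simp add: power_mult power2_eq_square power_mult_distrib mult_ac)
  then show ?thesis
    by (simp add: upoch_def)
qed

lemma upoch_u2_Suc: "upoch (u\<^sup>2) (u\<^sup>2) (Suc h) = upoch (u\<^sup>2) (u\<^sup>2) h * (1 - u ^ (2 * h + 2))"
proof -
  have "u\<^sup>2 * (u\<^sup>2) ^ h = u ^ (2 * h + 2)"
    by (metis power_add power_mult mult.commute)
  then show ?thesis
    by (simp add: upoch_Suc)
qed

text \<open>A recursion inside the balanced family, where sequence and argument carry the same
  \<open>A\<close>. Shifting the sequence turns \<open>A\<close> into A u^2 but the argument only
  into A u; \<open>hsum_shift_argument\<close> repairs the mismatch.\<close>

lemma hsum_balanced_Suc:
  "(1 - u ^ Suc y) * hsum (upoch (u\<^sup>2) A) (Suc y) A =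
     (1 - A * u ^ y) * hsum (upoch (u\<^sup>2) A) y A -
     v ^ y * (1 - A) * (hsum (upoch (u\<^sup>2) (A * u\<^sup>2)) y (A * u\<^sup>2) -
       (if y = 0 then 0 else A * u * hsum (upoch (u\<^sup>2) (A * u\<^sup>2)) (y - 1) (A * u\<^sup>2)))"
proof -
  have "hsum (\<lambda>l. upoch (u\<^sup>2) A (Suc l)) y (A * u) = (1 - A) * hsum (upoch (u\<^sup>2) (A * u\<^sup>2)) y (A * u)"
    by (simp add: upoch_Suc_left hsum_cmult)
  moreover have "hsum (upoch (u\<^sup>2) (A * u\<^sup>2)) y (A * u) = hsum (upoch (u\<^sup>2) (A * u\<^sup>2)) y (A * u\<^sup>2) -
       (if y = 0 then 0 else A * u * hsum (upoch (u\<^sup>2) (A * u\<^sup>2)) (y - 1) (A * u\<^sup>2))"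
    using hsum_shift_argument[of "upoch (u\<^sup>2) (A * u\<^sup>2)" "y - 1" "A * u"]
    by (cases y) (auto simp: power2_eq_square mult.assoc)
  ultimately show ?thesis
    by (simp only: hsum_Suc mult.assoc)
qed

text \<open>The recursion passes to A u^2, so the induction is over all \<open>A\<close> at once. In
  the even step only the term of lower even index survives; in the odd step the closed forms at
  \<open>A\<close> and A u^2 cancel.\<close>

lemma hsum_balanced:
  "hsum (upoch (u\<^sup>2) A) (2 * h) A = A ^ h * upoch (u\<^sup>2) A h / upoch (u\<^sup>2) (u\<^sup>2) h \<and>
   hsum (upoch (u\<^sup>2) A) (2 * h + 1) A = 0"
proof (induction h arbitrary: A)
  case 0
  have "(1 - u ^ Suc 0) * hsum (upoch (u\<^sup>2) A) (Suc 0) A = 0"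
    by (subst hsum_balanced_Suc) simp
  then show ?case
    using one_minus_upow_nonzero[of 0] by simp
next
  case (Suc h)
  let ?G = "\<lambda>h A. A ^ h * upoch (u\<^sup>2) A h / upoch (u\<^sup>2) (u\<^sup>2) h"
  have even: "hsum (upoch (u\<^sup>2) A) (2 * h + 2) A = ?G (Suc h) A" for A
  proof -
    have "(1 - u ^ (2 * h + 2)) * hsum (upoch (u\<^sup>2) A) (2 * h + 2) A =
        v ^ (2 * h + 1) * (1 - A) * (A * u * ?G h (A * u\<^sup>2))"
      using hsum_balanced_Suc[of "2 * h + 1" A] Suc by simp
    also have "\<dots> = (v ^ (2 * h + 1) * u ^ (2 * h + 1)) * (A ^ Suc h * ((1 - A) * upoch (u\<^sup>2) (A * u\<^sup>2) h) / upoch (u\<^sup>2) (u\<^sup>2) h)"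
      by (simp add: power_mult_distrib power_mult[symmetric] mult_ac del: upow_vpow upow_vpow_left)
    also have "v ^ (2 * h + 1) * u ^ (2 * h + 1) = 1"
      by (rule upow_vpow)
    also have "1 * (A ^ Suc h * ((1 - A) * upoch (u\<^sup>2) (A * u\<^sup>2) h) / upoch (u\<^sup>2) (u\<^sup>2) h) =
        (1 - u ^ (2 * h + 2)) * ?G (Suc h) A"
      using one_minus_upow_nonzero[of "2 * h + 1"]
      by (simp add: upoch_u2_Suc upoch_Suc_left[of "u\<^sup>2" A h] del: one_minus_upow_nonzero)
    finally have "(1 - u ^ (2 * h + 2)) * hsum (upoch (u\<^sup>2) A) (2 * h + 2) A =
        (1 - u ^ (2 * h + 2)) * ?G (Suc h) A" .
    moreover have "1 - u ^ (2 * h + 2) \<noteq> 0"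
      using one_minus_upow_nonzero[of "2 * h + 1"] by (simp del: one_minus_upow_nonzero)
    ultimately show ?thesis
      by (rule mult_left_cancel[THEN iffD1, rotated])
  qed
  have "(1 - u ^ Suc (2 * h + 2)) * hsum (upoch (u\<^sup>2) A) (Suc (2 * h + 2)) A =
      (1 - A * u ^ (2 * h + 2)) * ?G (Suc h) A - v ^ (2 * h + 2) * (1 - A) * ?G (Suc h) (A * u\<^sup>2)"
    using hsum_balanced_Suc[of "2 * h + 2" A] Suc[of "A * u\<^sup>2"] even[of A] even[of "A * u\<^sup>2"] by simp
  also have "v ^ (2 * h + 2) * (1 - A) * ?G (Suc h) (A * u\<^sup>2) =
      (v ^ (2 * h + 2) * u ^ (2 * h + 2)) * (A ^ Suc h * ((1 - A) * upoch (u\<^sup>2) (A * u\<^sup>2) (Suc h)) / upoch (u\<^sup>2) (u\<^sup>2) (Suc h))"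
  proof -
    have "(u\<^sup>2) ^ Suc h = u ^ (2 * h + 2)"
      by (simp only: power_mult[symmetric]) simp
    then have "(A * u\<^sup>2) ^ Suc h = A ^ Suc h * u ^ (2 * h + 2)"
      by (simp only: power_mult_distrib)
    then show ?thesis
      by (simp only: mult_ac times_divide_eq_right)
  qed
  also have "(1 - A) * upoch (u\<^sup>2) (A * u\<^sup>2) (Suc h) = upoch (u\<^sup>2) A (Suc h) * (1 - A * u ^ (2 * h + 2))"
    by (simp add: upoch_Suc_left[symmetric] upoch_Suc[of _ _ "Suc h"] power_mult[symmetric] power2_eq_square)
       (simp add: power_mult power2_eq_square power_mult_distrib mult_ac)
  finally have "(1 - u ^ Suc (2 * h + 2)) * hsum (upoch (u\<^sup>2) A) (Suc (2 * h + 2)) A = 0"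
    by (simp only: upow_vpow) (simp add: mult_ac)
  then show ?case
    using even[of A] one_minus_upow_nonzero[of "2 * h + 2"] by (simp del: one_minus_upow_nonzero)
qed

text \<open>One step beyond the balanced argument, \<open>hsum_shift_argument\<close> expresses the
  sum by \<open>hsum_balanced\<close> and the preceding index.\<close>

lemma hsum_shifted:
  "hsum (upoch (u\<^sup>2) C) (2 * h) (C * u) = C ^ h * upoch (u\<^sup>2) (C * u\<^sup>2) h / upoch (u\<^sup>2) (u\<^sup>2) h \<and>
   hsum (upoch (u\<^sup>2) C) (2 * h + 1) (C * u) =
     C * (C ^ h * upoch (u\<^sup>2) (C * u\<^sup>2) h / upoch (u\<^sup>2) (u\<^sup>2) h)"
proof (induction h)
  case 0
  show ?case
    using hsum_shift_argument[of "upoch (u\<^sup>2) C" 0 C] hsum_balanced[of C 0] by simp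
next
  case (Suc h)
  have even: "hsum (upoch (u\<^sup>2) C) (2 * Suc h) (C * u) =
      C ^ Suc h * upoch (u\<^sup>2) (C * u\<^sup>2) (Suc h) / upoch (u\<^sup>2) (u\<^sup>2) (Suc h)"
  proof -
    define Q where "Q = upoch (u\<^sup>2) (C * u\<^sup>2) h"
    define W where "W = upoch (u\<^sup>2) (u\<^sup>2) h"
    define e where "e = 1 - u ^ (2 * h + 2)"
    have e: "e \<noteq> 0"
      using one_minus_upow_nonzero[of "2 * h + 1"] by (simp add: e_def del: one_minus_upow_nonzero)
    have "hsum (upoch (u\<^sup>2) C) (2 * Suc h) (C * u) = C ^ Suc h * ((1 - C) * Q) / (W * e) + C * (C * (C ^ h * Q / W))"
      using hsum_shift_argument[of "upoch (u\<^sup>2) C" "2 * h + 1" C] hsum_balanced[of C "Suc h"] Suc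
      by (simp add: upoch_u2_Suc upoch_Suc_left[of "u\<^sup>2" C h] Q_def W_def e_def)
    also have "C * (C * (C ^ h * Q / W)) = C ^ Suc h * Q * C / W"
      by simp
    also have "C ^ Suc h * ((1 - C) * Q) / (W * e) + C ^ Suc h * Q * C / W =
        C ^ Suc h * (Q * (1 - C * u ^ (2 * h + 2))) / (W * e)"
      by (rule divide_add_factor[OF e, symmetric]) (simp add: e_def algebra_simps)
    also have "Q * (1 - C * u ^ (2 * h + 2)) = upoch (u\<^sup>2) (C * u\<^sup>2) (Suc h)"
      by (simp add: Q_def upoch_Suc power_mult power2_eq_square power_mult_distrib mult_ac)
    finally show ?thesis
      by (simp add: W_def e_def upoch_u2_Suc)
  qed
  then show ?case
    using hsum_shift_argument[of "upoch (u\<^sup>2) C" "2 * Suc h" C] hsum_balanced[of C "Suc h"] by simp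
qed

text \<open>The normalised odd branch of \<open>icoef\<close>; for \<alpha> = s odd it is used with
  \<open>C\<close> = u^(s-1).\<close>

definition odd_seq :: "'a \<Rightarrow> nat \<Rightarrow> 'a" where
  "odd_seq C l = (if l = 0 then 1 else (1 - C * u ^ l) * upoch (u\<^sup>2) (C * u\<^sup>2) (l - 1))"

text \<open>Writing 1 - C u^l = (1 - C) + C (1 - u^l) splits the sum into a shifted one and, by
  \<open>hsum_shift_sequence\<close>, a balanced one. At even index the balanced part vanishes or is
  absent; at odd index the two parts cancel.\<close>

lemma hsum_odd_seq:
  "hsum (odd_seq C) (2 * h) (C * u) = C ^ h * upoch (u\<^sup>2) (C * u\<^sup>2) h / upoch (u\<^sup>2) (u\<^sup>2) h \<and>
   hsum (odd_seq C) (2 * h + 1) (C * u) = 0"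
proof -
  have "odd_seq C = (\<lambda>l. upoch (u\<^sup>2) C l + C * ((1 - u ^ l) * upoch (u\<^sup>2) (C * u\<^sup>2) (l - 1)))"
  proof
    fix l
    show "odd_seq C l = upoch (u\<^sup>2) C l + C * ((1 - u ^ l) * upoch (u\<^sup>2) (C * u\<^sup>2) (l - 1))"
      by (cases l) (simp_all add: odd_seq_def upoch_Suc_left algebra_simps)
  qed
  then have *: "hsum (odd_seq C) (Suc y) (C * u) = hsum (upoch (u\<^sup>2) C) (Suc y) (C * u) -
      C * (v ^ y * hsum (upoch (u\<^sup>2) (C * u\<^sup>2)) y (C * u\<^sup>2))" for y
    using hsum_shift_sequence[of "upoch (u\<^sup>2) (C * u\<^sup>2)" y "C * u"]
    by (simp add: hsum_add hsum_cmult power2_eq_square mult.assoc)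
  have "hsum (odd_seq C) (2 * h) (C * u) = hsum (upoch (u\<^sup>2) C) (2 * h) (C * u)"
  proof (cases h)
    case (Suc i)
    then show ?thesis
      using *[of "2 * i + 1"] hsum_balanced[of "C * u\<^sup>2" i] by simp
  qed (simp add: odd_seq_def)
  moreover have "v ^ (2 * h) * (C * u\<^sup>2) ^ h = C ^ h"
    by (simp add: power_mult_distrib power_mult[symmetric] mult_ac)
  then have "C * (v ^ (2 * h) * hsum (upoch (u\<^sup>2) (C * u\<^sup>2)) (2 * h) (C * u\<^sup>2)) =
      hsum (upoch (u\<^sup>2) C) (2 * h + 1) (C * u)"
    using hsum_balanced[of "C * u\<^sup>2" h] hsum_shifted[of C h] by (simp add: mult.assoc[symmetric])
  ultimately show ?thesis
    using *[of "2 * h"] hsum_shifted[of C h] by simp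
qed

end

section \<open>Integrality of the coefficients\<close>

text \<open>The ring of integer polynomials in q^-1, in which \<open>qinv_Z_qinv\<close> is the
  ideal generated by q^-1.\<close>

definition Z_qinv :: "qfield set" where
  "Z_qinv = range (\<lambda>p :: int poly. poly (map_poly of_int p) (inverse qq))"

lemma Z_qinv_add: "x \<in> Z_qinv \<Longrightarrow> y \<in> Z_qinv \<Longrightarrow> x + y \<in> Z_qinv"
proof -
  have "map_poly of_int p + map_poly of_int p' = (map_poly of_int (p + p') :: qfield poly)" for p p'
    by (simp add: poly_eq_iff coeff_map_poly)
  then show "x \<in> Z_qinv \<Longrightarrow> y \<in> Z_qinv \<Longrightarrow> x + y \<in> Z_qinv"
    unfolding Z_qinv_def by (auto simp flip: poly_add)
qed

lemma Z_qinv_mult: "x \<in> Z_qinv \<Longrightarrow> y \<in> Z_qinv \<Longrightarrow> x * y \<in> Z_qinv"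
proof -
  have "map_poly of_int p * map_poly of_int p' = (map_poly of_int (p * p') :: qfield poly)" for p p'
    by (simp add: poly_eq_iff coeff_map_poly coeff_mult)
  then show "x \<in> Z_qinv \<Longrightarrow> y \<in> Z_qinv \<Longrightarrow> x * y \<in> Z_qinv"
    unfolding Z_qinv_def by (auto simp flip: poly_mult)
qed

lemma Z_qinv_0 [simp]: "0 \<in> Z_qinv"
  unfolding Z_qinv_def by (rule range_eqI[of _ _ 0]) simp

lemma Z_qinv_1 [simp]: "1 \<in> Z_qinv"
  unfolding Z_qinv_def by (rule range_eqI[of _ _ 1]) simp

lemma Z_qinv_inverse_qq [simp]: "inverse qq \<in> Z_qinv"
  unfolding Z_qinv_def by (rule range_eqI[of _ _ "[:0, 1:]"]) (simp add: map_poly_pCons)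

lemma Z_qinv_power: "x \<in> Z_qinv \<Longrightarrow> x ^ n \<in> Z_qinv"
  by (induction n) (auto intro: Z_qinv_mult)

lemma qq_powi_in_Z_qinv: "e \<le> 0 \<Longrightarrow> qq powi e \<in> Z_qinv"
  using Z_qinv_power[OF Z_qinv_inverse_qq, of "nat (- e)"] by (simp add: power_int_def)

lemma qinv_Z_qinv_iff: "x \<in> qinv_Z_qinv \<longleftrightarrow> qq * x \<in> Z_qinv"
  unfolding qinv_Z_qinv_def Z_qinv_def image_iff by (auto simp: field_simps)

lemma qinv_Z_qinv_0 [simp]: "0 \<in> qinv_Z_qinv"
  by (simp add: qinv_Z_qinv_iff)

lemma qinv_Z_qinv_add: "x \<in> qinv_Z_qinv \<Longrightarrow> y \<in> qinv_Z_qinv \<Longrightarrow> x + y \<in> qinv_Z_qinv"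
  by (simp add: qinv_Z_qinv_iff ring_distribs Z_qinv_add)

lemma qinv_Z_qinv_subset: "x \<in> qinv_Z_qinv \<Longrightarrow> x \<in> Z_qinv"
  using Z_qinv_mult[OF Z_qinv_inverse_qq, of "qq * x"] by (simp add: qinv_Z_qinv_iff mult.assoc[symmetric])

lemma qinv_Z_qinv_mult: "x \<in> qinv_Z_qinv \<Longrightarrow> y \<in> Z_qinv \<Longrightarrow> x * y \<in> qinv_Z_qinv"
  using Z_qinv_mult[of "qq * x" y] by (simp add: qinv_Z_qinv_iff mult.assoc)

lemma qq_powi_in_qinv_Z_qinv: "e < 0 \<Longrightarrow> qq powi e \<in> qinv_Z_qinv"
  using qq_powi_in_Z_qinv[of "e + 1"] by (simp add: qinv_Z_qinv_iff power_int_add mult.commute)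

section \<open>The bases q^-2 and q^-4 and their Gaussian binomials\<close>

definition qm2 :: qfield where
  "qm2 = qq powi (- 2)"

lemma qq_powi_add: "qq powi (a + b) = qq powi a * qq powi b"
  by (simp add: power_int_add)

lemma qm2_power: "qm2 ^ n = qq powi (- 2 * int n)"
  by (simp add: qm2_def power_int_power')

lemma qq_powi_neq_1: "e < 0 \<Longrightarrow> qq powi e \<noteq> 1"
proof -
  assume "e < 0"
  then have "qq powi e < qq powi 0"
    using qq_gt_2 by (intro power_int_strict_increasing) (auto intro: less_trans[of _ 2])
  then show ?thesis by simp
qed

interpretation u: not_root_of_unity qm2 "qq\<^sup>2"
proof
  show "qm2 * qq\<^sup>2 = 1"
    using power_int_add[of qq "- 2" 2] by (simp add: qm2_def)
  show "qm2 ^ k \<noteq> 1" if "k > 0" for k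
    unfolding qm2_power using that by (intro qq_powi_neq_1) simp
qed

text \<open>The closed forms of \<open>hsum\<close> have Pochhammer symbols in base u^2, hence
  Gaussian binomials in base q^-4.\<close>

interpretation w: not_root_of_unity "qm2\<^sup>2" "(qq\<^sup>2)\<^sup>2"
proof
  show "qm2\<^sup>2 * (qq\<^sup>2)\<^sup>2 = 1"
    by (rule u.upow_vpow)
  show "(qm2\<^sup>2) ^ k \<noteq> 1" if "k > 0" for k
    using that u.not_root[of "2 * k"] by (simp add: power_mult)
qed

text \<open>The Pascal rule builds \<open>gbin\<close> from 0, 1 and \<open>u\<close> by sums and
  products, without the division of its definition, so integrality can be read off in either
  base.\<close>

lemma (in not_root_of_unity) gbin_induct:
  assumes "P 0" "P 1" "\<And>x y. P x \<Longrightarrow> P y \<Longrightarrow> P (x + y)" "\<And>x y. P x \<Longrightarrow> P y \<Longrightarrow> P (x * y)" "P u"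
  shows "P (gbin u r h)"
proof -
  have pow: "P (u ^ n)" for n
    by (induction n) (auto intro: assms)
  show ?thesis
  proof (induction r arbitrary: h)
    case 0
    show ?case
      using assms(1,2) by (cases h) auto
  next
    case (Suc r)
    show ?case
    proof (induction h)
      case (Suc h)
      show ?case
        unfolding gbin_Suc_Suc by (intro assms(3,4) pow Suc \<open>P (gbin u r _)\<close>)
    qed (use assms(2) in simp)
  qed
qed

lemma qm2_in_Z_qinv: "qm2 \<in> Z_qinv"
  by (simp only: qm2_def) (rule qq_powi_in_Z_qinv, simp)

lemma gbin_u_in_Z_qinv: "gbin qm2 r h \<in> Z_qinv"
  by (rule u.gbin_induct) (auto intro: Z_qinv_add Z_qinv_mult qm2_in_Z_qinv)

lemma gbin_w_in_Z_qinv: "gbin (qm2\<^sup>2) r h \<in> Z_qinv"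
  by (rule w.gbin_induct) (auto intro: Z_qinv_add Z_qinv_mult qm2_in_Z_qinv Z_qinv_power)

text \<open>Triangular numbers as integers, defined by recursion so that exponents of
  \<open>qq\<close> need no halving.\<close>

primrec tri :: "nat \<Rightarrow> int" where
  "tri 0 = 0"
| "tri (Suc n) = tri n + int n + 1"

lemma tri_add: "tri (k + l) = tri k + tri l + int k * int l"
  by (induction l) (simp_all add: algebra_simps)

lemma tri_nonneg: "tri n \<ge> 0"
  by (induction n) auto

lemma tri_pos: "n > 0 \<Longrightarrow> tri n > 0"
  using tri_nonneg[of "n - 1"] by (cases n) auto

lemma tri_double: "tri (2 * h) = 2 * tri h + int h * int h"
  using tri_add[of h h] by (simp only: mult_2)

lemma tri_ge: "tri n \<ge> int n"
  by (induction n) auto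

lemma int_triangle: "int (l * (l - 1) div 2) = tri l - int l"
proof (induction l)
  case (Suc l)
  have "Suc l * l div 2 = l + l * (l - 1) div 2"
  proof (cases l)
    case (Suc i)
    have "Suc (Suc i) * Suc i = 2 * Suc i + Suc i * i" by simp
    then show ?thesis using Suc by (metis div_mult_self4 mult.commute diff_Suc_1 zero_neq_numeral)
  qed simp
  then show ?case
    using Suc by simp
qed simp

text \<open>The coefficient of the \<open>k\<close>-th summand in the expansion
  \<open>iB_divpow_F\<close>: \<open>e\<close> gathers powers of \<open>qq\<close>, and the quantum
  integers come from repeated action of \<open>uE (tau i)\<close>.\<close>

definition scoef :: "int \<Rightarrow> int \<Rightarrow> nat \<Rightarrow> qfield" where
  "scoef e p k = qq powi (e * int k - tri k) * (\<Prod>t<k. qint (p + int t + 1)) / qfact k"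

section \<open>Expansion coefficients as Pochhammer symbols in base q^-2\<close>

lemma qint_conv_u: "qint (int r) = qq powi (int r - 1) * (1 - qm2 ^ r) / (1 - qm2)"
  by (simp add: qint_def qm2_def power_int_power' power_int_diff power_int_minus power_int_add divide_simps power2_eq_square)

lemma qm2_neq_1: "1 - qm2 \<noteq> 0"
  using u.one_minus_upow_nonzero[of 0] by simp

lemma qfact_conv_u: "qfact k = qq powi (tri k - int k) * upoch qm2 qm2 k / (1 - qm2) ^ k"
proof (induction k)
  case (Suc k)
  have "qint (int k + 1) = qq powi int k * (1 - qm2 ^ Suc k) / (1 - qm2)"
    using qint_conv_u[of "Suc k"] by (simp add: add.commute)
  then show ?case
    using Suc qq_powi_add[of "int k" "tri k - int k"] by (simp add: upoch_Suc mult_ac)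
qed simp

lemma qint_prod_conv_u:
  "(\<Prod>t<k. qint (int p + int t + 1)) =
     qq powi (int k * int p + tri k - int k) * upoch qm2 (qm2 ^ (p + 1)) k / (1 - qm2) ^ k"
proof (induction k)
  case (Suc k)
  have "qint (int p + int k + 1) = qq powi (int p + int k) * (1 - qm2 ^ (p + 1) * qm2 ^ k) / (1 - qm2)"
    using qint_conv_u[of "p + k + 1"] by (simp add: power_add mult_ac add_ac)
  moreover have "qq powi (int (Suc k) * int p + tri (Suc k) - int (Suc k)) =
      qq powi (int k * int p + tri k - int k) * qq powi (int p + int k)"
    unfolding qq_powi_add[symmetric]
    by (rule arg_cong[where f = "\<lambda>e. qq powi e"]) (simp add: algebra_simps)
  ultimately show ?case
    unfolding prod.lessThan_Suc Suc.IH upoch_Suc power_Suc2 by (simp only: mult_ac times_divide_eq_right times_divide_eq_left divide_divide_eq_left)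
qed simp

lemma divide_cancel_factors:
  fixes a b c d f x y :: "'b::field"
  assumes "c * d \<noteq> 0" and *: "f * c = a * b"
  shows "a * (b * x / d) / (c * y / d) = f * (x / y)"
proof -
  have "a * (b * x / d) / (c * y / d) = (a * b) * x / (c * y)"
    using assms(1) by simp
  also have "\<dots> = f * (x / y)"
    using assms(1) by (simp flip: *)
  finally show ?thesis .
qed

text \<open>In base q^-2 the product over the factorial becomes \<open>gbin\<close>, so the
  coefficient is an explicit power of \<open>qq\<close> times an element of
  \<open>Z_qinv\<close>.\<close>

lemma scoef_eq:
  "scoef e (int p) k = qq powi ((e + int p) * int k - tri k) * gbin qm2 (p + 1) k"
proof -
  have "qq powi ((e + int p) * int k - tri k) * qq powi (tri k - int k) =
      qq powi (e * int k - tri k) * qq powi (int k * int p + tri k - int k)"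
    unfolding qq_powi_add[symmetric]
    by (rule arg_cong[where f = "\<lambda>e. qq powi e"]) (simp add: algebra_simps)
  then show ?thesis
    unfolding scoef_def qfact_conv_u qint_prod_conv_u gbin_def
    using qm2_neq_1 by (intro divide_cancel_factors) auto
qed

lemma scoef_0 [simp]: "scoef e p 0 = 1"
  by (simp add: scoef_def)

text \<open>The hypothesis bounds the exponent in \<open>scoef_eq\<close> by \<open>- tri k\<close>,
  which is negative for \<open>k > 0\<close>.\<close>

lemma scoef_in_qinv_Z_qinv: "e + int p \<le> 0 \<Longrightarrow> k > 0 \<Longrightarrow> scoef e (int p) k \<in> qinv_Z_qinv"
proof -
  assume *: "e + int p \<le> 0" "k > 0"
  then have "(e + int p) * int k \<le> 0"
    by (simp add: mult_nonpos_nonneg)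
  then have "(e + int p) * int k - tri k < 0"
    using tri_pos[OF *(2)] by linarith
  then show ?thesis
    unfolding scoef_eq by (intro qinv_Z_qinv_mult qq_powi_in_qinv_Z_qinv gbin_u_in_Z_qinv)
qed

lemma qstep_conv_u:
  "qstep (int s) l = qq powi (int l * (int s - 2) + tri l * 2 - int l) * upoch (qm2\<^sup>2) (qm2 ^ s) l / (1 - qm2) ^ l"
proof (induction l)
  case (Suc l)
  have "qint (int s + 2 * int l) = qq powi (int s + 2 * int l - 1) * (1 - qm2 ^ s * (qm2\<^sup>2) ^ l) / (1 - qm2)"
    using qint_conv_u[of "s + 2 * l"] by (simp add: power_add power_mult)
  moreover have "qq powi (int (Suc l) * (int s - 2) + tri (Suc l) * 2 - int (Suc l)) =
      qq powi (int l * (int s - 2) + tri l * 2 - int l) * qq powi (int s + 2 * int l - 1)"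
    unfolding qq_powi_add[symmetric]
    by (rule arg_cong[where f = "\<lambda>e. qq powi e"]) (simp add: algebra_simps)
  ultimately show ?case
    unfolding qstep_Suc Suc.IH upoch_Suc power_Suc2
    by (simp only: mult_ac times_divide_eq_right times_divide_eq_left divide_divide_eq_left)
qed simp

text \<open>What remains of \<open>icoef (int s)\<close> once the sign, the power of
  \<open>qq\<close> and the denominator \<open>upoch qm2 qm2 l\<close> are removed.\<close>

definition iseq :: "nat \<Rightarrow> nat \<Rightarrow> qfield" where
  "iseq s = (if even s then upoch (qm2\<^sup>2) (qm2 ^ s) else u.odd_seq (qm2 ^ (s - 1)))"

lemma iseq_0 [simp]: "iseq s 0 = 1"
  by (simp add: iseq_def u.odd_seq_def)

lemma icoef_conv_u:
  assumes "s > 0"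
  shows "icoef (int s) l = (- 1) ^ l * qq powi (int l * (int s - 2) + tri l) * iseq s l / upoch qm2 qm2 l"
proof -
  have split: "qq powi (int l * (int s - 2) + tri l * 2 - int l) =
      qq powi (int l * (int s - 2) + tri l) * qq powi (tri l - int l)"
    unfolding qq_powi_add[symmetric]
    by (rule arg_cong[where f = "\<lambda>e. qq powi e"]) simp
  have "(if even s then qstep (int s) l
      else if l = 0 then 1 else qint (int s + int l - 1) * qstep (int s + 1) (l - 1)) =
      qq powi (int l * (int s - 2) + tri l * 2 - int l) * iseq s l / (1 - qm2) ^ l"
  proof (cases "even s \<or> l = 0")
    case True
    then show ?thesis
      by (auto simp: iseq_def qstep_conv_u u.odd_seq_def)
  next
    case False
    then obtain i where i: "l = Suc i"
      by (cases l) auto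
    have "qint (int s + int l - 1) = qq powi (int s + int l - 2) * (1 - qm2 ^ (s - 1) * qm2 ^ l) / (1 - qm2)"
    proof -
      have "int (s - 1 + l) = int s + int l - 1"
        using assms by simp
      then show ?thesis
        using qint_conv_u[of "s - 1 + l", unfolded power_add] by simp
    qed
    moreover have "qstep (int s + 1) i = qq powi (int i * (int s - 1) + tri i * 2 - int i) *
        upoch (qm2\<^sup>2) (qm2 ^ (s - 1) * qm2\<^sup>2) i / (1 - qm2) ^ i"
      using qstep_conv_u[of "s + 1" i] assms by (simp add: add.commute[of 1 "int s"] flip: power_add)
    moreover have "int l * (int s - 2) + tri l * 2 - int l =
        (int s + int l - 2) + (int i * (int s - 1) + tri i * 2 - int i)"
      by (simp add: i algebra_simps)
    then have "qq powi (int l * (int s - 2) + tri l * 2 - int l) =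
        qq powi (int s + int l - 2) * qq powi (int i * (int s - 1) + tri i * 2 - int i)"
      by (simp only: qq_powi_add[symmetric])
    moreover have "iseq s l = (1 - qm2 ^ (s - 1) * qm2 ^ l) * upoch (qm2\<^sup>2) (qm2 ^ (s - 1) * qm2\<^sup>2) i"
      using False by (simp add: iseq_def u.odd_seq_def i)
    moreover have "(if even s then qstep (int s) l
      else if l = 0 then 1 else qint (int s + int l - 1) * qstep (int s + 1) (l - 1)) =
      qint (int s + int l - 1) * qstep (int s + 1) i"
      using False by (simp add: i)
    moreover have "(1 - qm2) ^ l = (1 - qm2) * (1 - qm2) ^ i"
      by (simp add: i)
    ultimately show ?thesis
      by (simp only: mult_ac times_divide_eq_right times_divide_eq_left divide_divide_eq_left)
  qed
  then have "icoef (int s) l = (- 1) ^ l / (qq powi (tri l - int l) * upoch qm2 qm2 l / (1 - qm2) ^ l) *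
      (qq powi (int l * (int s - 2) + tri l) * qq powi (tri l - int l) * iseq s l / (1 - qm2) ^ l)"
    unfolding icoef_def split qfact_conv_u by simp
  then show ?thesis
    using qm2_neq_1 by simp
qed

text \<open>The factor in \<open>y\<close> of the candidate's coefficients, in hypergeometric form;
  it is used with \<open>s\<close> = \<alpha> and \<open>p = m - c\<close>.\<close>

definition Rsum :: "nat \<Rightarrow> nat \<Rightarrow> nat \<Rightarrow> qfield" where
  "Rsum s p y = qq powi (int y * int s - tri y) * u.hsum (iseq s) y (qm2 ^ (p + 1))"

lemma Rsum_0 [simp]: "Rsum s p 0 = 1"
  by (simp add: Rsum_def)

text \<open>Term by term in base q^-2: the part of the exponent of \<open>qq\<close> depending on
  \<open>l\<close> is twice l (y-l) + l (l-1)/2, matching the power of v = q^2 in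
  \<open>hsum\<close>; the rest is the prefactor of \<open>Rsum\<close>.\<close>

lemma sum_icoef_scoef:
  assumes "s > 0"
  shows "(\<Sum>l\<le>y. icoef (int s) l * scoef (int s - int p) (int (p + l)) (y - l)) = Rsum s p y"
  unfolding Rsum_def u.hsum_def sum_distrib_left
proof (intro sum.cong refl)
  fix l assume "l \<in> {..y}"
  then obtain k where y: "y = l + k"
    by (auto dest: le_Suc_ex)
  have "(qq\<^sup>2) ^ (l * k + l * (l - 1) div 2) = qq powi (2 * (int l * int k + (tri l - int l)))"
    unfolding int_triangle[symmetric] power_mult[symmetric]
    by (simp only: power_int_of_nat[symmetric] of_nat_mult of_nat_add of_nat_numeral)
  moreover have "int l * (int s - 2) + tri l + ((int s - int p + int (p + l)) * int k - tri k) =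
      (int y * int s - tri y) + 2 * (int l * int k + (tri l - int l))"
    by (simp add: y tri_add algebra_simps)
  then have "qq powi (int l * (int s - 2) + tri l) * qq powi ((int s - int p + int (p + l)) * int k - tri k) =
     qq powi (int y * int s - tri y) * qq powi (2 * (int l * int k + (tri l - int l)))"
    by (simp only: qq_powi_add[symmetric])
  ultimately have *: "qq powi (int l * (int s - 2) + tri l) * qq powi ((int s - int p + int (p + l)) * int k - tri k) =
     qq powi (int y * int s - tri y) * (qq\<^sup>2) ^ (l * k + l * (l - 1) div 2)"
    by simp
  have "icoef (int s) l * scoef (int s - int p) (int (p + l)) k =
      (qq powi (int l * (int s - 2) + tri l) * qq powi ((int s - int p + int (p + l)) * int k - tri k)) *
      ((- 1) ^ l * iseq s l * upoch qm2 (qm2 ^ (p + 1) * qm2 ^ l) k / (upoch qm2 qm2 l * upoch qm2 qm2 k))"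
    by (simp add: icoef_conv_u[OF assms] scoef_eq gbin_def power_add mult_ac del: of_nat_add)
  then show "icoef (int s) l * scoef (int s - int p) (int (p + l)) (y - l) =
      qq powi (int y * int s - tri y) * ((- 1) ^ l * (qq\<^sup>2) ^ (l * (y - l) + l * (l - 1) div 2) * iseq s l *
        upoch qm2 (qm2 ^ (p + 1) * qm2 ^ l) (y - l) / (upoch qm2 qm2 l * upoch qm2 qm2 (y - l)))"
    unfolding * by (simp add: y mult_ac)
qed

text \<open>This is \<open>hsum_shift_argument\<close> at B = u^(p+1). The exponent on the right is
  negative as soon as \<open>s \<le> p + 1\<close>.\<close>

lemma Rsum_Suc:
  "Rsum s (Suc p) (Suc y) = Rsum s p (Suc y) + qq powi (int s - int y - 2 * int p - 3) * Rsum s (Suc p) y"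
proof -
  have "int (Suc y) * int s - tri (Suc y) + - 2 * int (p + 1) =
      (int s - int y - 2 * int p - 3) + (int y * int s - tri y)"
    by (simp add: algebra_simps)
  then have "qq powi (int (Suc y) * int s - tri (Suc y)) * qq powi (- 2 * int (p + 1)) =
      qq powi (int s - int y - 2 * int p - 3) * qq powi (int y * int s - tri y)"
    by (simp only: qq_powi_add[symmetric])
  moreover have "u.hsum (iseq s) (Suc y) (qm2 ^ (Suc p + 1)) = u.hsum (iseq s) (Suc y) (qm2 ^ (p + 1)) +
      qq powi (- 2 * int (p + 1)) * u.hsum (iseq s) y (qm2 ^ (Suc p + 1))"
    using u.hsum_shift_argument[of "iseq s" y "qm2 ^ (p + 1)"] unfolding qm2_power[symmetric]
    by (simp add: mult.commute)
  ultimately show ?thesis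
    unfolding Rsum_def by (simp only: ring_distribs mult.assoc[symmetric])
qed

text \<open>At \<open>p = s - 1\<close> the argument is u^s, where the closed forms apply:
  \<open>A\<close> = u^s for even \<open>s\<close>, and C u with \<open>C\<close> = u^(s-1) for odd
  \<open>s\<close>. Odd \<open>y\<close> gives zero, even \<open>y\<close> a negative power of
  \<open>qq\<close> times a Gaussian binomial in base q^-4.\<close>

lemma Rsum_base:
  assumes "s > 0" and "y > 0"
  shows "Rsum s (s - 1) y \<in> qinv_Z_qinv"
proof -
  define h where "h = y div 2"
  have "Rsum s (s - 1) y = 0 \<or> h > 0 \<and> (\<exists>e r. e < 0 \<and> Rsum s (s - 1) y = qq powi e * gbin (qm2\<^sup>2) r h)"
  proof (cases "even y")
    case False
    then have y: "y = 2 * h + 1"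
      by (simp add: h_def)
    show ?thesis
    proof (cases "even s")
      case True
      then show ?thesis
        using assms u.hsum_balanced[of "qm2 ^ s" h] by (simp add: Rsum_def iseq_def y)
    next
      case False
      then have "qm2 ^ (s - 1) * qm2 = qm2 ^ s"
        using assms by (metis Suc_pred' power_Suc2)
      then show ?thesis
        using assms False u.hsum_odd_seq[of "qm2 ^ (s - 1)" h] by (simp add: Rsum_def iseq_def y)
    qed
  next
    case True
    then have y: "y = 2 * h" and h: "h > 0"
      using assms by (auto simp: h_def)
    \<comment> \<open>For odd \<open>s\<close> the exponent is
      \<open>int h * 2 - tri (2 * h)\<close>, so positivity of \<open>tri (2 * h)\<close> alone
      would not suffice.\<close>
    have tri: "tri (2 * h) > int h * 2"
    proof -
      have "int h * int h > 0"
        using h by simp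
      then show ?thesis
        unfolding tri_double using tri_ge[of h] by linarith
    qed
    show ?thesis
    proof (cases "even s")
      case True
      then obtain r where r: "s = 2 * r"
        by blast
      have "u.hsum (iseq s) y (qm2 ^ s) = (qm2 ^ s) ^ h * upoch (qm2\<^sup>2) (qm2 ^ s) h / upoch (qm2\<^sup>2) (qm2\<^sup>2) h"
        using True u.hsum_balanced[of "qm2 ^ s" h] by (simp add: iseq_def y)
      also have "\<dots> = qq powi (- 2 * int (s * h)) * gbin (qm2\<^sup>2) r h"
        unfolding power_mult[symmetric, of _ s h] qm2_power[of "s * h"] unfolding r power_mult gbin_def by simp
      finally have "Rsum s (s - 1) y = qq powi (int y * int s - tri y) * qq powi (- 2 * int (s * h)) * gbin (qm2\<^sup>2) r h"
        using assms by (simp add: Rsum_def mult.assoc)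
      also have "qq powi (int y * int s - tri y) * qq powi (- 2 * int (s * h)) = qq powi (- tri (2 * h))"
        unfolding qq_powi_add[symmetric] by (rule arg_cong[where f = "\<lambda>e. qq powi e"]) (simp add: y)
      finally show ?thesis
        using h tri by (intro disjI2 conjI exI[of _ "- tri (2 * h)"] exI[of _ r]) auto
    next
      case False
      then obtain r where r: "s = 2 * r + 1"
        by (auto elim: oddE)
      have "qm2 ^ (2 * r) * qm2 = qm2 ^ s"
        by (simp add: r)
      then have "u.hsum (iseq s) y (qm2 ^ s) =
          (qm2 ^ (2 * r)) ^ h * upoch (qm2\<^sup>2) (qm2 ^ (2 * r) * qm2\<^sup>2) h / upoch (qm2\<^sup>2) (qm2\<^sup>2) h"
        using u.hsum_odd_seq[of "qm2 ^ (2 * r)" h] by (simp add: iseq_def y r mult.commute)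
      also have "qm2 ^ (2 * r) * qm2\<^sup>2 = (qm2\<^sup>2) ^ (r + 1)"
        by (simp add: power_mult)
      also have "(qm2 ^ (2 * r)) ^ h * upoch (qm2\<^sup>2) ((qm2\<^sup>2) ^ (r + 1)) h / upoch (qm2\<^sup>2) (qm2\<^sup>2) h =
          qq powi (- 2 * int (2 * r * h)) * gbin (qm2\<^sup>2) (r + 1) h"
        unfolding power_mult[symmetric, of _ "2 * r" h] qm2_power[of "2 * r * h"] gbin_def by simp
      finally have "Rsum s (s - 1) y = qq powi (int y * int s - tri y) * qq powi (- 2 * int (2 * r * h)) * gbin (qm2\<^sup>2) (r + 1) h"
        using assms by (simp add: Rsum_def mult.assoc)
      also have "qq powi (int y * int s - tri y) * qq powi (- 2 * int (2 * r * h)) = qq powi (int h * 2 - tri (2 * h))"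
        unfolding qq_powi_add[symmetric] by (rule arg_cong[where f = "\<lambda>e. qq powi e"]) (simp add: y r algebra_simps)
      finally show ?thesis
        using h tri by (intro disjI2 conjI exI[of _ "int h * 2 - tri (2 * h)"] exI[of _ "r + 1"]) auto
    qed
  qed
  then show ?thesis
    by (auto intro!: qinv_Z_qinv_mult qq_powi_in_qinv_Z_qinv gbin_w_in_Z_qinv)
qed

text \<open>Outer induction on \<open>p\<close> upwards from \<open>s - 1\<close>, inner induction
  on \<open>y\<close>: by \<open>Rsum_Suc\<close> the new value is an earlier one plus a term damped
  by a negative power of \<open>qq\<close>.\<close>

lemma Rsum_in_qinv_Z_qinv:
  assumes "s > 0" and "s \<le> p + 1" and "y > 0"
  shows "Rsum s p y \<in> qinv_Z_qinv"
proof -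
  from assms(2) have "s - 1 \<le> p"
    by simp
  then show ?thesis
    using assms(3)
  proof (induction p arbitrary: y rule: dec_induct)
    case base
    then show ?case
      by (rule Rsum_base[OF assms(1)])
  next
    case (step p)
    from step.prems show ?case
    proof (induction y)
      case (Suc y)
      \<comment> \<open>For \<open>y = 0\<close> the value is 1, which lies in the ring but not in
        the ideal; the negative power of \<open>qq\<close> makes up for this.\<close>
      have "Rsum s (Suc p) y \<in> Z_qinv"
        using Suc.IH by (cases y) (auto intro: qinv_Z_qinv_subset)
      moreover have "int s - int y - 2 * int p - 3 < 0"
        using step.hyps assms(1) by linarith
      ultimately show ?case
        unfolding Rsum_Suc using step.IH[of "Suc y"]
        by (auto intro!: qinv_Z_qinv_add qinv_Z_qinv_mult qq_powi_in_qinv_Z_qinv)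
    qed simp
  qed
qed

section \<open>Modules over the quantum group\<close>

text \<open>Scalars sit at the empty word, which commutes with every word; the induction adds one
  monomial at a time.\<close>

lemma fscal_commute: "fscal c * f = f * fscal c"
proof (induction f rule: update_induct)
  case const
  show ?case by simp
next
  case (update f k a)
  have "Poly_Mapping.update k a f = f + Poly_Mapping.single k a"
    using update by (intro poly_mapping_eqI) (auto simp: lookup_update lookup_add lookup_single when_def in_keys_iff)
  then show ?case
    using update by (simp add: ring_distribs fscal_def mult_single mult.commute)
qed

lemma scal_add: "scal (c + d) = scal c + scal d"
  by transfer (simp add: fscal_def single_add uq_ideal.zero)

lemma scal_mult: "scal (c * d) = scal c * scal d"
  by transfer (simp add: fscal_def mult_single uq_ideal.zero)

lemma scal_1: "scal 1 = 1"
  by transfer (simp add: fscal_def uq_ideal.zero)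

lemma scal_0: "scal 0 = 0"
  by transfer (simp add: fscal_def uq_ideal.zero)

lemma scal_commute: "scal c * x = x * scal c"
  by transfer (simp add: fscal_commute uq_ideal.zero)

lemma uK_uKinv: "uK i * uKinv i = 1" "uKinv i * uK i = 1"
  by (transfer, rule uq_ideal.K_Kinv) (transfer, rule uq_ideal.Kinv_K)

lemma uK_uF: "uK i * uF j * uKinv i = scal (qq powi (- cartan i j)) * uF j"
  by transfer (rule uq_ideal.K_F)

lemma uE_uF_same_aux:
  "fE i * fF i - fF i * fE i - fscal c * (fK i - fKinv i) \<in> uq_ideal \<Longrightarrow>
   uE i * uF i - uF i * uE i = scal c * (uK i - uKinv i)"
  by transfer

lemma uE_uF_same: "uE i * uF i - uF i * uE i = scal (1 / (qq - qq powi (- 1))) * (uK i - uKinv i)"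
  using uq_ideal.E_F[of i i] by (intro uE_uF_same_aux) simp

lemma uE_uF_other: "i \<noteq> j \<Longrightarrow> uE i * uF j = uF j * uE i"
proof (transfer)
  fix i j :: idx assume "i \<noteq> j"
  then show "fE i * fF j - fF j * fE i \<in> uq_ideal"
    using uq_ideal.E_F[of i j] by simp
qed

locale uq_rep =
  fixes act :: "uq \<Rightarrow> 'v::ab_group_add \<Rightarrow> 'v"
  assumes rep: "uq_module act"
begin

abbreviation scale (infixr "\<cdot>" 75) where
  "c \<cdot> v \<equiv> act (scal c) v"

lemma act_add_right: "act u (v + w) = act u v + act u w"
  and act_add_left: "act (x + y) v = act x v + act y v"
  and act_mult: "act (x * y) v = act x (act y v)"
  and act_1 [simp]: "act 1 v = v"
  using rep by (auto simp: uq_module_def)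

lemma act_0_left [simp]: "act 0 v = 0"
  using act_add_left[of 0 0 v] by simp

lemma act_diff_left: "act (x - y) v = act x v - act y v"
  using act_add_left[of "x - y" y v] by simp

text \<open>Scalars act through the algebra, which turns the bare abelian group into a vector space
  over \<open>qfield\<close>.\<close>

sublocale vector_space "(\<cdot>)"
  by standard (simp_all add: act_add_right act_add_left act_mult scal_add scal_mult scal_1)

lemma act_scale: "act u (c \<cdot> v) = c \<cdot> act u v"
  by (simp only: act_mult[symmetric] scal_commute)

lemmas gen_scale = act_scale[of "uE i" for i] act_scale[of "uF i" for i] act_scale[of "uK i" for i]
  act_scale[of "uKinv i" for i] act_scale[of "iB s i" for s i] act_scale[of "divpow X r" for X r]

lemma act_0_right [simp]: "act u 0 = 0"
  using act_add_right[of u 0 0] by simp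

lemma act_minus_right: "act u (- v) = - act u v"
  using act_add_right[of u v "- v"] by (simp add: add_eq_0_iff)

lemma act_sum_right: "act u (\<Sum>i\<in>I. f i) = (\<Sum>i\<in>I. act u (f i))"
  by (induction I rule: infinite_finite_induct) (auto simp: act_add_right)

lemma Kinv_K [simp]: "act (uKinv i) (act (uK i) v) = v"
  and K_Kinv [simp]: "act (uK i) (act (uKinv i) v) = v"
  by (simp_all flip: act_mult add: uK_uKinv)

lemma K_F: "act (uK i) (act (uF j) v) = qq powi (- cartan i j) \<cdot> act (uF j) (act (uK i) v)"
proof -
  have "act (uK i * uF j * uKinv i) (act (uK i) v) = act (scal (qq powi (- cartan i j)) * uF j) (act (uK i) v)"
    by (simp only: uK_uF)
  then show ?thesis by (simp only: act_mult Kinv_K)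
qed

lemma E_F_same: "act (uE i) (act (uF i) v) = act (uF i) (act (uE i) v) +
    (1 / (qq - qq powi (- 1))) \<cdot> (act (uK i) v - act (uKinv i) v)"
proof -
  have "act (uE i * uF i - uF i * uE i) v = act (scal (1 / (qq - qq powi (- 1))) * (uK i - uKinv i)) v"
    by (simp only: uE_uF_same)
  then show ?thesis
    by (simp only: act_mult act_diff_left) (simp add: algebra_simps)
qed

lemma E_F_other: "i \<noteq> j \<Longrightarrow> act (uE i) (act (uF j) v) = act (uF j) (act (uE i) v)"
  by (metis act_mult uE_uF_other)

definition wt :: "idx \<Rightarrow> int \<Rightarrow> 'v \<Rightarrow> bool" where
  "wt i h v \<longleftrightarrow> act (uK i) v = (qq powi h) \<cdot> v"

lemma wt_Kinv: "wt i h v \<Longrightarrow> act (uKinv i) v = (qq powi (- h)) \<cdot> v"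
proof -
  assume "wt i h v"
  then have "v = qq powi h \<cdot> act (uKinv i) v"
    using Kinv_K[of i v] by (simp add: wt_def gen_scale)
  then have "qq powi (- h) \<cdot> v = qq powi (- h) \<cdot> (qq powi h \<cdot> act (uKinv i) v)"
    by simp
  also have "\<dots> = act (uKinv i) v"
    by (simp only: scale_scale qq_powi_add[symmetric]) simp
  finally show ?thesis ..
qed

lemma E_F_wt: "wt i h v \<Longrightarrow> act (uE i) (act (uF i) v) = act (uF i) (act (uE i) v) + qint h \<cdot> v"
proof -
  assume "wt i h v"
  then have "act (uK i) v - act (uKinv i) v = (qq powi h - qq powi (- h)) \<cdot> v"
    by (simp add: wt_def wt_Kinv scale_left_diff_distrib del: power_int_minus)
  then show ?thesis
    by (simp add: E_F_same qint_def)
qed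

lemma wt_0 [simp]: "wt i h 0"
  by (simp add: wt_def)

lemma wt_scale: "wt i h v \<Longrightarrow> wt i h (c \<cdot> v)"
  by (simp add: wt_def gen_scale mult.commute)

lemma wt_add: "wt i h v \<Longrightarrow> wt i h w \<Longrightarrow> wt i h (v + w)"
  by (simp add: wt_def act_add_right scale_right_distrib)

lemma wt_sum: "(\<And>x. x \<in> I \<Longrightarrow> wt i h (f x)) \<Longrightarrow> wt i h (\<Sum>x\<in>I. f x)"
  by (induction I rule: infinite_finite_induct) (auto intro: wt_add)

lemma wt_F: "wt i h v \<Longrightarrow> wt i (h - cartan i j) (act (uF j) v)"
  by (simp add: wt_def K_F gen_scale qq_powi_add[symmetric] del: power_int_minus)

subsection \<open>Divided powers\<close>

lemma divpow_negative [simp]: "r < 0 \<Longrightarrow> divpow X r = 0"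
  by (simp add: divpow_def)

lemma act_divpow_0 [simp]: "act (divpow X 0) v = v"
  by (simp add: divpow_def scal_1)

lemma act_act_divpow:
  "act X (act (divpow X (int k)) v) = qint (int k + 1) \<cdot> act (divpow X (int k + 1)) v"
proof -
  have "scal (qint (int k + 1)) * divpow X (int k + 1) =
      scal (qint (int k + 1)) * scal (1 / qfact (Suc k)) * X * X ^ k"
    by (simp add: divpow_def nat_add_distrib mult.assoc)
  also have "scal (qint (int k + 1)) * scal (1 / qfact (Suc k)) = scal (1 / qfact k)"
    using qint_nonzero[of "int k + 1"] by (simp flip: scal_mult)
  also have "scal (1 / qfact k) * X * X ^ k = X * divpow X (int k)"
    by (subst scal_commute) (simp add: divpow_def mult.assoc)
  finally show ?thesis
    by (simp only: act_mult[symmetric])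
qed

lemma act_divpow_Suc:
  "act (divpow X (int k + 1)) v = (1 / qint (int k + 1)) \<cdot> act X (act (divpow X (int k)) v)"
  using qint_nonzero[of "int k + 1"] by (simp add: act_act_divpow)

lemma E_divpow_F_other:
  assumes "i \<noteq> j"
  shows "act (uE i) (act (divpow (uF j) r) v) = act (divpow (uF j) r) (act (uE i) v)"
proof (cases "r < 0")
  case False
  have "act (uE i) (act (divpow (uF j) (int k)) v) = act (divpow (uF j) (int k)) (act (uE i) v)" for k
    using act_divpow_Suc[of "uF j"]
    by (induction k) (simp_all add: add.commute gen_scale E_F_other[OF assms])
  from this[of "nat r"] show ?thesis
    using False by simp
qed simp

lemma wt_divpow_F:
  assumes "wt i h v"
  shows "wt i (h - cartan i j * r) (act (divpow (uF j) r) v)"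
proof (cases "r < 0")
  case False
  have "wt i (h - cartan i j * int k) (act (divpow (uF j) (int k)) v)" for k
  proof (induction k)
    case (Suc k)
    then show ?case
      using wt_scale[OF wt_F[OF Suc, of j], of "1 / qint (int k + 1)"] act_divpow_Suc[of "uF j" k v]
      by (simp add: algebra_simps)
  qed (use assms in simp)
  from this[of "nat r"] show ?thesis
    using False by simp
qed simp

text \<open>Induction using that \<open>uF i\<close> times the power of order \<open>k\<close> is a
  quantum multiple of the next one; the scalars produced combine by
  \<open>qint_product_sum\<close>.\<close>

lemma E_divpow_F_same:
  assumes "wt i h v"
  shows "act (uE i) (act (divpow (uF i) (int k + 1)) v) =
    act (divpow (uF i) (int k + 1)) (act (uE i) v) + qint (h - int k) \<cdot> act (divpow (uF i) (int k)) v"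
proof (induction k)
  case 0
  show ?case
    using act_divpow_Suc[of "uF i" 0] E_F_wt[OF assms] by simp
next
  case (Suc k)
  have nz: "qint (int (Suc k) + 1) \<noteq> 0"
    by (intro qint_nonzero) simp
  have "wt i (h - 2 * (int k + 1)) (act (divpow (uF i) (int (Suc k))) v)"
    using wt_divpow_F[OF assms, of i "int (Suc k)"] by (simp add: cartan_def algebra_simps)
  then have "act (uE i) (act (uF i) (act (divpow (uF i) (int (Suc k))) v)) =
      act (uF i) (act (uE i) (act (divpow (uF i) (int (Suc k))) v)) +
      qint (h - 2 * (int k + 1)) \<cdot> act (divpow (uF i) (int (Suc k))) v"
    by (rule E_F_wt)
  also have "act (uE i) (act (divpow (uF i) (int (Suc k))) v) =
    act (divpow (uF i) (int (Suc k))) (act (uE i) v) + qint (h - int k) \<cdot> act (divpow (uF i) (int k)) v"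
    using Suc by (simp add: add.commute)
  also have "act (uF i) \<dots> = qint (int (Suc k) + 1) \<cdot> act (divpow (uF i) (int (Suc k) + 1)) (act (uE i) v) +
      (qint (h - int k) * qint (int k + 1)) \<cdot> act (divpow (uF i) (int (Suc k))) v"
    by (simp only: act_add_right gen_scale act_act_divpow scale_scale) (simp add: add.commute)
  finally have "act (uE i) (act (uF i) (act (divpow (uF i) (int (Suc k))) v)) =
      qint (int (Suc k) + 1) \<cdot> act (divpow (uF i) (int (Suc k) + 1)) (act (uE i) v) +
      (qint (h - int k) * qint (int k + 1) + qint (h - 2 * (int k + 1))) \<cdot> act (divpow (uF i) (int (Suc k))) v"
    by (simp add: scale_left_distrib)
  also have "qint (h - int k) * qint (int k + 1) + qint (h - 2 * (int k + 1)) =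
      qint (int (Suc k) + 1) * qint (h - int (Suc k))"
    using qint_product_sum[of "int k + 2" "int k + 1" "h - int k - 1"] by (simp add: algebra_simps)
  finally show ?case
    unfolding act_divpow_Suc[of "uF i" "Suc k"] gen_scale using nz by (simp add: scale_right_distrib)
qed

text \<open>For \<open>r \<le> 0\<close> both sides vanish, since divided powers of negative order
  are zero. Validity for every integer \<open>r\<close> allows chains of ever lower powers.\<close>

lemma E_divpow_F_singular:
  assumes "wt i h v" and "act (uE i) v = 0"
  shows "act (uE i) (act (divpow (uF i) r) v) = qint (h - r + 1) \<cdot> act (divpow (uF i) (r - 1)) v"
proof (cases "r \<le> 0")
  case True
  then show ?thesis
    using assms by (cases "r = 0") auto
next
  case False
  then obtain k where "r = int k + 1"
    by (metis add.commute linorder_not_le zero_less_imp_eq_int of_nat_Suc gr0_implies_Suc of_nat_0_less_iff)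
  then show ?thesis
    using E_divpow_F_same[OF assms(1), of k] assms(2) by simp
qed

subsection \<open>Powers of the generators of the coideal subalgebra\<close>

lemma iB_act: "act (iB \<sigma> i) v = act (uF i) v + (qq powi par \<sigma> i) \<cdot> act (uE (tau i)) (act (uKinv i) v)"
  by (simp add: iB_def act_add_left act_mult)

lemma tau_neq: "tau i \<noteq> i" "i \<noteq> tau i"
  by (cases i; simp)+

lemma cartan_tau [simp]: "cartan i (tau i) = - 1" "cartan (tau i) i = - 1" "cartan i i = 2"
  using tau_neq[of i] by (auto simp: cartan_def)

lemma Kinv_F: "act (uKinv i) (act (uF i) v) = qq powi 2 \<cdot> act (uF i) (act (uKinv i) v)"
proof -
  have "qq powi 2 \<cdot> act (uK i) (act (uF i) (act (uKinv i) v)) = act (uF i) v"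
    by (simp only: K_F K_Kinv cartan_tau scale_scale qq_powi_add[symmetric]) simp
  then have "act (uKinv i) (act (uF i) v) = act (uKinv i) (act (uK i) (qq powi 2 \<cdot> act (uF i) (act (uKinv i) v)))"
    by (simp only: gen_scale)
  then show ?thesis
    by (simp only: Kinv_K)
qed

text \<open>The second summand of \<open>iB\<close> q-commutes with \<open>uF i\<close>:
  \<open>uE (tau i)\<close> commutes with it and \<open>uKinv i\<close> contributes q^2 per
  factor.\<close>

lemma Y_divpow_F:
  "act (uE (tau i)) (act (uKinv i) (act (divpow (uF i) (int k)) v)) =
     qq powi (2 * int k) \<cdot> act (divpow (uF i) (int k)) (act (uE (tau i)) (act (uKinv i) v))"
proof (induction k)
  case (Suc k)
  have "qq powi (2 * int (Suc k)) = qq powi (2 * int k) * qq powi 2"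
    unfolding qq_powi_add[symmetric] by (rule arg_cong[where f = "\<lambda>e. qq powi e"]) simp
  then show ?case
    using Suc act_divpow_Suc[of "uF i" k]
    by (simp add: add.commute gen_scale Kinv_F E_F_other[OF tau_neq(1)] mult_ac)
qed simp

text \<open>The q-binomial theorem for the two q-commuting summands of \<open>iB\<close>, on a
  sequence of vectors that the second summand shifts up to scalars \<open>y t\<close>; powers of
  that summand become products of these scalars.\<close>

lemma iB_divpow_chain:
  assumes "\<And>t. (qq powi par \<sigma> i) \<cdot> act (uE (tau i)) (act (uKinv i) (f t)) = y t \<cdot> f (Suc t)"
  shows "act (divpow (iB \<sigma> i) (int b)) (f 0) =
    (\<Sum>k\<le>b. (qq powi (int k * (int b - int k)) * (\<Prod>t<k. y t) / qfact k) \<cdot>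
       act (divpow (uF i) (int b - int k)) (f k))"
proof (induction b)
  case (Suc b)
  define c where "c b k = qq powi (int k * (int b - int k)) * (\<Prod>t<k. y t) / qfact k" for b k
  define w where "w k = act (divpow (uF i) (int (Suc b) - int k)) (f k)" for k
  have nz: "qint (int b + 1) \<noteq> 0"
    by (intro qint_nonzero) simp
  have F: "act (uF i) (act (divpow (uF i) (int b - int k)) (f k)) = qint (int (Suc b) - int k) \<cdot> w k" if "k \<le> b" for k
    using act_act_divpow[of "uF i" "b - k" "f k"] that by (simp add: w_def of_nat_diff algebra_simps)
  have Y: "(qq powi par \<sigma> i) \<cdot> act (uE (tau i)) (act (uKinv i) (act (divpow (uF i) (int b - int k)) (f k))) =
      (qq powi (2 * (int b - int k)) * y k) \<cdot> w (Suc k)" if "k \<le> b" for k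
  proof -
    have "(qq powi par \<sigma> i) \<cdot> act (uE (tau i)) (act (uKinv i) (act (divpow (uF i) (int (b - k))) (f k))) =
       qq powi (2 * int (b - k)) \<cdot> act (divpow (uF i) (int (b - k))) (y k \<cdot> f (Suc k))"
      by (simp only: Y_divpow_F assms[symmetric] gen_scale scale_scale mult.commute)
    then show ?thesis
      using that by (simp add: w_def gen_scale of_nat_diff)
  qed
  \<comment> \<open>The recursion for the coefficients: with the common factor \<open>P\<close>
    removed it is \<open>qint_add\<close> for b + 1 = (k+1) + (b-k).\<close>
  have coef: "qint (int b + 1) * c (Suc b) (Suc k) =
      c b (Suc k) * qint (int b - int k) + c b k * (qq powi (2 * (int b - int k)) * y k)" for k
  proof -
    define P where "P = (\<Prod>t<k. y t) * y k / (qfact k * qint (int k + 1))"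
    have nz: "qint (int k + 1) \<noteq> 0"
      by (intro qint_nonzero) simp
    have "qq powi (int (Suc k) * (int (Suc b) - int (Suc k))) * qint (int b + 1) =
        qq powi (int (Suc k) * (int (Suc b) - int (Suc k))) * qq powi (int b - int k) * qint (int k + 1) +
        qq powi (int (Suc k) * (int (Suc b) - int (Suc k))) * qq powi (- (int k + 1)) * qint (int b - int k)"
      using qint_add[of "int k + 1" "int b - int k"] by (simp only: ring_distribs mult.assoc) (simp add: algebra_simps)
    also have "qq powi (int (Suc k) * (int (Suc b) - int (Suc k))) * qq powi (int b - int k) =
        qq powi (int k * (int b - int k)) * qq powi (2 * (int b - int k))"
      unfolding qq_powi_add[symmetric] by (rule arg_cong[where f = "\<lambda>e. qq powi e"]) (simp add: algebra_simps)
    also have "qq powi (int (Suc k) * (int (Suc b) - int (Suc k))) * qq powi (- (int k + 1)) =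
        qq powi (int (Suc k) * (int b - int (Suc k)))"
      unfolding qq_powi_add[symmetric] by (rule arg_cong[where f = "\<lambda>e. qq powi e"]) (simp add: algebra_simps)
    finally have *: "qq powi (int (Suc k) * (int (Suc b) - int (Suc k))) * qint (int b + 1) * P =
      (qq powi (int k * (int b - int k)) * qq powi (2 * (int b - int k)) * qint (int k + 1) +
       qq powi (int (Suc k) * (int b - int (Suc k))) * qint (int b - int k)) * P"
      by simp
    have "c (Suc b) (Suc k) = qq powi (int (Suc k) * (int (Suc b) - int (Suc k))) * P"
      "c b (Suc k) = qq powi (int (Suc k) * (int b - int (Suc k))) * P"
      "c b k * y k = qq powi (int k * (int b - int k)) * (qint (int k + 1) * P)"
      unfolding c_def P_def using nz by (simp_all add: mult_ac)
    moreover have "c b k * (qq powi (2 * (int b - int k)) * y k) = (c b k * y k) * qq powi (2 * (int b - int k))"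
      by (simp only: mult_ac)
    ultimately show ?thesis
      using * by (simp only: ring_distribs mult_ac add_ac)
  qed
  have coef0: "qint (int b + 1) * c (Suc b) 0 = c b 0 * qint (int (Suc b))"
    by (simp add: c_def add.commute)
  have "act (iB \<sigma> i) (act (divpow (iB \<sigma> i) (int b)) (f 0)) =
      (\<Sum>k\<le>b. c b k \<cdot> act (iB \<sigma> i) (act (divpow (uF i) (int b - int k)) (f k)))"
    unfolding Suc.IH by (simp add: act_sum_right gen_scale c_def)
  also have "\<dots> = (\<Sum>k\<le>b. (c b k * qint (int (Suc b) - int k)) \<cdot> w k) +
      (\<Sum>k\<le>b. (c b k * (qq powi (2 * (int b - int k)) * y k)) \<cdot> w (Suc k))"
    unfolding sum.distrib[symmetric]
    by (intro sum.cong refl) (simp add: iB_act F Y scale_right_distrib del: of_nat_Suc)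
  \<comment> \<open>The added term \<open>k = Suc b\<close> has the factor
    \<open>qint 0\<close>.\<close>
  also have "(\<Sum>k\<le>b. (c b k * qint (int (Suc b) - int k)) \<cdot> w k) =
      (\<Sum>k\<le>Suc b. (c b k * qint (int (Suc b) - int k)) \<cdot> w k)"
    by simp
  also have "\<dots> = (c b 0 * qint (int (Suc b))) \<cdot> w 0 +
      (\<Sum>k\<le>b. (c b (Suc k) * qint (int b - int k)) \<cdot> w (Suc k))"
    by (simp add: sum.atMost_Suc_shift del: sum.atMost_Suc)
  also have "\<dots> + (\<Sum>k\<le>b. (c b k * (qq powi (2 * (int b - int k)) * y k)) \<cdot> w (Suc k)) =
      (\<Sum>k\<le>Suc b. (qint (int b + 1) * c (Suc b) k) \<cdot> w k)"
    by (simp only: sum.atMost_Suc_shift coef coef0 scale_left_distrib sum.distrib add.assoc)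
  finally have "act (iB \<sigma> i) (act (divpow (iB \<sigma> i) (int b)) (f 0)) =
      qint (int b + 1) \<cdot> (\<Sum>k\<le>Suc b. c (Suc b) k \<cdot> w k)"
    by (simp add: scale_sum_right del: sum.atMost_Suc)
  then show ?case
    using nz act_divpow_Suc[of "iB \<sigma> i" b "f 0"] by (simp add: c_def w_def add.commute)
qed simp

text \<open>As \<open>uE (tau i)\<close> kills \<open>v\<close>, \<open>E_divpow_F_singular\<close>
  makes the decreasing divided powers of \<open>uF (tau i)\<close> on \<open>v\<close> a chain for
  \<open>iB_divpow_chain\<close>. Collecting powers of \<open>qq\<close> gives
  \<open>scoef\<close>.\<close>

lemma iB_divpow_F:
  assumes "wt i h v" and "wt (tau i) h' v" and "act (uE (tau i)) v = 0"
  shows "act (divpow (iB \<sigma> i) (int b)) (act (divpow (uF (tau i)) (int c)) v) =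
    (\<Sum>k\<le>b. scoef (int b + par \<sigma> i - h - int c) (h' - int c) k \<cdot>
       act (divpow (uF i) (int b - int k)) (act (divpow (uF (tau i)) (int c - int k)) v))"
proof -
  define y where "y t = qq powi (par \<sigma> i - h - int c + int t) * qint (h' - int c + int t + 1)" for t
  have "act (uKinv i) (act (divpow (uF (tau i)) (int c - int t)) v) =
     qq powi (- (h + int c - int t)) \<cdot> act (divpow (uF (tau i)) (int c - int t)) v" for t
    using wt_Kinv[OF wt_divpow_F[OF assms(1), of "tau i" "int c - int t"]] by (simp add: algebra_simps)
  then have chain: "(qq powi par \<sigma> i) \<cdot> act (uE (tau i)) (act (uKinv i) (act (divpow (uF (tau i)) (int c - int t)) v)) =
      y t \<cdot> act (divpow (uF (tau i)) (int c - int (Suc t))) v" for t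
  proof -
    assume *: "\<And>t. act (uKinv i) (act (divpow (uF (tau i)) (int c - int t)) v) =
     qq powi (- (h + int c - int t)) \<cdot> act (divpow (uF (tau i)) (int c - int t)) v"
    have "qq powi par \<sigma> i * qq powi (- (h + int c - int t)) = qq powi (par \<sigma> i - h - int c + int t)"
      unfolding qq_powi_add[symmetric] by (rule arg_cong[where f = "\<lambda>e. qq powi e"]) simp
    moreover have "h' - (int c - int t) + 1 = h' - int c + int t + 1" "int c - int t - 1 = int c - int (Suc t)"
      by simp_all
    ultimately show ?thesis
      unfolding * gen_scale E_divpow_F_singular[OF assms(2,3)] y_def
      by (simp only: scale_scale mult.assoc[symmetric])
  qed
  have prod: "(\<Prod>t<k. y t) = qq powi (int k * (par \<sigma> i - h - int c) + (tri k - int k)) * (\<Prod>t<k. qint (h' - int c + int t + 1))" for k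
  proof (induction k)
    case (Suc k)
    have "qq powi (int (Suc k) * (par \<sigma> i - h - int c) + (tri (Suc k) - int (Suc k))) =
        qq powi (int k * (par \<sigma> i - h - int c) + (tri k - int k)) * qq powi (par \<sigma> i - h - int c + int k)"
      unfolding qq_powi_add[symmetric] by (rule arg_cong[where f = "\<lambda>e. qq powi e"]) (simp add: algebra_simps)
    then show ?case
      unfolding prod.lessThan_Suc Suc.IH unfolding y_def by (simp only: mult_ac)
  qed simp
  have "qq powi (int k * (int b - int k)) * (\<Prod>t<k. y t) / qfact k =
      scoef (int b + par \<sigma> i - h - int c) (h' - int c) k" for k
  proof -
    have "2 * tri k = int k * int k + int k"
      by (induction k) (simp_all add: algebra_simps)
    then have "qq powi (int k * (int b - int k)) * qq powi (int k * (par \<sigma> i - h - int c) + (tri k - int k)) =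
        qq powi ((int b + par \<sigma> i - h - int c) * int k - tri k)"
      unfolding qq_powi_add[symmetric] by (intro arg_cong[where f = "\<lambda>e. qq powi e"]) (simp add: algebra_simps)
    then show ?thesis
      unfolding prod scoef_def by (simp only: mult.assoc[symmetric])
  qed
  then show ?thesis
    using iB_divpow_chain[of \<sigma> i "\<lambda>t. act (divpow (uF (tau i)) (int c - int t)) v" y b, OF chain] by simp
qed

end

section \<open>B-monomials on the highest weight vector of L(m,n)\<close>

locale L_module = uq_rep act for act :: "uq \<Rightarrow> 'v::ab_group_add \<Rightarrow> 'v" +
  fixes \<eta> :: 'v and m n :: nat
  assumes L: "is_L act \<eta> m n"
begin

lemma eta_nonzero: "\<eta> \<noteq> 0"
  and E_eta [simp]: "act (uE i) \<eta> = 0"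
  and wt1_eta: "wt I1 (int m) \<eta>"
  and wt2_eta: "wt I2 (int n) \<eta>"
  using L by (auto simp: is_L_def wt_def)

lemma Fmon_eq: "Fmon act \<eta> a b c = act (divpow (uF I1) a) (act (divpow (uF I2) b) (act (divpow (uF I1) c) \<eta>))"
  by (simp add: Fmon_def act_mult)

lemma Bmon_eq: "Bmon \<sigma> act \<eta> a b c =
    act (divpow (iB \<sigma> I1) a) (act (divpow (iB \<sigma> I2) b) (act (divpow (iB \<sigma> I1) c) \<eta>))"
  by (simp add: Bmon_def act_mult)

text \<open>Three uses of \<open>iB_divpow_F\<close>. The innermost collapses to F_1^(c) \<eta>, as
  negative divided powers of F_2 vanish. The outermost applies because E_2 kills F_1^(c-k)
  \<eta>.\<close>

lemma Bmon_expand: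
  "Bmon \<sigma> act \<eta> (int a) (int b) (int c) =
     (\<Sum>k\<le>b. \<Sum>x\<le>a.
        (scoef (int b + snd \<sigma> - int n - int c) (int m - int c) k *
         scoef (int a + fst \<sigma> - (int m - 2 * (int c - int k)) - (int b - int k)) (int n + int c - int b) x) \<cdot>
        Fmon act \<eta> (int a - int x) (int b - int x - int k) (int c - int k))"
proof -
  have "act (divpow (iB \<sigma> I1) (int c)) \<eta> = act (divpow (uF I1) (int c)) \<eta>"
  proof -
    have "act (divpow (iB \<sigma> I1) (int c)) \<eta> = (\<Sum>k\<le>c. scoef (int c + fst \<sigma> - int m) (int n) k \<cdot>
        act (divpow (uF I1) (int c - int k)) (act (divpow (uF I2) (- int k)) \<eta>))"
      using iB_divpow_F[OF wt1_eta, of "int n" \<sigma> c 0] wt2_eta by simp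
    also have "\<dots> = (\<Sum>k\<le>c. if k = 0 then act (divpow (uF I1) (int c)) \<eta> else 0)"
      by (intro sum.cong refl) auto
    finally show ?thesis
      by (simp add: sum.delta)
  qed
  then have "Bmon \<sigma> act \<eta> (int a) (int b) (int c) =
     (\<Sum>k\<le>b. scoef (int b + snd \<sigma> - int n - int c) (int m - int c) k \<cdot>
       act (divpow (iB \<sigma> I1) (int a))
         (act (divpow (uF I2) (int b - int k)) (act (divpow (uF I1) (int c - int k)) \<eta>)))"
    using iB_divpow_F[OF wt2_eta, of "int m" \<sigma> b c] wt1_eta
    by (simp add: Bmon_eq act_sum_right gen_scale)
  also have "\<dots> = (\<Sum>k\<le>b. scoef (int b + snd \<sigma> - int n - int c) (int m - int c) k \<cdot>
     (\<Sum>x\<le>a. scoef (int a + fst \<sigma> - (int m - 2 * (int c - int k)) - (int b - int k)) (int n + int c - int b) x \<cdot>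
        Fmon act \<eta> (int a - int x) (int b - int x - int k) (int c - int k)))"
  proof (intro sum.cong refl arg_cong2[where f = "(\<cdot>)"])
    fix k assume "k \<in> {..b}"
    then obtain b' where b: "b = b' + k"
      by (metis atMost_iff le_add_diff_inverse2)
    let ?v = "act (divpow (uF I1) (int c - int k)) \<eta>"
    have "wt I1 (int m - 2 * (int c - int k)) ?v" "wt I2 (int n + int c - int k) ?v"
      using wt_divpow_F[OF wt1_eta, of I1 "int c - int k"] wt_divpow_F[OF wt2_eta, of I1 "int c - int k"]
      by (simp_all add: cartan_def algebra_simps)
    moreover have "act (uE I2) ?v = 0"
      by (simp add: E_divpow_F_other)
    ultimately show "act (divpow (iB \<sigma> I1) (int a)) (act (divpow (uF I2) (int b - int k)) ?v) =
        (\<Sum>x\<le>a. scoef (int a + fst \<sigma> - (int m - 2 * (int c - int k)) - (int b - int k)) (int n + int c - int b) x \<cdot>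
        Fmon act \<eta> (int a - int x) (int b - int x - int k) (int c - int k))"
      using iB_divpow_F[of I1 "int m - 2 * (int c - int k)" ?v "int n + int c - int k" \<sigma> a b']
      by (simp add: b Fmon_eq algebra_simps)
  qed
  finally show ?thesis
    by (simp add: scale_sum_right)
qed

end

section \<open>Linear independence of the monomials\<close>

text \<open>As for alternating series: each term is a strictly smaller multiple, of opposite sign,
  of its successor, so a partial sum is a positive multiple of its last term. Adding a term replaces
  \<open>s\<close> by \<open>1 - s * \<rho>\<close>.\<close>

lemma sum_alternating_contraction:
  fixes f :: "nat \<Rightarrow> 'a::linordered_field"
  assumes "\<And>i. i < A \<Longrightarrow> \<exists>\<rho>. 0 \<le> \<rho> \<and> \<rho> < 1 \<and> f i = - \<rho> * f (Suc i)"
  shows "\<exists>s. 0 < s \<and> s \<le> 1 \<and> (\<Sum>i\<le>A. f i) = s * f A"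
  using assms
proof (induction A)
  case 0
  then show ?case
    by (intro exI[of _ 1]) auto
next
  case (Suc A)
  then obtain s where s: "0 < s" "s \<le> 1" "(\<Sum>i\<le>A. f i) = s * f A"
    by (metis less_Suc_eq)
  obtain \<rho> where \<rho>: "0 \<le> \<rho>" "\<rho> < 1" "f A = - \<rho> * f (Suc A)"
    using Suc.prems[of A] by auto
  have "s * \<rho> < 1" "0 \<le> s * \<rho>"
    using s \<rho> mult_right_mono[of s 1 \<rho>] by auto
  moreover have "(\<Sum>i\<le>Suc A. f i) = (1 - s * \<rho>) * f (Suc A)"
    using s(3) \<rho>(3) by (simp add: algebra_simps)
  ultimately show ?case
    by (intro exI[of _ "1 - s * \<rho>"]) auto
qed

context uq_rep
begin

lemma divpow_divpow:
  "act (divpow X (int r)) (act (divpow X (int t)) v) =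
     (qfact (r + t) / (qfact r * qfact t)) \<cdot> act (divpow X (int (r + t))) v"
proof (induction r)
  case (Suc r)
  have nz: "qint (int r + 1) \<noteq> 0"
    by (intro qint_nonzero) simp
  have "act (divpow X (int (Suc r))) (act (divpow X (int t)) v) =
      (1 / qint (int r + 1)) \<cdot> act X (act (divpow X (int r)) (act (divpow X (int t)) v))"
    using act_divpow_Suc[of X r] by (simp add: add.commute)
  also have "\<dots> = (1 / qint (int r + 1)) \<cdot> (qfact (r + t) / (qfact r * qfact t)) \<cdot>
      qint (int (r + t) + 1) \<cdot> act (divpow X (int (r + t) + 1)) v"
    unfolding Suc by (simp only: act_scale[of X] act_act_divpow)
  finally show ?case
    using nz by (simp add: add.commute mult_ac)
qed simp

text \<open>Distinct eigenvalues of \<open>uK i\<close>: subtracting q^(h+t) times the relation from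
  its image under \<open>uK i\<close> removes the vector at \<open>t\<close> and rescales the others
  by nonzero scalars.\<close>

lemma weights_independent:
  assumes "finite S" and "\<And>s. s \<in> S \<Longrightarrow> wt i (h + int s) (v s)" and "(\<Sum>s\<in>S. v s) = 0" and "s \<in> S"
  shows "v s = 0"
  using assms
proof (induction S arbitrary: v s rule: finite_induct)
  case (insert t S)
  have "(\<Sum>s\<in>insert t S. act (uK i) (v s)) - (\<Sum>s\<in>insert t S. qq powi (h + int t) \<cdot> v s) = 0"
    using insert.prems(2) by (simp only: act_sum_right[symmetric] scale_sum_right[symmetric]) simp
  moreover have "act (uK i) (v s) = qq powi (h + int s) \<cdot> v s" if "s \<in> insert t S" for s
    using insert.prems(1)[OF that] by (simp add: wt_def)
  ultimately have sum': "(\<Sum>s\<in>S. (qq powi (h + int s) - qq powi (h + int t)) \<cdot> v s) = 0"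
    using insert.hyps by (simp add: scale_left_diff_distrib sum_subtractf)
  have wt': "wt i (h + int s) ((qq powi (h + int s) - qq powi (h + int t)) \<cdot> v s)" if "s \<in> S" for s
    using insert.prems(1) that by (intro wt_scale) auto
  have *: "(qq powi (h + int s) - qq powi (h + int t)) \<cdot> v s = 0" if "s \<in> S" for s
    using insert.IH[of "\<lambda>s. (qq powi (h + int s) - qq powi (h + int t)) \<cdot> v s" s, OF wt' sum' that] .
  have **: "v s = 0" if "s \<in> S" for s
  proof -
    have "qq powi (h + int s) \<noteq> qq powi (h + int t)"
    proof
      assume eq: "qq powi (h + int s) = qq powi (h + int t)"
      have "qq powi (int s - int t) * qq powi (h + int t) = qq powi (h + int s)"
        unfolding qq_powi_add[symmetric] by (rule arg_cong[where f = "\<lambda>e. qq powi e"]) simp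
      moreover have "qq powi (int t - int s) * qq powi (h + int s) = qq powi (h + int t)"
        unfolding qq_powi_add[symmetric] by (rule arg_cong[where f = "\<lambda>e. qq powi e"]) simp
      ultimately have "qq powi (int s - int t) = 1" "qq powi (int t - int s) = 1"
        using eq by simp_all
      moreover have "s \<noteq> t"
        using insert.hyps that by auto
      ultimately show False
        using qq_powi_neq_1[of "int s - int t"] qq_powi_neq_1[of "int t - int s"] by linarith
    qed
    then show ?thesis
      using *[OF that] by simp
  qed
  then have "v t = 0"
    using insert.prems(2) insert.hyps by simp
  then show ?case
    using ** insert.prems(3) by auto
qed simp

end

context L_module
begin

text \<open>E_1 passes F_2 and acts once on each power of F_1; for the outer power the scalar is
  read off the weight of the vector to its right.\<close>

lemma E1_Fmon:
  "act (uE I1) (Fmon act \<eta> r s t) =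
     qint (int m - t + 1) \<cdot> Fmon act \<eta> r s (t - 1) + qint (int m - 2 * t + s - r + 1) \<cdot> Fmon act \<eta> (r - 1) s t"
proof -
  let ?w = "act (divpow (uF I2) s) (act (divpow (uF I1) t) \<eta>)"
  have E: "act (uE I1) ?w = qint (int m - t + 1) \<cdot> act (divpow (uF I2) s) (act (divpow (uF I1) (t - 1)) \<eta>)"
    using E_divpow_F_singular[OF wt1_eta, of t] by (simp add: E_divpow_F_other gen_scale)
  have w: "wt I1 (int m - 2 * t + s) ?w"
    using wt_divpow_F[OF wt_divpow_F[OF wt1_eta, of I1 t], of I2 s] by (simp add: cartan_def)
  consider "r < 0" | "r = 0" | k where "r = int k + 1"
    by (metis add.commute gr0_implies_Suc int_nat_eq less_linear of_nat_Suc of_nat_0_less_iff zero_less_imp_eq_int)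
  then show ?thesis
  proof cases
    case 3
    then show ?thesis
      using E_divpow_F_same[OF w, of k] E by (simp add: Fmon_eq gen_scale) (simp add: algebra_simps)
  qed (simp_all add: Fmon_eq E)
qed

lemma E2_Fmon:
  "act (uE I2) (Fmon act \<eta> r s t) = qint (int n + t - s + 1) \<cdot> Fmon act \<eta> r (s - 1) t"
proof -
  have "wt I2 (int n + t) (act (divpow (uF I1) t) \<eta>)"
    using wt_divpow_F[OF wt2_eta, of I1 t] by (simp add: cartan_def)
  from E_divpow_F_singular[OF this, of s] show ?thesis
    by (simp add: Fmon_eq E_divpow_F_other gen_scale)
qed

lemma wt_Fmon: "wt I1 (int m - 2 * t + s - 2 * r) (Fmon act \<eta> r s t)"
  using wt_divpow_F[OF wt_divpow_F[OF wt_divpow_F[OF wt1_eta, of I1 t], of I2 s], of I1 r]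
  by (simp add: Fmon_eq cartan_def)

lemma F1_divpow_eta_nonzero: "k \<le> m \<Longrightarrow> act (divpow (uF I1) (int k)) \<eta> \<noteq> 0"
proof (induction k)
  case 0
  then show ?case
    using eta_nonzero by simp
next
  case (Suc k)
  have "act (uE I1) (act (divpow (uF I1) (int (Suc k))) \<eta>) = qint (int m - int k) \<cdot> act (divpow (uF I1) (int k)) \<eta>"
    using E_divpow_F_singular[OF wt1_eta, of "int (Suc k)"] by simp
  moreover have "qint (int m - int k) \<noteq> 0"
    using Suc.prems by (intro qint_nonzero) simp
  ultimately show ?case
    using Suc by auto
qed

definition E2_factor :: "nat \<Rightarrow> nat \<Rightarrow> qfield" where
  "E2_factor b i = (\<Prod>j<b. qint (int n + int i - int j))"

lemma E2_power_Fmon: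
  "(act (uE I2) ^^ b) (Fmon act \<eta> r (int b) (int i)) = E2_factor b i \<cdot> Fmon act \<eta> r 0 (int i)"
proof (induction b)
  case (Suc b)
  have pull: "(act (uE I2) ^^ k) (c \<cdot> v) = c \<cdot> (act (uE I2) ^^ k) v" for k c v
    by (induction k) (simp_all add: gen_scale)
  have "(act (uE I2) ^^ Suc b) (Fmon act \<eta> r (int (Suc b)) (int i)) =
      (act (uE I2) ^^ b) (qint (int n + int i - int b) \<cdot> Fmon act \<eta> r (int b) (int i))"
    unfolding funpow_Suc_right o_apply E2_Fmon by (simp add: algebra_simps)
  then show ?case
    using Suc by (simp add: pull E2_factor_def mult.commute)
qed (simp add: E2_factor_def)

lemma E2_factor_pos: "b \<le> n + i \<Longrightarrow> E2_factor b i > 0"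
  unfolding E2_factor_def by (intro prod_pos) (auto intro!: qint_pos)

lemma E2_factor_eq_0: "n + i < b \<Longrightarrow> E2_factor b i = 0"
  unfolding E2_factor_def by (intro prod_zero) (auto intro!: bexI[of _ "n + i"])

text \<open>Raising \<open>i\<close> shifts the product: a new top factor enters and the bottom one
  leaves. The identity is cross-multiplied because factors may vanish.\<close>

lemma E2_factor_Suc:
  "E2_factor b i * qint (int n + int i + 1) = E2_factor b (Suc i) * qint (int n + int i + 1 - int b)"
proof (induction b)
  case (Suc b)
  have "E2_factor (Suc b) i * qint (int n + int i + 1) =
      qint (int n + int i - int b) * (E2_factor b i * qint (int n + int i + 1))"
    by (simp add: E2_factor_def)
  also have "\<dots> = E2_factor (Suc b) (Suc i) * qint (int n + int i + 1 - int (Suc b))"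
    unfolding Suc by (simp add: E2_factor_def algebra_simps)
  finally show ?case .
qed (simp add: E2_factor_def)

lemma E2_power_sum: "(act (uE I2) ^^ b) (\<Sum>i\<in>I. f i \<cdot> v i) = (\<Sum>i\<in>I. f i \<cdot> (act (uE I2) ^^ b) (v i))"
  by (induction b) (simp_all add: act_sum_right gen_scale)

text \<open>The outer factors compare by monotonicity, as \<open>A \<le> b\<close>. For the others
  \<open>qint_mult_le\<close> applies, since (i+1) + (n+i+1-b) is at most n+i+1.\<close>

lemma contraction_factor:
  assumes "i < A" "A \<le> b" "A \<le> m" "b \<le> n + i"
  shows "qint (int m - int i) * (qint (int i + 1) * qint (int n + int i + 1 - int b)) <
    qint (int m + int b - int A - int i + 1) * (qint (int A - int i) * qint (int n + int i + 1))"
proof -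
  have "qint (int m - int i) < qint (int m + int b - int A - int i + 1)"
    using assms by (intro qint_less) auto
  moreover have "qint (int i + 1) * qint (int n + int i + 1 - int b) \<le> qint (int A - int i) * qint (int n + int i + 1)"
  proof -
    have "qint (int i + 1) * qint (int n + int i + 1 - int b) \<le> qint (int i + 1 + (int n + int i + 1 - int b))"
      using assms by (intro qint_mult_le) auto
    also have "\<dots> \<le> 1 * qint (int n + int i + 1)"
      unfolding mult_1 using assms by (intro qint_le) auto
    also have "\<dots> \<le> qint (int A - int i) * qint (int n + int i + 1)"
      using assms qint_le[of 1 "int A - int i"] by (intro mult_right_mono qint_nonneg) auto
    finally show ?thesis .
  qed
  moreover have "qint (int i + 1) * qint (int n + int i + 1 - int b) > 0"
    using assms by (intro mult_pos_pos qint_pos) auto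
  moreover have "qint (int m - int i) \<ge> 0"
    using assms by (intro qint_nonneg) auto
  ultimately show ?thesis
    by - (rule mult_less_le_imp_less)
qed

text \<open>The recursion \<open>rec\<close> is the one E_1 will provide. For \<open>A > m\<close>
  it descends from the zero coefficient at \<open>Suc m\<close>. Otherwise the \<open>b\<close>-th
  power of E_2 sends every monomial to a multiple of the nonzero vector F_1^(A) \<eta>, and the
  contraction forces the top term, then all lower ones, to vanish.\<close>

lemma Fmon_relation_alternating:
  assumes "A \<le> b" and supp: "\<And>i. i > A \<or> i > m \<Longrightarrow> l i = 0"
    and rel: "(\<Sum>i\<le>A. l i \<cdot> Fmon act \<eta> (int A - int i) (int b) (int i)) = 0"
    and rec: "\<And>i. i < A \<Longrightarrow> b \<le> n + i \<Longrightarrow>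
      l i * qint (int m + int b - int A - int i + 1) = - (l (Suc i) * qint (int m - int i))"
    and i: "b \<le> n + i"
  shows "l i = 0"
proof (cases "A \<le> m")
  case False
  have "l i = 0" if "i \<le> Suc m"
    using that
  proof (induction rule: inc_induct)
    case base
    show ?case
      by (rule supp) simp
  next
    case (step j)
    have "qint (int m + int b - int A - int j + 1) \<noteq> 0"
      using step False \<open>A \<le> b\<close> by (intro qint_nonzero) simp
    moreover have "l j * qint (int m + int b - int A - int j + 1) = - (l (Suc j) * qint (int m - int j))"
      using step False i by (intro rec) auto
    ultimately show ?case
      using step by simp
  qed
  then show ?thesis
    using supp[of i] by (cases "i \<le> Suc m") auto
next
  case True
  \<comment> \<open>Up to the common factor \<open>qfact A\<close>, the contribution of term
    \<open>j\<close> to the coefficient of F_1^(A) \<eta>.\<close>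
  define f where "f j = l j * E2_factor b j / (qfact (A - j) * qfact j)" for j
  have mon: "Fmon act \<eta> (int A - int j) 0 (int j) =
      (qfact A / (qfact (A - j) * qfact j)) \<cdot> act (divpow (uF I1) (int A)) \<eta>" if "j \<le> A" for j
    using divpow_divpow[of "uF I1" "A - j" j \<eta>] that by (simp add: Fmon_eq of_nat_diff)
  have "0 = (act (uE I2) ^^ b) (\<Sum>i\<le>A. l i \<cdot> Fmon act \<eta> (int A - int i) (int b) (int i))"
    unfolding rel by (induction b) simp_all
  also have "\<dots> = (\<Sum>j\<le>A. (f j * qfact A) \<cdot> act (divpow (uF I1) (int A)) \<eta>)"
    unfolding E2_power_sum E2_power_Fmon
    by (intro sum.cong refl) (simp add: mon f_def)
  also have "\<dots> = ((\<Sum>j\<le>A. f j) * qfact A) \<cdot> act (divpow (uF I1) (int A)) \<eta>"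
    by (simp add: sum_distrib_right scale_sum_left)
  finally have sum0: "(\<Sum>j\<le>A. f j) = 0"
    using F1_divpow_eta_nonzero[OF True] by simp
  have contr: "\<exists>\<rho>. 0 \<le> \<rho> \<and> \<rho> < 1 \<and> f j = - \<rho> * f (Suc j)" if "j < A" for j
  proof (cases "b \<le> n + j")
    \<comment> \<open>Here \<open>rec\<close> gives nothing, but \<open>E2_factor b j\<close> is
      zero, so the ratio 0 works.\<close>
    case False
    then show ?thesis
      by (intro exI[of _ 0]) (simp add: f_def E2_factor_eq_0)
  next
    case j: True
    define x where "x = qint (int m - int j) * (qint (int j + 1) * qint (int n + int j + 1 - int b))"
    define y where "y = qint (int m + int b - int A - int j + 1) * (qint (int A - int j) * qint (int n + int j + 1))"
    have "x < y"
      unfolding x_def y_def using that \<open>A \<le> b\<close> True j by (rule contraction_factor)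
    moreover have "x \<ge> 0"
      unfolding x_def using that True j by (intro mult_nonneg_nonneg qint_nonneg) auto
    moreover have "f j = - (x / y) * f (Suc j)"
    proof -
      from that obtain d where d: "A = Suc (j + d)"
        by (auto dest: less_imp_Suc_add)
      define p1 where "p1 = qint (int m + int b - int A - int j + 1)"
      define p2 where "p2 = qint (int n + int j + 1)"
      have nz: "p1 \<noteq> 0" "p2 \<noteq> 0" "qint (int d + 1) \<noteq> 0" "qint (int j + 1) \<noteq> 0"
        unfolding p1_def p2_def by (rule qint_nonzero; use that \<open>A \<le> b\<close> True in linarith)+
      have l: "l j = - (l (Suc j) * qint (int m - int j)) / p1"
        using rec[OF that j] nz by (simp add: p1_def field_simps)
      have e: "E2_factor b j = E2_factor b (Suc j) * qint (int n + int j + 1 - int b) / p2"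
        using E2_factor_Suc[of b j] nz by (simp add: p2_def field_simps)
      have A: "A - j = Suc d" "A - Suc j = d" "int A - int j = int d + 1"
        using d by auto
      show ?thesis
        unfolding f_def x_def y_def p1_def[symmetric] p2_def[symmetric] l e A qfact_Suc
        using nz by (simp add: field_simps)
    qed
    ultimately show ?thesis
      by (intro exI[of _ "x / y"]) auto
  qed
  obtain s where "0 < s" "(\<Sum>j\<le>A. f j) = s * f A"
    using sum_alternating_contraction[of A f] contr by blast
  then have top: "f A = 0"
    using sum0 by simp
  have "f i = 0" if "i \<le> A"
    using that
  proof (induction rule: inc_induct)
    case (step j)
    then show ?case
      using contr[of j] by auto
  qed (rule top)
  then have "l i = 0" if "i \<le> A"
    using that E2_factor_pos[OF i] by (simp add: f_def)
  then show ?thesis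
    using supp[of i] by (cases "i \<le> A") auto
qed

text \<open>Applying \<open>E\<^sub>1\<close> to a linear relation determines its coefficients up to a common factor, with alternating
  signs; applying a power of \<open>E\<^sub>2\<close> then yields an alternating sum whose terms decrease for the
  order on the ground field in which \<open>q\<close> is infinitely large.\<close>

lemma Fmon_relation_trivial:
  assumes "A \<le> b" and "\<And>i. i > A \<or> i > m \<Longrightarrow> l i = 0"
    and "(\<Sum>i\<le>A. l i \<cdot> Fmon act \<eta> (int A - int i) (int b) (int i)) = 0"
    and "b \<le> n + i"
  shows "l i = 0"
  using assms
proof (induction A arbitrary: l i)
  case 0
  then show ?case
    using Fmon_relation_alternating[of 0 b l i] by simp
next
  case (Suc A)
  \<comment> \<open>The coefficients of the image of the relation under E_1, with total power of F_1
    lowered by one. By induction they vanish, which is the recursion \<open>rec\<close>.\<close>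
  define k where "k i = (if i \<le> A then l i * qint (int m + int b - int (Suc A) - int i + 1) + l (Suc i) * qint (int m - int i) else 0)" for i
  have "0 = act (uE I1) (\<Sum>i\<le>Suc A. l i \<cdot> Fmon act \<eta> (int (Suc A) - int i) (int b) (int i))"
    unfolding Suc.prems(3) by simp
  also have "\<dots> = (\<Sum>i\<le>Suc A. (l i * qint (int m - int i + 1)) \<cdot> Fmon act \<eta> (int (Suc A) - int i) (int b) (int i - 1)) +
      (\<Sum>i\<le>Suc A. (l i * qint (int m + int b - int (Suc A) - int i + 1)) \<cdot> Fmon act \<eta> (int A - int i) (int b) (int i))"
    unfolding act_sum_right gen_scale E1_Fmon sum.distrib[symmetric]
    by (intro sum.cong refl) (simp add: scale_right_distrib algebra_simps)
  also have "(\<Sum>i\<le>Suc A. (l i * qint (int m - int i + 1)) \<cdot> Fmon act \<eta> (int (Suc A) - int i) (int b) (int i - 1)) =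
      (\<Sum>i\<le>A. (l (Suc i) * qint (int m - int i)) \<cdot> Fmon act \<eta> (int A - int i) (int b) (int i))"
    unfolding sum.atMost_Suc_shift by (simp add: Fmon_eq)
  also have "(\<Sum>i\<le>Suc A. (l i * qint (int m + int b - int (Suc A) - int i + 1)) \<cdot> Fmon act \<eta> (int A - int i) (int b) (int i)) =
      (\<Sum>i\<le>A. (l i * qint (int m + int b - int (Suc A) - int i + 1)) \<cdot> Fmon act \<eta> (int A - int i) (int b) (int i))"
    by (simp add: Fmon_eq)
  also have "(\<Sum>i\<le>A. (l (Suc i) * qint (int m - int i)) \<cdot> Fmon act \<eta> (int A - int i) (int b) (int i)) + \<dots> =
      (\<Sum>i\<le>A. k i \<cdot> Fmon act \<eta> (int A - int i) (int b) (int i))"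
    unfolding sum.distrib[symmetric] by (intro sum.cong refl) (simp add: k_def scale_left_distrib)
  finally have rel: "(\<Sum>i\<le>A. k i \<cdot> Fmon act \<eta> (int A - int i) (int b) (int i)) = 0" ..
  have k0: "k i = 0" if "b \<le> n + i" for i
    by (rule Suc.IH[OF _ _ rel that]) (use Suc.prems(1,2) in \<open>auto simp: k_def\<close>)
  have rec: "l j * qint (int m + int b - int (Suc A) - int j + 1) = - (l (Suc j) * qint (int m - int j))"
    if "j < Suc A" "b \<le> n + j" for j
    using k0[OF that(2)] that(1) by (simp add: k_def add_eq_0_iff2 del: of_nat_Suc)
  show ?case
    by (rule Fmon_relation_alternating[OF Suc.prems(1) _ Suc.prems(3) rec Suc.prems(4)]) (use Suc.prems(2) in auto)
qed

text \<open>The weight for K_1 separates the values of \<open>x + y\<close>. For a fixed value the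
  power of F_2 is constant, and \<open>Fmon_relation_trivial\<close> applies.\<close>

lemma Fmon_independent:
  assumes "a + c \<le> b" and "c \<le> m" and "b \<le> n + c"
    and sum0: "(\<Sum>(x, y)\<in>{..a} \<times> {..c}. g x y \<cdot> Fmon act \<eta> (int a - int x) (int b - int x - int y) (int c - int y)) = 0"
    and "x \<le> a" and "y \<le> c"
  shows "g x y = 0"
proof -
  define M where "M = (\<lambda>(x, y). g x y \<cdot> Fmon act \<eta> (int a - int x) (int b - int x - int y) (int c - int y))"
  define v where "v s = (\<Sum>p\<in>{p \<in> {..a} \<times> {..c}. fst p + snd p = s}. M p)" for s
  have "wt I1 (int m - 2 * int a - 2 * int c + int b + int s) (v s)" for s
    unfolding v_def
  proof (rule wt_sum)
    fix p assume "p \<in> {p \<in> {..a} \<times> {..c}. fst p + snd p = s}"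
    then obtain x y where p: "p = (x, y)" "x + y = s"
      by (cases p) auto
    have eq: "int m - 2 * int a - 2 * int c + int b + int s =
        int m - 2 * (int c - int y) + (int b - int x - int y) - 2 * (int a - int x)"
      using p by auto
    show "wt I1 (int m - 2 * int a - 2 * int c + int b + int s) (M p)"
      unfolding eq unfolding p(1) M_def prod.case by (rule wt_scale[OF wt_Fmon])
  qed
  moreover have "(\<Sum>s\<le>a + c. v s) = 0"
  proof -
    have "(\<Sum>s\<le>a + c. v s) = (\<Sum>p\<in>{..a} \<times> {..c}. M p)"
      unfolding v_def by (intro sum.group) auto
    then show ?thesis
      using sum0 by (simp add: M_def)
  qed
  ultimately have "v (x + y) = 0"
    using weights_independent[of "{..a + c}" I1 "int m - 2 * int a - 2 * int c + int b" v "x + y"]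
      \<open>x \<le> a\<close> \<open>y \<le> c\<close> by simp
  define s where "s = x + y"
  \<comment> \<open>The total power of F_1 in layer \<open>s\<close>. The relation is reindexed by
    the inner power \<open>i\<close> = c - y, with coefficient 0 outside the rectangle.\<close>
  define A where "A = a + c - s"
  define l where "l i = (if i \<le> c \<and> c \<le> s + i \<and> s + i \<le> a + c then g (s + i - c) (c - i) else 0)" for i
  have "v s = (\<Sum>i\<in>{i \<in> {..A}. i \<le> c \<and> c \<le> s + i \<and> s + i \<le> a + c}. l i \<cdot> Fmon act \<eta> (int A - int i) (int (b - s)) (int i))"
    unfolding v_def
  proof (rule sum.reindex_bij_witness[of _ "\<lambda>i. (s + i - c, c - i)" "\<lambda>p. c - snd p"])
    fix p assume "p \<in> {p \<in> {..a} \<times> {..c}. fst p + snd p = s}"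
    then obtain x' y' where p: "p = (x', y')" "x' + y' = s" "x' \<le> a" "y' \<le> c"
      by (cases p) auto
    have "l (c - y') = g x' y'" "int A - int (c - y') = int a - int x'" "int (b - s) = int b - int x' - int y'"
      using p \<open>a + c \<le> b\<close> by (auto simp: l_def A_def)
    then show "l (c - snd p) \<cdot> Fmon act \<eta> (int A - int (c - snd p)) (int (b - s)) (int (c - snd p)) = M p"
      using p by (simp add: M_def)
  qed (auto simp: A_def)
  also have "\<dots> = (\<Sum>i\<le>A. l i \<cdot> Fmon act \<eta> (int A - int i) (int (b - s)) (int i))"
    by (rule sum.mono_neutral_left) (auto simp: l_def)
  finally have "(\<Sum>i\<le>A. l i \<cdot> Fmon act \<eta> (int A - int i) (int (b - s)) (int i)) = 0"
    using \<open>v (x + y) = 0\<close> by (simp add: s_def)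
  moreover have "l i = 0" if "i > A \<or> i > m" for i
    using that \<open>c \<le> m\<close> \<open>x \<le> a\<close> \<open>y \<le> c\<close> by (auto simp: l_def A_def s_def)
  moreover have "A \<le> b - s" "b - s \<le> n + (c - y)"
    using assms by (auto simp: A_def s_def)
  ultimately have "l (c - y) = 0"
    using Fmon_relation_trivial[of A "b - s" l "c - y"] by blast
  then show ?thesis
    using \<open>x \<le> a\<close> \<open>y \<le> c\<close> by (simp add: l_def s_def split: if_splits)
qed

end

section \<open>Bar invariance and uniqueness\<close>

lemma Fract_sum: "Fract (\<Sum>i\<in>I. f i) 1 = (\<Sum>i\<in>I. Fract (f i) (1 :: 'a::idom))"
proof -
  have "Fract (x + y) 1 = Fract x 1 + Fract y (1 :: 'a)" for x y
    by simp
  then show ?thesis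
    by (induction I rule: infinite_finite_induct) (simp_all add: Zero_fract_def del: add_fract)
qed

lemma Fract_of_int: "Fract (of_int k) 1 = of_int k"
proof (cases k rule: int_cases2)
  case (nonneg n)
  then show ?thesis by (simp add: Fract_of_nat_eq)
next
  case (nonpos n)
  then show ?thesis by (simp add: Fract_of_nat_eq flip: minus_fract)
qed

lemma Fract_monom: "Fract (monom (of_int k) n) 1 = of_int k * qq ^ n"
proof (induction n)
  case 0
  have "monom (of_int k) 0 = (of_int k :: rat poly)"
    by (simp add: monom_0 of_int_poly)
  then show ?case
    by (simp add: Fract_of_int)
next
  case (Suc n)
  have "monom (of_int k) (Suc n) = [:0, 1:] * monom (of_int k :: rat) n"
    by (simp add: monom_Suc)
  then have "Fract (monom (of_int k) (Suc n)) 1 = qq * Fract (monom (of_int k) n) 1"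
    by (simp add: qq_def)
  then show ?case
    using Suc by simp
qed

text \<open>Multiplying by q^(d+1) gives a polynomial equation whose left side has degrees 0 to d
  and whose right side has degrees d+2 to 2d+2, so no cancellation is possible.\<close>

lemma inversion_symmetric_eq_0:
  fixes p :: "int poly"
  assumes "inverse qq * poly (map_poly of_int p) (inverse qq) = qq * poly (map_poly of_int p) qq"
  shows "p = 0"
proof -
  define d where "d = degree p"
  define r :: "rat poly" where
    "r = (\<Sum>i\<le>d. monom (of_int (coeff p i)) (d - i)) - (\<Sum>i\<le>d. monom (of_int (coeff p i)) (d + 2 + i))"
  have eval: "poly (map_poly of_int p) x = (\<Sum>i\<le>d. of_int (coeff p i) * x ^ i)" for x :: qfield
    by (simp add: poly_altdef degree_map_poly d_def coeff_map_poly)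
  have "Fract r 1 = (\<Sum>i\<le>d. of_int (coeff p i) * qq ^ (d - i)) - (\<Sum>i\<le>d. of_int (coeff p i) * qq ^ (d + 2 + i))"
  proof -
    have "Fract (x - y) 1 = Fract x 1 - Fract y 1" for x y :: "rat poly"
      by simp
    then show ?thesis
      unfolding r_def by (simp only: Fract_sum Fract_monom)
  qed
  also have "(\<Sum>i\<le>d. of_int (coeff p i) * qq ^ (d - i)) = qq ^ d * poly (map_poly of_int p) (inverse qq)"
    unfolding eval sum_distrib_left by (intro sum.cong refl) (simp add: power_diff power_inverse divide_inverse)
  also have "(\<Sum>i\<le>d. of_int (coeff p i) * qq ^ (d + 2 + i)) = qq ^ (d + 2) * poly (map_poly of_int p) qq"
    unfolding eval sum_distrib_left by (intro sum.cong refl) (simp add: power_add)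
  also have "qq ^ (d + 2) * poly (map_poly of_int p) qq = qq ^ d * poly (map_poly of_int p) (inverse qq)"
  proof -
    have "qq ^ (d + 2) * poly (map_poly of_int p) qq = qq ^ (d + 1) * (qq * poly (map_poly of_int p) qq)"
      by simp
    then show ?thesis
      unfolding assms[symmetric] by simp
  qed
  finally have "r = 0"
    by (simp add: Zero_fract_def eq_fract)
  have "coeff p j = 0" for j
  proof (cases "j \<le> d")
    case True
    have "coeff r (d + 2 + j) = - of_int (coeff p j)"
      using True unfolding r_def by (simp add: coeff_sum if_distrib cong: if_cong) (intro sum.neutral ballI if_not_P, linarith)
    then show ?thesis
      using \<open>r = 0\<close> by simp
  qed (simp add: d_def coeff_eq_0)
  then show ?thesis
    by (simp add: poly_eq_iff)
qed

lemma qinv_Z_qinv_diff: "x \<in> qinv_Z_qinv \<Longrightarrow> y \<in> qinv_Z_qinv \<Longrightarrow> x - y \<in> qinv_Z_qinv"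
proof -
  have "map_poly of_int p - map_poly of_int p' = (map_poly of_int (p - p') :: qfield poly)" for p p'
    by (simp add: poly_eq_iff coeff_map_poly)
  then show "x \<in> qinv_Z_qinv \<Longrightarrow> y \<in> qinv_Z_qinv \<Longrightarrow> x - y \<in> qinv_Z_qinv"
    unfolding qinv_Z_qinv_def by (auto simp flip: poly_diff right_diff_distrib)
qed

section \<open>The involution \<Psi> and conjugation of scalars\<close>

locale psi_module = L_module act \<eta> m n for act :: "uq \<Rightarrow> 'v::ab_group_add \<Rightarrow> 'v" and \<eta> m n +
  fixes \<sigma> :: "int \<times> int" and \<psi> :: "uq \<Rightarrow> uq" and \<Psi> :: "'v \<Rightarrow> 'v"
  assumes psi: "is_psi_i \<sigma> \<psi>" and Psi: "is_psi_L \<sigma> \<psi> act \<eta> \<Psi>"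
begin

lemma Psi_add: "\<Psi> (v + w) = \<Psi> v + \<Psi> w"
  and Psi_qq: "\<Psi> (qq \<cdot> v) = inverse qq \<cdot> \<Psi> v"
  and Psi_Psi [simp]: "\<Psi> (\<Psi> v) = v"
  and Psi_act_eta: "u \<in> Ui \<sigma> \<Longrightarrow> \<Psi> (act u \<eta>) = act (\<psi> u) \<eta>"
  using Psi by (auto simp: is_psi_L_def)

lemma Psi_0 [simp]: "\<Psi> 0 = 0"
  using Psi_add[of 0 0] by simp

lemma Psi_minus: "\<Psi> (- v) = - \<Psi> v"
  using Psi_add[of v "- v"] by (simp add: add_eq_0_iff)

lemma Psi_diff: "\<Psi> (v - w) = \<Psi> v - \<Psi> w"
  using Psi_add[of v "- w"] by (simp add: Psi_minus)

lemma Psi_sum: "\<Psi> (\<Sum>i\<in>I. f i) = (\<Sum>i\<in>I. \<Psi> (f i))"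
  by (induction I rule: infinite_finite_induct) (auto simp: Psi_add)

text \<open>Conjugation q to q^-1, read off from \<Psi> instead of constructed as a field
  automorphism. \<open>bar_pair_unique\<close> and \<open>bar_pair_exists\<close> show that the
  relation is a function.\<close>

definition bar_pair :: "qfield \<Rightarrow> qfield \<Rightarrow> bool" where
  "bar_pair f g \<longleftrightarrow> (\<forall>v. \<Psi> (f \<cdot> v) = g \<cdot> \<Psi> v)"

lemma Psi_scale: "bar_pair f g \<Longrightarrow> \<Psi> (f \<cdot> v) = g \<cdot> \<Psi> v"
  by (simp add: bar_pair_def)

lemma bar_pair_0: "bar_pair 0 0"
  and bar_pair_1: "bar_pair 1 1"
  and bar_pair_qq: "bar_pair qq (inverse qq)"
  by (simp_all add: bar_pair_def Psi_qq)

lemma bar_pair_add: "bar_pair f g \<Longrightarrow> bar_pair f' g' \<Longrightarrow> bar_pair (f + f') (g + g')"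
  by (simp add: bar_pair_def scale_left_distrib Psi_add)

lemma bar_pair_diff: "bar_pair f g \<Longrightarrow> bar_pair f' g' \<Longrightarrow> bar_pair (f - f') (g - g')"
  by (simp add: bar_pair_def scale_left_diff_distrib Psi_diff)

lemma bar_pair_minus: "bar_pair f g \<Longrightarrow> bar_pair (- f) (- g)"
  using bar_pair_diff[OF bar_pair_0] by simp

lemma bar_pair_mult: "bar_pair f g \<Longrightarrow> bar_pair f' g' \<Longrightarrow> bar_pair (f * f') (g * g')"
  unfolding bar_pair_def by (simp flip: scale_scale)

lemma bar_pair_unique: "bar_pair f g \<Longrightarrow> bar_pair f g' \<Longrightarrow> g = g'"
proof -
  assume "bar_pair f g" "bar_pair f g'"
  then have "g \<cdot> \<Psi> (\<Psi> \<eta>) = g' \<cdot> \<Psi> (\<Psi> \<eta>)"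
    by (metis Psi_scale)
  then show ?thesis
    using eta_nonzero by simp
qed

lemma bar_pair_inverse:
  assumes "bar_pair f g"
  shows "bar_pair (inverse f) (inverse g)"
proof (cases "f = 0")
  case True
  then show ?thesis
    using bar_pair_unique[OF assms, of 0] bar_pair_0 by simp
next
  case False
  have "g \<noteq> 0"
  proof
    assume "g = 0"
    then have "\<Psi> (\<Psi> (f \<cdot> \<eta>)) = 0"
      using Psi_scale[OF assms] by simp
    then show False
      using False eta_nonzero by simp
  qed
  moreover have "\<Psi> v = g \<cdot> \<Psi> (inverse f \<cdot> v)" for v
    using Psi_scale[OF assms, of "inverse f \<cdot> v"] False by simp
  ultimately show ?thesis
    unfolding bar_pair_def by (metis scale_scale left_inverse scale_one)
qed

lemma bar_pair_divide: "bar_pair f g \<Longrightarrow> bar_pair f' g' \<Longrightarrow> bar_pair (f / f') (g / g')"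
  by (simp add: divide_inverse bar_pair_mult bar_pair_inverse)

lemma bar_pair_power: "bar_pair f g \<Longrightarrow> bar_pair (f ^ k) (g ^ k)"
  by (induction k) (auto intro: bar_pair_mult bar_pair_1)

lemma bar_pair_powi: "bar_pair (qq powi r) (qq powi (- r))"
  using bar_pair_power[OF bar_pair_qq, of "nat r"] bar_pair_power[OF bar_pair_inverse[OF bar_pair_qq], of "nat (- r)"]
  by (auto simp: power_int_def power_inverse)

lemma bar_pair_prod: "(\<And>i. i \<in> I \<Longrightarrow> bar_pair (f i) (g i)) \<Longrightarrow> bar_pair (\<Prod>i\<in>I. f i) (\<Prod>i\<in>I. g i)"
  by (induction I rule: infinite_finite_induct) (auto intro: bar_pair_mult bar_pair_1)

text \<open>Conjugation changes the sign of both numerator and denominator.\<close>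

lemma bar_pair_qint: "bar_pair (qint r) (qint r)"
proof -
  have "bar_pair (qint r) ((qq powi (- r) - qq powi (- (- r))) / (inverse qq - qq powi (- (- 1))))"
    unfolding qint_def by (intro bar_pair_divide bar_pair_diff bar_pair_powi bar_pair_qq)
  also have "(qq powi (- r) - qq powi (- (- r))) / (inverse qq - qq powi (- (- 1))) = qint r"
  proof -
    have "(qq powi (- r) - qq powi (- (- r))) / (inverse qq - qq powi (- (- 1))) =
        (- (qq powi r - qq powi (- r))) / (- (qq - qq powi (- 1)))"
      by (simp add: power_int_minus)
    then show ?thesis
      unfolding minus_divide_divide qint_def .
  qed
  finally show ?thesis .
qed

lemma bar_pair_qfact: "bar_pair (qfact k) (qfact k)"
  unfolding qfact_def by (intro bar_pair_prod bar_pair_qint)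

lemma bar_pair_qstep: "bar_pair (qstep s k) (qstep s k)"
  unfolding qstep_def by (intro bar_pair_prod bar_pair_qint)

lemma bar_pair_of_int: "bar_pair (of_int k) (of_int k)"
proof -
  have "bar_pair (of_nat n) (of_nat n)" for n
    by (induction n) (auto intro: bar_pair_add bar_pair_1 bar_pair_0)
  then show ?thesis
    by (cases k rule: int_cases2) (auto intro: bar_pair_minus)
qed

lemma bar_pair_icoef: "bar_pair (icoef \<alpha> l) (icoef \<alpha> l)"
  unfolding icoef_def
  by (auto intro!: bar_pair_mult bar_pair_divide bar_pair_power bar_pair_minus bar_pair_1
    bar_pair_qfact bar_pair_qstep bar_pair_qint)

lemma bar_pair_poly: "bar_pair (poly (map_poly of_int p) (inverse qq)) (poly (map_poly of_int p) qq)"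
proof (induction p)
  case (pCons a p)
  have "bar_pair (inverse qq) qq"
    using bar_pair_inverse[OF bar_pair_qq] by simp
  then show ?case
    using pCons by (simp add: map_poly_pCons bar_pair_add bar_pair_mult bar_pair_of_int)
qed (simp add: bar_pair_0)

text \<open>Rational constants are quotients of integers, polynomials arise from constants and
  \<open>qq\<close> by Horner's scheme, and all other elements are quotients of polynomials.\<close>

lemma bar_pair_exists: "\<exists>g. bar_pair f g"
proof -
  have const: "\<exists>g. bar_pair (Fract [:c:] 1) g" for c :: rat
  proof (cases c)
    case (Fract k d)
    then have "Fract [:c:] 1 * of_int d = (of_int k :: qfield)"
      by (simp add: Fract_of_int[symmetric] of_int_poly Fract_of_int_quotient)
    then have "Fract [:c:] 1 = of_int k / (of_int d :: qfield)"
      using Fract by (simp add: field_simps)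
    then show ?thesis
      using bar_pair_divide[OF bar_pair_of_int bar_pair_of_int] by auto
  qed
  have poly: "\<exists>g. bar_pair (Fract p 1) g" for p
  proof (induction p)
    case 0
    show ?case
      using bar_pair_0 by (auto simp: Zero_fract_def)
  next
    case (pCons c p)
    have "Fract (pCons c p) 1 = Fract [:c:] 1 + qq * Fract p 1"
      by (simp add: qq_def)
    then show ?case
      using const[of c] pCons bar_pair_add bar_pair_mult bar_pair_qq by metis
  qed
  obtain x y where "f = Fract x y"
    by (cases f) auto
  then have "f = Fract x 1 / Fract y 1"
    by simp
  then show ?thesis
    using poly bar_pair_divide by metis
qed

text \<open>Conjugation sends q^-1 p(q^-1) to q p(q), so a fixed element satisfies the symmetry
  excluded by \<open>inversion_symmetric_eq_0\<close>.\<close>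

lemma bar_pair_qinv_fixed: "f \<in> qinv_Z_qinv \<Longrightarrow> bar_pair f f \<Longrightarrow> f = 0"
proof -
  assume "f \<in> qinv_Z_qinv" and fixed: "bar_pair f f"
  then obtain p :: "int poly" where f: "f = inverse qq * poly (map_poly of_int p) (inverse qq)"
    by (auto simp: qinv_Z_qinv_def)
  have "bar_pair (inverse qq * poly (map_poly of_int p) (inverse qq)) (qq * poly (map_poly of_int p) qq)"
    using bar_pair_inverse[OF bar_pair_qq] by (intro bar_pair_mult bar_pair_poly) simp
  then have "f = qq * poly (map_poly of_int p) qq"
    using fixed bar_pair_unique unfolding f by blast
  then have "p = 0"
    by (intro inversion_symmetric_eq_0) (simp add: f)
  then show ?thesis
    by (simp add: f)
qed

lemma psi_mult: "x \<in> Ui \<sigma> \<Longrightarrow> y \<in> Ui \<sigma> \<Longrightarrow> \<psi> (x * y) = \<psi> x * \<psi> y"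
  using psi by (simp add: is_psi_i_def)

lemma psi_iB_power: "iB \<sigma> i ^ k \<in> Ui \<sigma>" "\<psi> (iB \<sigma> i ^ k) = iB \<sigma> i ^ k"
proof -
  have one: "1 \<in> Ui \<sigma>" "\<psi> 1 = 1"
  proof -
    show "1 \<in> Ui \<sigma>"
      using Ui.scal[of 1] by (simp add: scal_1)
    have "(1 :: qfield) = Fract [:1:] 1"
      by (simp add: One_fract_def pCons_one)
    then show "\<psi> 1 = 1"
      using psi unfolding is_psi_i_def by (metis scal_1)
  qed
  have "iB \<sigma> i ^ k \<in> Ui \<sigma> \<and> \<psi> (iB \<sigma> i ^ k) = iB \<sigma> i ^ k"
  proof (induction k)
    case (Suc k)
    then show ?case
      using psi_mult[OF Ui.iB] psi by (auto simp: is_psi_i_def intro: Ui.mult Ui.iB)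
  qed (simp add: one)
  then show "iB \<sigma> i ^ k \<in> Ui \<sigma>" "\<psi> (iB \<sigma> i ^ k) = iB \<sigma> i ^ k"
    by auto
qed

text \<open>\<psi> fixes every word in the generators \<open>iB\<close>, and the factorials in the
  divided powers are self-conjugate.\<close>

lemma Psi_Bmon: "\<Psi> (Bmon \<sigma> act \<eta> (int a) (int b) (int c)) = Bmon \<sigma> act \<eta> (int a) (int b) (int c)"
proof -
  define u where "u = iB \<sigma> I1 ^ a * iB \<sigma> I2 ^ b * iB \<sigma> I1 ^ c"
  define f where "f = 1 / qfact a * (1 / qfact b * (1 / qfact c))"
  have "u \<in> Ui \<sigma>" "\<psi> u = u"
    unfolding u_def by (simp_all add: psi_mult psi_iB_power Ui.mult)
  then have "\<Psi> (act u \<eta>) = act u \<eta>"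
    using Psi_act_eta by simp
  moreover have "Bmon \<sigma> act \<eta> (int a) (int b) (int c) = f \<cdot> act u \<eta>"
    by (simp add: Bmon_def divpow_def u_def f_def act_mult
      act_scale[of "iB \<sigma> I1 ^ a"] act_scale[of "iB \<sigma> I2 ^ b"])
  moreover have "bar_pair f f"
    unfolding f_def by (intro bar_pair_mult bar_pair_divide bar_pair_1 bar_pair_qfact)
  ultimately show ?thesis
    using Psi_scale by simp
qed

definition Bterm :: "int \<Rightarrow> int \<Rightarrow> nat \<Rightarrow> nat \<Rightarrow> nat \<Rightarrow> qfield" where
  "Bterm b c a k x = scoef (b + snd \<sigma> - int n - c) (int m - c) k *
     scoef (int a + fst \<sigma> - (int m - 2 * (c - int k)) - (b - int k)) (int n + c - b) x"

lemma Bmon_expand':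
  "Bmon \<sigma> act \<eta> (int a) (int b) (int c) = (\<Sum>(k, x)\<in>{..b} \<times> {..a}.
     Bterm (int b) (int c) a k x \<cdot> Fmon act \<eta> (int a - int x) (int b - int x - int k) (int c - int k))"
  by (simp add: Bmon_expand Bterm_def sum.cartesian_product)

end

section \<open>Unitriangularity of \<Psi> on the monomials, and uniqueness\<close>

locale monomial_span = psi_module act \<eta> m n \<sigma> \<psi> \<Psi>
  for act :: "uq \<Rightarrow> 'v::ab_group_add \<Rightarrow> 'v" and \<eta> m n \<sigma> \<psi> \<Psi> +
  fixes a b c :: nat
  assumes b_ge: "a + c \<le> b" and c_le: "c \<le> m" and b_le: "b \<le> n + c"
begin

definition mon :: "nat \<times> nat \<Rightarrow> 'v" where
  "mon p = Fmon act \<eta> (int a - int (fst p)) (int b - int (fst p) - int (snd p)) (int c - int (snd p))"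

text \<open>A decreasing filtration by the total shift x + y of the exponents; \<Psi> will be
  unitriangular for it, up to conjugation of scalars.\<close>

definition below :: "nat \<Rightarrow> 'v set" where
  "below s = {\<Sum>p\<in>{..a} \<times> {..c}. h p \<cdot> mon p | h. \<forall>p. fst p + snd p < s \<longrightarrow> h p = 0}"

lemma mon_eq_0: "p \<notin> {..a} \<times> {..c} \<Longrightarrow> mon p = 0"
  by (cases p) (auto simp: mon_def Fmon_eq)

lemma belowI: "(\<And>p. fst p + snd p < s \<Longrightarrow> h p = 0) \<Longrightarrow> (\<Sum>p\<in>{..a} \<times> {..c}. h p \<cdot> mon p) \<in> below s"
  by (auto simp: below_def)

lemma below_0: "0 \<in> below s"
  using belowI[of s "\<lambda>_. 0"] by simp

lemma below_add: "v \<in> below s \<Longrightarrow> w \<in> below s \<Longrightarrow> v + w \<in> below s"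
proof -
  assume "v \<in> below s" "w \<in> below s"
  then obtain h k where h: "v = (\<Sum>p\<in>{..a} \<times> {..c}. h p \<cdot> mon p)" "\<forall>p. fst p + snd p < s \<longrightarrow> h p = 0"
    and k: "w = (\<Sum>p\<in>{..a} \<times> {..c}. k p \<cdot> mon p)" "\<forall>p. fst p + snd p < s \<longrightarrow> k p = 0"
    by (auto simp: below_def)
  have "v + w = (\<Sum>p\<in>{..a} \<times> {..c}. (h p + k p) \<cdot> mon p)"
    unfolding h k by (simp add: scale_left_distrib sum.distrib)
  then show ?thesis
    by (simp only:) (rule belowI, simp add: h(2)[rule_format] k(2)[rule_format])
qed

lemma below_scale: "v \<in> below s \<Longrightarrow> r \<cdot> v \<in> below s"
proof -
  assume "v \<in> below s"
  then obtain h where h: "v = (\<Sum>p\<in>{..a} \<times> {..c}. h p \<cdot> mon p)" "\<forall>p. fst p + snd p < s \<longrightarrow> h p = 0"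
    by (auto simp: below_def)
  have "r \<cdot> v = (\<Sum>p\<in>{..a} \<times> {..c}. (r * h p) \<cdot> mon p)"
    unfolding h by (simp add: scale_sum_right)
  then show ?thesis
    by (simp only:) (rule belowI, simp add: h(2)[rule_format])
qed

lemma below_diff: "v \<in> below s \<Longrightarrow> w \<in> below s \<Longrightarrow> v - w \<in> below s"
  using below_add[OF _ below_scale[of w s "- 1"], of v] by simp

lemma below_sum: "(\<And>i. i \<in> I \<Longrightarrow> f i \<in> below s) \<Longrightarrow> (\<Sum>i\<in>I. f i) \<in> below s"
  by (induction I rule: infinite_finite_induct) (auto intro: below_0 below_add)

lemma mon_below: "s \<le> fst p + snd p \<Longrightarrow> mon p \<in> below s"
proof (cases "p \<in> {..a} \<times> {..c}")
  case True
  assume "s \<le> fst p + snd p"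
  have "(\<Sum>p'\<in>{..a} \<times> {..c}. (if p' = p then 1 else 0) \<cdot> mon p') \<in> below s"
    using \<open>s \<le> fst p + snd p\<close> by (intro belowI) auto
  also have "(\<Sum>p'\<in>{..a} \<times> {..c}. (if p' = p then 1 else 0) \<cdot> mon p') = (\<Sum>p'\<in>{..a} \<times> {..c}. if p' = p then mon p' else 0)"
    by (intro sum.cong) auto
  finally show ?thesis
    using True by (simp add: sum.delta)
qed (simp add: mon_eq_0 below_0)

lemma below_mono: "s \<le> t \<Longrightarrow> below t \<subseteq> below s"
  by (fastforce simp: below_def)

lemma below_empty: "a + c < s \<Longrightarrow> v \<in> below s \<Longrightarrow> v = 0"
proof -
  assume "a + c < s" "v \<in> below s"
  then obtain h where "v = (\<Sum>p\<in>{..a} \<times> {..c}. h p \<cdot> mon p)" "\<forall>p. fst p + snd p < s \<longrightarrow> h p = 0"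
    by (auto simp: below_def)
  then show ?thesis
    using \<open>a + c < s\<close> by (auto intro!: sum.neutral)
qed

text \<open>The B-monomial with the same exponents is invariant and has leading term
  \<open>mon p\<close> with coefficient 1; all its other terms are shifted further.\<close>

lemma Bmon_minus_mon:
  assumes "p \<in> {..a} \<times> {..c}"
  shows "\<exists>v. \<Psi> v = v \<and> v - mon p \<in> below (fst p + snd p + 1)"
proof -
  obtain x y where p: "p = (x, y)" "x \<le> a" "y \<le> c"
    using assms by auto
  define a' b' c' where "a' = a - x" and "b' = b - x - y" and "c' = c - y"
  have abc: "int a' = int a - int x" "int b' = int b - int x - int y" "int c' = int c - int y"
    using p b_ge by (auto simp: a'_def b'_def c'_def)
  define v where "v = Bmon \<sigma> act \<eta> (int a') (int b') (int c')"
  have mon: "Fmon act \<eta> (int a' - int x') (int b' - int x' - int k) (int c' - int k) = mon (x + x', y + k)" for x' k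
    unfolding mon_def abc by (simp add: algebra_simps)
  have "v = (\<Sum>(k, x')\<in>{..b'} \<times> {..a'}. Bterm (int b') (int c') a' k x' \<cdot> mon (x + x', y + k))"
    unfolding v_def Bmon_expand' mon ..
  also have "\<dots> = mon p + (\<Sum>(k, x')\<in>{..b'} \<times> {..a'} - {(0, 0)}. Bterm (int b') (int c') a' k x' \<cdot> mon (x + x', y + k))"
    by (subst sum.remove[of _ "(0, 0)"]) (auto simp: p Bterm_def)
  finally have "v - mon p = (\<Sum>(k, x')\<in>{..b'} \<times> {..a'} - {(0, 0)}. Bterm (int b') (int c') a' k x' \<cdot> mon (x + x', y + k))"
    by simp
  also have "\<dots> \<in> below (fst p + snd p + 1)"
    by (intro below_sum) (auto simp: p intro!: below_scale mon_below)
  finally show ?thesis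
    unfolding v_def using Psi_Bmon by blast
qed

lemma Psi_sum_below:
  assumes "\<And>p. p \<in> {..a} \<times> {..c} \<Longrightarrow> s \<le> fst p + snd p \<Longrightarrow> \<Psi> (mon p) \<in> below s" and "v \<in> below s"
  shows "\<Psi> v \<in> below s"
proof -
  obtain h where h: "v = (\<Sum>p\<in>{..a} \<times> {..c}. h p \<cdot> mon p)" "\<forall>p. fst p + snd p < s \<longrightarrow> h p = 0"
    using assms(2) by (auto simp: below_def)
  have "\<Psi> (h p \<cdot> mon p) \<in> below s" if "p \<in> {..a} \<times> {..c}" for p
  proof (cases "s \<le> fst p + snd p")
    case True
    obtain g where "bar_pair (h p) g"
      using bar_pair_exists by blast
    then show ?thesis
      using assms(1)[OF that True] by (simp add: Psi_scale below_scale)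
  qed (simp add: h(2)[rule_format] below_0)
  then show ?thesis
    unfolding h Psi_sum by (rule below_sum)
qed

text \<open>Downward induction from \<open>a + c + 1\<close>, where the filtration is zero. In layer
  \<open>s\<close> a monomial differs from an invariant vector by an element of the next layer,
  where the claim is known.\<close>

lemma Psi_below: "v \<in> below s \<Longrightarrow> \<Psi> v \<in> below s"
proof (cases "s \<le> a + c + 1")
  case True
  then show "v \<in> below s \<Longrightarrow> \<Psi> v \<in> below s"
  proof (induction arbitrary: v rule: inc_induct)
    case base
    then show ?case
      using below_empty[OF _ base] below_0 by simp
  next
    case (step s)
    have "\<Psi> (mon p) \<in> below s" if p: "p \<in> {..a} \<times> {..c}" "s \<le> fst p + snd p" for p
    proof (cases "s = fst p + snd p")
      case True
      obtain w where w: "\<Psi> w = w" "w - mon p \<in> below (Suc s)"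
        using Bmon_minus_mon[OF p(1)] True by auto
      have "\<Psi> (mon p) = mon p + ((w - mon p) - \<Psi> (w - mon p))"
        using w(1) by (simp add: Psi_diff)
      also have "\<dots> \<in> below s"
        by (rule below_add[OF mon_below[OF p(2)]
          subsetD[OF below_mono[of s "Suc s"] below_diff[OF w(2) step.IH[OF w(2)]]]]) simp
      finally show ?thesis .
    next
      case False
      then show ?thesis
        using p step.IH[OF mon_below[of "Suc s" p]] below_mono[of s "Suc s"] by auto
    qed
    then show ?case
      using step.prems by (rule Psi_sum_below)
  qed
next
  case False
  then show "v \<in> below s \<Longrightarrow> \<Psi> v \<in> below s"
    using below_empty[of s v] below_0 by simp
qed

lemma Psi_mon: "p \<in> {..a} \<times> {..c} \<Longrightarrow> \<Psi> (mon p) - mon p \<in> below (fst p + snd p + 1)"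
proof -
  assume "p \<in> {..a} \<times> {..c}"
  then obtain w where w: "\<Psi> w = w" "w - mon p \<in> below (fst p + snd p + 1)"
    using Bmon_minus_mon by blast
  have "\<Psi> (mon p) - mon p = (w - mon p) - \<Psi> (w - mon p)"
    using w(1) by (simp add: Psi_diff)
  then show ?thesis
    by (simp only: below_diff[OF w(2) Psi_below[OF w(2)]])
qed

lemma mon_independent:
  assumes "(\<Sum>p\<in>{..a} \<times> {..c}. h p \<cdot> mon p) = 0" and "p \<in> {..a} \<times> {..c}"
  shows "h p = 0"
  using Fmon_independent[OF b_ge c_le b_le, of "\<lambda>x y. h (x, y)" "fst p" "snd p"] assms
  by (auto simp: mon_def case_prod_beta)

text \<open>Induction on the total shift: once all coefficients of smaller shift vanish, \<Psi>
  conjugates those of layer \<open>s\<close> modulo the next layer. By independence they are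
  self-conjugate, hence zero by \<open>bar_pair_qinv_fixed\<close>.\<close>

lemma Psi_fixed_eq_0:
  assumes g: "\<And>p. g p \<in> qinv_Z_qinv" and fixed: "\<Psi> w = w" and w: "w = (\<Sum>p\<in>{..a} \<times> {..c}. g p \<cdot> mon p)"
  shows "w = 0"
proof -
  have "g p = 0" if "p \<in> {..a} \<times> {..c}" "fst p + snd p = s" for p s
    using that
  proof (induction s arbitrary: p rule: less_induct)
    case (less s)
    define bar where "bar f = (SOME f'. bar_pair f f')" for f
    have bar: "bar_pair f (bar f)" for f
      unfolding bar_def using bar_pair_exists by (rule someI_ex)
    have "\<Psi> (g p \<cdot> mon p) - bar (g p) \<cdot> mon p \<in> below (Suc s)" if "p \<in> {..a} \<times> {..c}" for p
    proof (cases "fst p + snd p < s")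
      case True
      then have "g p = 0"
        using less.IH that by blast
      moreover have "bar 0 = 0"
        using bar bar_pair_0 bar_pair_unique by blast
      ultimately show ?thesis
        by (simp add: below_0)
    next
      case False
      have "\<Psi> (g p \<cdot> mon p) - bar (g p) \<cdot> mon p = bar (g p) \<cdot> (\<Psi> (mon p) - mon p)"
        by (simp add: Psi_scale[OF bar] scale_right_diff_distrib)
      then show ?thesis
        using Psi_mon[OF that] below_mono[of "Suc s" "fst p + snd p + 1"] False by (auto intro: below_scale)
    qed
    then have "(\<Sum>p\<in>{..a} \<times> {..c}. \<Psi> (g p \<cdot> mon p) - bar (g p) \<cdot> mon p) \<in> below (Suc s)"
      by (rule below_sum)
    also have "(\<Sum>p\<in>{..a} \<times> {..c}. \<Psi> (g p \<cdot> mon p) - bar (g p) \<cdot> mon p) =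
        \<Psi> w - (\<Sum>p\<in>{..a} \<times> {..c}. bar (g p) \<cdot> mon p)"
      unfolding w Psi_sum by (rule sum_subtractf)
    also have "\<dots> = (\<Sum>p\<in>{..a} \<times> {..c}. (g p - bar (g p)) \<cdot> mon p)"
      unfolding fixed unfolding w by (simp add: scale_left_diff_distrib sum_subtractf)
    finally obtain h where h: "(\<Sum>p\<in>{..a} \<times> {..c}. (g p - bar (g p)) \<cdot> mon p) = (\<Sum>p\<in>{..a} \<times> {..c}. h p \<cdot> mon p)"
      "\<forall>p. fst p + snd p < Suc s \<longrightarrow> h p = 0"
      by (auto simp: below_def)
    then have "(\<Sum>p\<in>{..a} \<times> {..c}. (g p - bar (g p) - h p) \<cdot> mon p) = 0"
      by (simp add: scale_left_diff_distrib sum_subtractf)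
    then have "g p - bar (g p) - h p = 0"
      using less.prems(1) by (rule mon_independent)
    then have "g p = bar (g p)"
      using h(2) less.prems(2) by simp
    then show ?case
      using bar_pair_qinv_fixed[OF g] bar by metis
  qed
  then show ?thesis
    unfolding w by (auto intro!: sum.neutral)
qed

text \<open>The finite set of the coset is arbitrary, but monomials outside the rectangle vanish,
  and coefficients can be extended by 0, also at (0,0).\<close>

lemma coset_expand:
  assumes "v \<in> icb_coset act \<eta> (int a) (int b) (int c)"
  shows "\<exists>g. (\<forall>p. g p \<in> qinv_Z_qinv) \<and> v = mon (0, 0) + (\<Sum>p\<in>{..a} \<times> {..c}. g p \<cdot> mon p)"
proof -
  obtain S g where S: "finite S" "(0, 0) \<notin> S" and g: "\<forall>x y. g x y \<in> qinv_Z_qinv"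
    and v: "v = Fmon act \<eta> (int a) (int b) (int c) +
        (\<Sum>(x, y)\<in>S. g x y \<cdot> Fmon act \<eta> (int a - int x) (int b - int x - int y) (int c - int y))"
    using assms by (auto simp: icb_coset_def)
  define h where "h p = (if p \<in> S then g (fst p) (snd p) else 0)" for p
  have "(\<Sum>(x, y)\<in>S. g x y \<cdot> Fmon act \<eta> (int a - int x) (int b - int x - int y) (int c - int y)) = (\<Sum>p\<in>S. h p \<cdot> mon p)"
    by (intro sum.cong refl) (auto simp: h_def mon_def)
  also have "\<dots> = (\<Sum>p\<in>{..a} \<times> {..c}. h p \<cdot> mon p)"
    by (rule sum.mono_neutral_cong) (use S in \<open>auto simp: h_def mon_eq_0\<close>)
  finally show ?thesis
    using g unfolding v by (intro exI[of _ h]) (auto simp: h_def mon_def)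
qed

lemma coset_Psi_unique:
  assumes "v \<in> icb_coset act \<eta> (int a) (int b) (int c)" "\<Psi> v = v"
    and "w \<in> icb_coset act \<eta> (int a) (int b) (int c)" "\<Psi> w = w"
  shows "v = w"
proof -
  obtain g h where g: "\<And>p. g p \<in> qinv_Z_qinv" "v = mon (0, 0) + (\<Sum>p\<in>{..a} \<times> {..c}. g p \<cdot> mon p)"
    and h: "\<And>p. h p \<in> qinv_Z_qinv" "w = mon (0, 0) + (\<Sum>p\<in>{..a} \<times> {..c}. h p \<cdot> mon p)"
    using coset_expand[OF assms(1)] coset_expand[OF assms(3)] by auto
  have "v - w = (\<Sum>p\<in>{..a} \<times> {..c}. (g p - h p) \<cdot> mon p)"
    unfolding g h by (simp add: scale_left_diff_distrib sum_subtractf)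
  moreover have "\<Psi> (v - w) = v - w"
    using assms by (simp add: Psi_diff)
  ultimately have "v - w = 0"
    using g(1) h(1) by (intro Psi_fixed_eq_0[of "\<lambda>p. g p - h p"]) (auto intro: qinv_Z_qinv_diff)
  then show ?thesis by simp
qed

end

section \<open>The iCanonical basis in terms of monomials\<close>

lemma sum_triangle:
  fixes f :: "nat \<Rightarrow> nat \<Rightarrow> 'a::comm_monoid_add"
  shows "(\<Sum>i\<le>n. \<Sum>j\<le>n - i. f i j) = (\<Sum>k\<le>n. \<Sum>i\<le>k. f i (k - i))"
proof -
  have "(\<Sum>i\<le>n. \<Sum>j\<le>n - i. f i j) = (\<Sum>(i, j)\<in>(SIGMA i:{..n}. {..n - i}). f i j)"
    by (simp add: sum.Sigma)
  also have "(SIGMA i:{..n}. {..n - i}) = {(i, j). i + j \<le> n}"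
    by auto
  finally show ?thesis
    by (simp add: sum.triangle_reindex_eq)
qed

context monomial_span
begin

text \<open>The coefficients coming from \<open>B\<^sub>1\<^sup>(\<^sup>a\<^sup>)\<close> involve \<open>b\<close>, \<open>c\<close> and the summation indices only through the
  final exponents, so they factor out of the sum over \<open>l\<close> in the candidate.\<close>

definition outer_coef :: "nat \<Rightarrow> nat \<Rightarrow> qfield" where
  "outer_coef y x = scoef (int a + fst \<sigma> - (int m - 2 * (int c - int y)) - (int b - int y)) (int (n + c - b)) x"

definition icb_candidate :: "int \<Rightarrow> 'v" where
  "icb_candidate \<alpha> = (\<Sum>l\<le>c. icoef \<alpha> l \<cdot> Bmon \<sigma> act \<eta> (int a) (int b - int l) (int c - int l))"

lemma Psi_icb_candidate: "\<Psi> (icb_candidate \<alpha>) = icb_candidate \<alpha>"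
  unfolding icb_candidate_def Psi_sum
proof (intro sum.cong refl)
  fix l assume "l \<in> {..c}"
  then have bl: "int b - int l = int (b - l)" "int c - int l = int (c - l)"
    using b_ge by auto
  show "\<Psi> (icoef \<alpha> l \<cdot> Bmon \<sigma> act \<eta> (int a) (int b - int l) (int c - int l)) =
      icoef \<alpha> l \<cdot> Bmon \<sigma> act \<eta> (int a) (int b - int l) (int c - int l)"
    unfolding bl by (simp only: Psi_scale[OF bar_pair_icoef] Psi_Bmon)
qed

text \<open>Lowering \<open>b\<close> and \<open>c\<close> together keeps \<open>b - c\<close>, so
  the inner coefficient sees \<open>l\<close> only through \<open>m - c + l\<close> and the outer
  one only through \<open>l + k\<close>. Terms with \<open>k > c - l\<close> contain a negative
  power of F_1.\<close>

lemma Bmon_shifted_expand: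
  assumes "l \<le> c"
  shows "Bmon \<sigma> act \<eta> (int a) (int b - int l) (int c - int l) =
    (\<Sum>k\<le>c - l. \<Sum>x\<le>a. (scoef (int b + snd \<sigma> - int n - int c) (int (m - c + l)) k * outer_coef (l + k) x) \<cdot> mon (x, l + k))"
proof -
  have bl: "int b - int l = int (b - l)" "int c - int l = int (c - l)"
    using assms b_ge by auto
  have "Bmon \<sigma> act \<eta> (int a) (int (b - l)) (int (c - l)) =
    (\<Sum>k\<le>b - l. \<Sum>x\<le>a. (scoef (int b + snd \<sigma> - int n - int c) (int (m - c + l)) k * outer_coef (l + k) x) \<cdot> mon (x, l + k))"
    unfolding Bmon_expand
  proof (intro sum.cong refl)
    fix k x
    have 1: "scoef (int (b - l) + snd \<sigma> - int n - int (c - l)) (int m - int (c - l)) k =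
        scoef (int b + snd \<sigma> - int n - int c) (int (m - c + l)) k"
      using assms c_le b_ge by (intro arg_cong2[where f = "\<lambda>e p. scoef e p k"]) auto
    have 2: "scoef (int a + fst \<sigma> - (int m - 2 * (int (c - l) - int k)) - (int (b - l) - int k)) (int n + int (c - l) - int (b - l)) x =
        outer_coef (l + k) x"
      unfolding outer_coef_def
      using assms b_le b_ge by (intro arg_cong2[where f = "\<lambda>e p. scoef e p x"]) auto
    have 3: "Fmon act \<eta> (int a - int x) (int (b - l) - int x - int k) (int (c - l) - int k) = mon (x, l + k)"
      unfolding mon_def bl[symmetric] by (simp add: algebra_simps)
    show "(scoef (int (b - l) + snd \<sigma> - int n - int (c - l)) (int m - int (c - l)) k *
        scoef (int a + fst \<sigma> - (int m - 2 * (int (c - l) - int k)) - (int (b - l) - int k)) (int n + int (c - l) - int (b - l)) x) \<cdot>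
        Fmon act \<eta> (int a - int x) (int (b - l) - int x - int k) (int (c - l) - int k) =
        (scoef (int b + snd \<sigma> - int n - int c) (int (m - c + l)) k * outer_coef (l + k) x) \<cdot> mon (x, l + k)"
      unfolding 1 2 3 ..
  qed
  also have "\<dots> = (\<Sum>k\<le>c - l. \<Sum>x\<le>a. (scoef (int b + snd \<sigma> - int n - int c) (int (m - c + l)) k * outer_coef (l + k) x) \<cdot> mon (x, l + k))"
    by (rule sum.mono_neutral_right) (use assms b_ge in \<open>auto simp: mon_eq_0 intro!: sum.neutral\<close>)
  finally show ?thesis
    unfolding bl .
qed

text \<open>Grouping by \<open>y = l + k\<close> takes \<open>outer_coef y x\<close> out of the sum
  over \<open>l\<close>, which \<open>sum_icoef_scoef\<close> then evaluates.\<close>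

lemma icb_candidate_expand:
  assumes "\<alpha> = int m - int n + int b - 2 * int c + snd \<sigma>" and "\<alpha> > 0"
  shows "icb_candidate \<alpha> = (\<Sum>y\<le>c. \<Sum>x\<le>a. (Rsum (nat \<alpha>) (m - c) y * outer_coef y x) \<cdot> mon (x, y))"
proof -
  \<comment> \<open>The exponent in the inner coefficients is \<alpha> - (m - c), the form required
    by \<open>sum_icoef_scoef\<close>.\<close>
  have e: "int b + snd \<sigma> - int n - int c = int (nat \<alpha>) - int (m - c)"
    using assms c_le by simp
  have "icb_candidate \<alpha> = (\<Sum>l\<le>c. \<Sum>k\<le>c - l. \<Sum>x\<le>a.
      (icoef \<alpha> l * scoef (int (nat \<alpha>) - int (m - c)) (int (m - c + l)) k * outer_coef (l + k) x) \<cdot> mon (x, l + k))"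
    unfolding icb_candidate_def
    by (intro sum.cong refl) (simp add: Bmon_shifted_expand e scale_sum_right mult.assoc)
  also have "\<dots> = (\<Sum>y\<le>c. \<Sum>l\<le>y. \<Sum>x\<le>a.
      (icoef \<alpha> l * scoef (int (nat \<alpha>) - int (m - c)) (int (m - c + l)) (y - l) * outer_coef y x) \<cdot> mon (x, y))"
    unfolding sum_triangle by (intro sum.cong refl) simp
  also have "\<dots> = (\<Sum>y\<le>c. \<Sum>x\<le>a. (Rsum (nat \<alpha>) (m - c) y * outer_coef y x) \<cdot> mon (x, y))"
  proof (rule sum.cong[OF refl])
    fix y
    have "(\<Sum>l\<le>y. \<Sum>x\<le>a. (icoef \<alpha> l * scoef (int (nat \<alpha>) - int (m - c)) (int (m - c + l)) (y - l) * outer_coef y x) \<cdot> mon (x, y)) =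
        (\<Sum>x\<le>a. ((\<Sum>l\<le>y. icoef \<alpha> l * scoef (int (nat \<alpha>) - int (m - c)) (int (m - c + l)) (y - l)) * outer_coef y x) \<cdot> mon (x, y))"
      by (subst sum.swap) (simp only: scale_sum_left[symmetric] sum_distrib_right)
    also have "(\<Sum>l\<le>y. icoef \<alpha> l * scoef (int (nat \<alpha>) - int (m - c)) (int (m - c + l)) (y - l)) = Rsum (nat \<alpha>) (m - c) y"
      using sum_icoef_scoef[of "nat \<alpha>" "m - c" y] assms by simp
    finally show "(\<Sum>l\<le>y. \<Sum>x\<le>a. (icoef \<alpha> l * scoef (int (nat \<alpha>) - int (m - c)) (int (m - c + l)) (y - l) * outer_coef y x) \<cdot> mon (x, y)) =
        (\<Sum>x\<le>a. (Rsum (nat \<alpha>) (m - c) y * outer_coef y x) \<cdot> mon (x, y))" .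
  qed
  finally show ?thesis .
qed

lemma icb_candidate_in_coset:
  assumes \<alpha>: "\<alpha> = int m - int n + int b - 2 * int c + snd \<sigma>" and pos: "\<alpha> > 0"
    and \<sigma>: "\<sigma> \<in> {(1, 0), (0, 1)}" and b_gt: "a + c < b"
  shows "icb_candidate \<alpha> \<in> icb_coset act \<eta> (int a) (int b) (int c)"
proof -
  define g where "g x y = (if x \<le> a \<and> y \<le> c \<and> (x, y) \<noteq> (0, 0) then Rsum (nat \<alpha>) (m - c) y * outer_coef y x else 0)" for x y
  have outer: "outer_coef y x \<in> qinv_Z_qinv" if "x > 0" for y x
    unfolding outer_coef_def
  proof (rule scoef_in_qinv_Z_qinv[OF _ that])
    \<comment> \<open>The entries of \<sigma> add up to 1, so the left side equals a + c - b + 1 -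
      \<alpha> - y.\<close>
    show "int a + fst \<sigma> - (int m - 2 * (int c - int y)) - (int b - int y) + int (n + c - b) \<le> 0"
      using \<alpha> pos \<sigma> b_gt b_le by auto
  qed
  \<comment> \<open>From \<open>b \<le> n + c\<close> and \<open>snd \<sigma> \<le> 1\<close>
    follows \<alpha> \<le> m - c + 1, the range in which \<open>Rsum\<close> lies in the
    ideal.\<close>
  have Rsum: "Rsum (nat \<alpha>) (m - c) y \<in> qinv_Z_qinv" if "y > 0" for y
    using \<alpha> pos \<sigma> b_le c_le that by (intro Rsum_in_qinv_Z_qinv) auto
  have g: "g x y \<in> qinv_Z_qinv" for x y
  proof (cases "y = 0")
    case True
    then show ?thesis
      using outer[of x 0] by (auto simp: g_def)
  next
    case False
    have "outer_coef y x \<in> Z_qinv"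
      using outer[of x y] by (cases x) (auto simp: outer_coef_def intro: qinv_Z_qinv_subset)
    then show ?thesis
      using False Rsum[of y] by (auto simp: g_def intro: qinv_Z_qinv_mult)
  qed
  have "icb_candidate \<alpha> = (\<Sum>(x, y)\<in>{..a} \<times> {..c}. (Rsum (nat \<alpha>) (m - c) y * outer_coef y x) \<cdot> mon (x, y))"
    unfolding icb_candidate_expand[OF \<alpha> pos] by (subst sum.swap) (simp add: sum.cartesian_product)
  also have "\<dots> = mon (0, 0) + (\<Sum>(x, y)\<in>{..a} \<times> {..c} - {(0, 0)}. (Rsum (nat \<alpha>) (m - c) y * outer_coef y x) \<cdot> mon (x, y))"
    by (subst sum.remove[of _ "(0, 0)"]) (auto simp: outer_coef_def)
  also have "(\<Sum>(x, y)\<in>{..a} \<times> {..c} - {(0, 0)}. (Rsum (nat \<alpha>) (m - c) y * outer_coef y x) \<cdot> mon (x, y)) =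
      (\<Sum>(x, y)\<in>{..a} \<times> {..c} - {(0, 0)}. g x y \<cdot> Fmon act \<eta> (int a - int x) (int b - int x - int y) (int c - int y))"
  proof (intro sum.cong refl)
    fix p assume "p \<in> {..a} \<times> {..c} - {(0, 0)}"
    then obtain x y where p: "p = (x, y)" and "x \<le> a" "y \<le> c" "(x, y) \<noteq> (0, 0)"
      by (cases p) auto
    then have "g x y = Rsum (nat \<alpha>) (m - c) y * outer_coef y x"
      unfolding g_def by simp
    then show "(case p of (x, y) \<Rightarrow> (Rsum (nat \<alpha>) (m - c) y * outer_coef y x) \<cdot> mon (x, y)) =
        (case p of (x, y) \<Rightarrow> g x y \<cdot> Fmon act \<eta> (int a - int x) (int b - int x - int y) (int c - int y))"
      by (simp add: p mon_def)
  qed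
  finally have "icb_candidate \<alpha> = Fmon act \<eta> (int a) (int b) (int c) +
      (\<Sum>(x, y)\<in>{..a} \<times> {..c} - {(0, 0)}. g x y \<cdot> Fmon act \<eta> (int a - int x) (int b - int x - int y) (int c - int y))"
    by (simp add: mon_def)
  moreover have "finite ({..a} \<times> {..c} - {(0, 0)})" "(0, 0) \<notin> {..a} \<times> {..c} - {(0, 0)}"
    by auto
  ultimately show ?thesis
    unfolding icb_coset_def using g by blast
qed

lemma icb_eq_candidate:
  assumes "\<alpha> = int m - int n + int b - 2 * int c + snd \<sigma>" and "\<alpha> > 0"
    and "\<sigma> \<in> {(1, 0), (0, 1)}" and "a + c < b"
  shows "icb act \<eta> \<Psi> (int a) (int b) (int c) = icb_candidate \<alpha>"
  unfolding icb_def
  using icb_candidate_in_coset[OF assms] Psi_icb_candidate coset_Psi_unique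
  by (intro the_equality) auto

end

context psi_module
begin

text \<open>Both parities of \<alpha> are covered, since the inversion below uses the formula at
  \<open>\<alpha> + int k\<close>.\<close>

lemma icb_eq:
  assumes "c \<le> m" and "b \<le> n + c" and "a + c < b" and "\<sigma> \<in> {(1, 0), (0, 1)}"
    and "\<alpha> = int m - int n + int b - 2 * int c + snd \<sigma>" and "\<alpha> > 0"
  shows "icb act \<eta> \<Psi> (int a) (int b) (int c) =
    (\<Sum>l\<le>c. icoef \<alpha> l \<cdot> Bmon \<sigma> act \<eta> (int a) (int b - int l) (int c - int l))"
proof -
  interpret monomial_span act \<eta> m n \<sigma> \<psi> \<Psi> a b c
    by unfold_locales (use assms in auto)
  show ?thesis
    using icb_eq_candidate assms unfolding icb_candidate_def by simp
qed

text \<open>Inserting \<open>icb_eq\<close> for every basis element and grouping by N = k + l leaves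
  the sums of \<open>sum_bcoef_icoef\<close>, which vanish for N > 0.\<close>

lemma Bmon_eq_sum_icb:
  assumes "c \<le> m" and "b \<le> n + c" and "a + c < b" and "\<sigma> \<in> {(1, 0), (0, 1)}"
    and \<alpha>: "\<alpha> = int m - int n + int b - 2 * int c + snd \<sigma>" and "\<alpha> > 0" and "even \<alpha>"
  shows "Bmon \<sigma> act \<eta> (int a) (int b) (int c) =
    (\<Sum>k\<le>c. bcoef \<alpha> k \<cdot> icb act \<eta> \<Psi> (int a) (int b - int k) (int c - int k))"
proof -
  let ?B = "\<lambda>l. Bmon \<sigma> act \<eta> (int a) (int b - int l) (int c - int l)"
  have "icb act \<eta> \<Psi> (int a) (int b - int k) (int c - int k) =
      (\<Sum>l\<le>c - k. icoef (\<alpha> + int k) l \<cdot> ?B (k + l))" if "k \<le> c" for k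
  proof -
    have k: "int (b - k) = int b - int k" "int (c - k) = int c - int k"
      using that assms by auto
    have "icb act \<eta> \<Psi> (int a) (int (b - k)) (int (c - k)) = (\<Sum>l\<le>c - k. icoef (\<alpha> + int k) l \<cdot>
        Bmon \<sigma> act \<eta> (int a) (int (b - k) - int l) (int (c - k) - int l))"
      by (rule icb_eq) (use assms that in auto)
    then show ?thesis
      unfolding k by (simp add: diff_diff_eq)
  qed
  then have "(\<Sum>k\<le>c. bcoef \<alpha> k \<cdot> icb act \<eta> \<Psi> (int a) (int b - int k) (int c - int k)) =
      (\<Sum>k\<le>c. \<Sum>l\<le>c - k. (bcoef \<alpha> k * icoef (\<alpha> + int k) l) \<cdot> ?B (k + l))"
    by (simp add: scale_sum_right)
  also have "\<dots> = (\<Sum>N\<le>c. \<Sum>k\<le>N. (bcoef \<alpha> k * icoef (\<alpha> + int k) (N - k)) \<cdot> ?B N)"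
    unfolding sum_triangle by (intro sum.cong refl) simp
  also have "\<dots> = (\<Sum>N\<le>c. if N = 0 then ?B 0 else 0)"
  proof (intro sum.cong refl)
    fix N
    show "(\<Sum>k\<le>N. (bcoef \<alpha> k * icoef (\<alpha> + int k) (N - k)) \<cdot> ?B N) = (if N = 0 then ?B 0 else 0)"
      using sum_bcoef_icoef[OF \<open>even \<alpha>\<close>, of N]
      by (cases "N = 0") (simp_all add: bcoef_def scale_sum_left[symmetric] del: scale_scale)
  qed
  finally show ?thesis
    by (simp add: sum.delta)
qed

end

theorem theorem5p6:
  fixes act :: "uq \<Rightarrow> 'v::ab_group_add \<Rightarrow> 'v"
    and \<eta> :: 'v
    and \<psi> :: "uq \<Rightarrow> uq"
    and \<Psi> :: "'v \<Rightarrow> 'v"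
    and \<sigma> :: "int \<times> int"
    and m n a b c :: nat
    and \<alpha> :: int
  assumes "\<sigma> \<in> {(1, 0), (0, 1)}"
    and "is_L act \<eta> m n"
    and "is_psi_i \<sigma> \<psi>"
    and "is_psi_L \<sigma> \<psi> act \<eta> \<Psi>"
    and "m \<ge> c"
    and "int n - int b + int c \<ge> 0"
    and "\<alpha> = int m - int n + int b - 2 * int c + snd \<sigma>"
    and "\<alpha> > 0"
    and "even \<alpha>"
    and "b > a + c"
  shows "Bmon \<sigma> act \<eta> (int a) (int b) (int c) =
      (\<Sum>k | k \<le> c \<and> even k.
         act (scal (if k = 0 then 1
                    else qint \<alpha> * (qstep (\<alpha> - int k + 2) (k - 1) / qfact k)))
           (icb act \<eta> \<Psi> (int a) (int b - int k) (int c - int k)))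
    + (\<Sum>k | k \<le> c \<and> odd k.
         act (scal (qstep (\<alpha> - int k + 1) k / qfact k))
           (icb act \<eta> \<Psi> (int a) (int b - int k) (int c - int k)))
    \<and> icb act \<eta> \<Psi> (int a) (int b) (int c) =
      (\<Sum>k = 0..c.
         act (scal ((- 1) ^ k * (qstep \<alpha> k / qfact k)))
           (Bmon \<sigma> act \<eta> (int a) (int b - int k) (int c - int k)))"
proof -
  interpret psi_module act \<eta> m n \<sigma> \<psi> \<Psi>
    by unfold_locales (use assms in \<open>auto simp: is_L_def simple_uq_module_def\<close>)
  let ?t = "\<lambda>k. bcoef \<alpha> k \<cdot> icb act \<eta> \<Psi> (int a) (int b - int k) (int c - int k)"
  have "Bmon \<sigma> act \<eta> (int a) (int b) (int c) = (\<Sum>k\<in>{k. k \<le> c \<and> even k} \<union> {k. k \<le> c \<and> odd k}. ?t k)"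
    using Bmon_eq_sum_icb[of c b a \<alpha>] assms by (auto intro!: sum.cong)
  also have "\<dots> = (\<Sum>k | k \<le> c \<and> even k. ?t k) + (\<Sum>k | k \<le> c \<and> odd k. ?t k)"
    by (rule sum.union_disjoint) auto
  finally have "Bmon \<sigma> act \<eta> (int a) (int b) (int c) =
      (\<Sum>k | k \<le> c \<and> even k. ?t k) + (\<Sum>k | k \<le> c \<and> odd k. ?t k)" .
  moreover have "(\<Sum>k | k \<le> c \<and> even k. ?t k) = (\<Sum>k | k \<le> c \<and> even k.
         act (scal (if k = 0 then 1
                    else qint \<alpha> * (qstep (\<alpha> - int k + 2) (k - 1) / qfact k)))
           (icb act \<eta> \<Psi> (int a) (int b - int k) (int c - int k)))"
    by (intro sum.cong refl) (simp add: bcoef_def)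
  moreover have "(\<Sum>k | k \<le> c \<and> odd k. ?t k) = (\<Sum>k | k \<le> c \<and> odd k.
         act (scal (qstep (\<alpha> - int k + 1) k / qfact k))
           (icb act \<eta> \<Psi> (int a) (int b - int k) (int c - int k)))"
    by (intro sum.cong refl) (auto simp: bcoef_def)
  moreover have "icb act \<eta> \<Psi> (int a) (int b) (int c) =
      (\<Sum>k = 0..c.
         act (scal ((- 1) ^ k * (qstep \<alpha> k / qfact k)))
           (Bmon \<sigma> act \<eta> (int a) (int b - int k) (int c - int k)))"
    using icb_eq[of c b a \<alpha>] assms by (auto simp: icoef_def atMost_atLeast0)
  ultimately show ?thesis
    by simp
qed

end
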